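(* Let $f_{\mathcal C}$ be the unique minimizer of $R$ over $\mathcal C$. Let $(\lambda_n)_{n}$ be a sequence in $]0,+\infty[$ converging to $0$ and, for every $n$, let $\hat f_n=A\,\widehat u_{n,\lambda_n}(Z_n)$. Then the following hold: \begin{enumerate} \item[(i)] Suppose that $\varepsilon(\lambda_n)/\lambda_n^{4/r}\to 0$ and that $1/(\lambda_n^{2/r}n^{1/2})\to 0$. Then $(\hat f_n)_n$ is weakly consistent, i.e., $\|\hat f_n-f_{\mathcal C}\|_{L^2}\to 0$ in probability. \item[(ii)] Suppose that $\varepsilon(\lambda_n)=O(1/n)$ and that $(\log n)/(\lambda_n^{2/r}n^{1/2})\to 0$. Then $(\hat f_n)_n$ is strongly consistent, i.e., $\|\hat f_n-f_{\mathcal C}\|_{L^2}\to 0$ $\mathsf P$-a.s. \item[(iii)] Suppose that $f_{\mathcal C}\in A(\operatorname{dom}G)$ and set $S=\operatorname{Argmin}_{\operatorname{dom}G}F$ (the set of minimizers of $F$ over $\operatorname{dom} G$). Then there exists a unique $u^\dag\in S$ which minimizes $G$ over $S$, and $Au^\dag=f_{\mathcal C}$. Moreover: \begin{enumerate} \item[(a)] Suppose that $\varepsilon(\lambda_n)/\lambda_n^2\to 0$ and that $1/(\lambda_n n^{1/2})\to 0$. Then $\|\widehat u_{n,\lambda_n}(Z_n)-u^\dag\|_r\to 0$ in probability. \item[(b)] Suppose that $\varepsilon(\lambda_n)=O(1/n)$ and that $(\log n)/(\lambda_n n^{1/2})\to 0$. Then $\|\widehat u_{n,\lambda_n}(Z_n)-u^\dag\|_r\to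 0$ $\mathsf P$-a.s. \end{enumerate} \end{enumerate}
   Context: Notation. $\mathbb N^*=\mathbb N\setminus\{0\}$, $\mathbb R_+=[0,+\infty[$, $\mathbb R_{++}=]0,+\infty[$. $\mathbb K$ is an at most countable index set; $\|\cdot\|_r$ is the norm of $\ell^r(\mathbb K)$. For a real Hilbert space $\mathcal H$, $\Gamma_0(\mathcal H)$ is the set of proper lower semicontinuous convex functions from $\mathcal H$ to $]-\infty,+\infty]$ and $\Gamma_0^+(\mathcal H)$ is the subset of those with values in $[0,+\infty]$. $\iota_C$ is the indicator function of $C$ ($0$ on $C$, $+\infty$ elsewhere), $\sigma_D(\mu)=\sup_{\nu\in D}\nu\mu$ is the support function of $D\subset\mathbb R$. For $\epsilon\geq 0$, $\operatorname{Argmin}^{\epsilon}\varphi$ is the set of $u$ with $\varphi(u)\le\inf\varphi+\epsilon$. $(t)_+=\max\{t,0\}$, $(t)_-=\max\{-t,0\}$, and $r^*=r/(r-1)$. Standing assumptions. $(\mathcal X,\mathfrak A_{\mathcal X})$ is a measurable space, $\mathcal Y\subset\mathbb R$ is a nonempty bounded interval, $b=\sup_{y\in\mathcal Y}|y|$, and $P$ is a probability measure on $\mathcal X\times\mathcal Y$ with marginal $P_{\mathcal X}$ on $\mathcal X$. The risk is $R\colon L^2(P_{\mathcal X})\to\mathbb R_+$, $R(f)=\int_{\mathcal X\times\mathcal Y}|f(x)-y|^2\,dP(x,y)$. $(\phi_k)_{k\in\mathbb K}$ is a family of measurable functions from $\mathcal X$ to $\mathbb R$ such that $\sup_{x\in\mathcal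 X}\sum_{k\in\mathbb K}|\phi_k(x)|^2\le\kappa^2$ for some $\kappa\in\mathbb R_{++}$. The operator $A$ maps $u=(\mu_k)_{k\in\mathbb K}\in\ell^2(\mathbb K)$ to $f_u=\sum_{k\in\mathbb K}\mu_k\phi_k$ (pointwise); it is a bounded linear operator from $\ell^2(\mathbb K)$ to $L^2(P_{\mathcal X})$. Moreover, for some fixed $r\in]1,2]$ and $\eta\in\mathbb R_{++}$: (a) $(C_k)_{k\in\mathbb K}$ is a family of closed intervals in $\mathbb R$ with $0\in\bigcap_k C_k$; (b) $(D_k)_{k\in\mathbb K}$ is a family of nonempty closed bounded intervals in $\mathbb R$ with $\sum_k|(\inf D_k)_+|^{r^*}<+\infty$ and $\sum_k|(\sup D_k)_-|^{r^*}<+\infty$; (c) $(h_k)_{k\in\mathbb K}$ is a family in $\Gamma_0^+(\mathbb R)$ such that, for every $k$, $h_k(0)=0$ and $h_k-\eta|\cdot|^r\in\Gamma_0^+(\mathbb R)$. Define $g_k=\iota_{C_k}+\sigma_{D_k}+h_k$; $F=R\circ A\colon\ell^2(\mathbb K)\to\mathbb R$; $G\colon\ell^2(\mathbb K)\to]-\infty,+\infty]$, $G(u)=\sum_{k}g_k(\mu_k)$ for $u=(\mu_k)_k$; $\operatorname{dom}G=\{u: G(u)<+\infty\}$; and $\mathcal C=\overline{A\big(\ell^2(\mathbb K)\cap\prod_{k}C_k\big)}$ (closure in $L^2(P_{\mathcal X})$). The risk $R$ has a unique minimizer over $\mathcal C$. $(X_i,Y_i)_{i\in\mathbb N}$ is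 a sequence of i.i.d. random variables on a probability space $(\Omega,\mathfrak A,\mathsf P)$, with values in $\mathcal X\times\mathcal Y$ and distribution $P$; for $n\in\mathbb N^*$, $Z_n=(X_i,Y_i)_{1\le i\le n}$. The function $\varepsilon\colon\mathbb R_{++}\to[0,1]$ satisfies $\varepsilon(\lambda)\to 0$ as $\lambda\to 0^+$. For every $n\in\mathbb N^*$, every $\lambda\in\mathbb R_{++}$ and every training set $z_n=(x_i,y_i)_{1\le i\le n}\in(\mathcal X\times\mathcal Y)^n$, $\widehat u_{n,\lambda}(z_n)$ is an element satisfying $$\widehat u_{n,\lambda}(z_n)\in\operatorname{Argmin}^{\varepsilon(\lambda)}_{u\in\ell^2(\mathbb K)}\Big(\frac1n\sum_{i=1}^n|f_u(x_i)-y_i|^2+\lambda G(u)\Big),$$ and $\widehat u_{n,\lambda}(Z_n)$ is the resulting random variable with values in $\ell^2(\mathbb K)$.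
   Formalization: Parts (i) and (ii) additionally assume that each C_k is contained in the closure of dom h_k; without this they fail (e.g. h_k the indicator of {0} with C_k = ℝ, where every estimator is 0 but f_C need not be). *)

theory Defs
  imports "HOL-Probability.Probability" "HOL-Library.Landau_Symbols"
begin

section \<open>Extended-real-valued convex functions\<close>

definition lsc :: "('a::topological_space \<Rightarrow> ereal) \<Rightarrow> bool" where
  "lsc f \<longleftrightarrow> (\<forall>x. f x \<le> Liminf (at x) f)"

definition Gamma0 :: "('a::real_normed_vector \<Rightarrow> ereal) set" where
  "Gamma0 = {f. (\<forall>x. f x \<noteq> -\<infinity>) \<and> (\<exists>x. f x \<noteq> \<infinity>) \<and> lsc f \<and>
     (\<forall>x y. \<forall>t\<in>{0<..<1}.
        f ((1 - t) *\<^sub>R x + t *\<^sub>R y) \<le> ereal (1 - t) * f x + ereal t * f y)}"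

definition Gamma0_plus :: "('a::real_normed_vector \<Rightarrow> ereal) set" where
  "Gamma0_plus = {f \<in> Gamma0. \<forall>x. 0 \<le> f x}"

definition indicator_fun :: "'a set \<Rightarrow> 'a \<Rightarrow> ereal" where
  "indicator_fun C x = (if x \<in> C then 0 else \<infinity>)"

definition support_fun :: "real set \<Rightarrow> real \<Rightarrow> ereal" where
  "support_fun D \<mu> = (SUP \<nu>\<in>D. ereal (\<nu> * \<mu>))"

definition Argmin :: "'a set \<Rightarrow> ('a \<Rightarrow> 'b::linorder) \<Rightarrow> 'a set" where
  "Argmin S \<phi> = {u. is_arg_min \<phi> (\<lambda>v. v \<in> S) u}"

definition Argmin_eps :: "real \<Rightarrow> 'a set \<Rightarrow> ('a \<Rightarrow> ereal) \<Rightarrow> 'a set" where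
  "Argmin_eps \<epsilon> S \<phi> = {u \<in> S. \<phi> u \<le> (INF v\<in>S. \<phi> v) + ereal \<epsilon>}"

section \<open>Sequence spaces over an index set\<close>

text \<open>A family indexed by \<open>K\<close> is represented by the total function that vanishes outside \<open>K\<close>,
  so that equality of families is equality of functions.\<close>

definition ell :: "real \<Rightarrow> 'k set \<Rightarrow> ('k \<Rightarrow> real) set" where
  "ell p K = {u. (\<forall>k. k \<notin> K \<longrightarrow> u k = 0) \<and> (\<lambda>k. \<bar>u k\<bar> powr p) summable_on K}"

definition ell_norm :: "real \<Rightarrow> 'k set \<Rightarrow> ('k \<Rightarrow> real) \<Rightarrow> ereal" where
  "ell_norm p K u =
     (if (\<lambda>k. \<bar>u k\<bar> powr p) summable_on K
      then ereal ((\<Sum>\<^sub>\<infinity>k\<in>K. \<bar>u k\<bar> powr p) powr (1 / p)) else \<infinity>)"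

definition ell2_borel :: "'k set \<Rightarrow> ('k \<Rightarrow> real) measure" where
  "ell2_borel K = sigma (ell 2 K)
     {U. openin (Metric_space.mtopology (ell 2 K)
            (\<lambda>u v. real_of_ereal (ell_norm 2 K (\<lambda>k. u k - v k)))) U}"

section \<open>Square-integrable functions, the risk and the synthesis operator\<close>

text \<open>Elements of \<open>L\<^sup>2(M)\<close> are represented by square-integrable functions; equality in \<open>L\<^sup>2(M)\<close> is
  equality almost everywhere.\<close>

definition L2_space :: "'x measure \<Rightarrow> ('x \<Rightarrow> real) set" where
  "L2_space M = {f \<in> borel_measurable M. integrable M (\<lambda>x. (f x)\<^sup>2)}"

definition L2_norm :: "'x measure \<Rightarrow> ('x \<Rightarrow> real) \<Rightarrow> ereal" where
  "L2_norm M f = (if f \<in> L2_space M then ereal (sqrt (\<integral>x. (f x)\<^sup>2 \<partial>M)) else \<infinity>)"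

definition L2_closure :: "'x measure \<Rightarrow> ('x \<Rightarrow> real) set \<Rightarrow> ('x \<Rightarrow> real) set" where
  "L2_closure M S =
     {f \<in> L2_space M. \<forall>e>0. \<exists>g\<in>S. L2_norm M (\<lambda>x. g x - f x) < ereal e}"

definition risk :: "('x \<times> real) measure \<Rightarrow> ('x \<Rightarrow> real) \<Rightarrow> real" where
  "risk P f = (\<integral>z. \<bar>f (fst z) - snd z\<bar>\<^sup>2 \<partial>P)"

definition synthesis :: "'k set \<Rightarrow> ('k \<Rightarrow> 'x \<Rightarrow> real) \<Rightarrow> ('k \<Rightarrow> real) \<Rightarrow> 'x \<Rightarrow> real" where
  "synthesis K \<phi> u = (\<lambda>x. \<Sum>\<^sub>\<infinity>k\<in>K. u k * \<phi> k x)"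

definition unique_minimizer_ae ::
    "'x measure \<Rightarrow> ('x \<Rightarrow> real) set \<Rightarrow> (('x \<Rightarrow> real) \<Rightarrow> real) \<Rightarrow> ('x \<Rightarrow> real) \<Rightarrow> bool" where
  "unique_minimizer_ae M S \<Phi> f \<longleftrightarrow>
     f \<in> Argmin S \<Phi> \<and> (\<forall>g\<in>Argmin S \<Phi>. AE x in M. g x = f x)"

section \<open>The penalty and the regularized empirical risk\<close>

text \<open>The penalty \<open>G\<close> is an unordered sum in the extended reals of terms of mixed sign. Under the
  hypotheses on \<open>C\<close>, \<open>D\<close> and \<open>h\<close> the negative parts have a finite sum for every \<open>u\<close>, and no term
  is \<open>-\<infinity>\<close>, so the sum always exists in \<open>]-\<infinity>,+\<infinity>]\<close>.\<close>

definition penalty :: "'k set \<Rightarrow> ('k \<Rightarrow> real set) \<Rightarrow> ('k \<Rightarrow> real set) \<Rightarrow>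
    ('k \<Rightarrow> real \<Rightarrow> ereal) \<Rightarrow> ('k \<Rightarrow> real) \<Rightarrow> ereal" where
  "penalty K C D h u =
     (\<Sum>\<^sub>\<infinity>k\<in>K. indicator_fun (C k) (u k) + support_fun (D k) (u k) + h k (u k))"

text \<open>The closed convex constraint set of the limit problem is built from the \<open>C k\<close> alone, but
  \<open>h k\<close> may take the value \<open>\<infinity>\<close> inside \<open>C k\<close> (\<open>h k = indicator_fun {0}\<close> with \<open>C k = UNIV\<close> is
  allowed). Every estimator lies in \<open>penalty_dom\<close>, so consistency towards the minimizer over the
  full constraint set needs \<open>C k \<subseteq> closure {t. h k t < \<infinity>}\<close>; this holds whenever the \<open>h k\<close> are
  real-valued.\<close>

definition penalty_dom :: "'k set \<Rightarrow> ('k \<Rightarrow> real set) \<Rightarrow> ('k \<Rightarrow> real set) \<Rightarrow>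
    ('k \<Rightarrow> real \<Rightarrow> ereal) \<Rightarrow> ('k \<Rightarrow> real) set" where
  "penalty_dom K C D h = {u \<in> ell 2 K. penalty K C D h u < \<infinity>}"

definition empirical_risk :: "nat \<Rightarrow> (nat \<Rightarrow> 'x \<times> real) \<Rightarrow> ('x \<Rightarrow> real) \<Rightarrow> real" where
  "empirical_risk n z f = (1 / real n) * (\<Sum>i=1..n. \<bar>f (fst (z i)) - snd (z i)\<bar>\<^sup>2)"

section \<open>Modes of convergence\<close>

text \<open>Indices start at \<open>1\<close>. Requiring measurability keeps the probabilities below meaningful,
  since \<^const>\<open>measure\<close> is \<open>0\<close> on non-measurable sets.\<close>

definition tendsto_zero_in_prob :: "'w measure \<Rightarrow> (nat \<Rightarrow> 'w \<Rightarrow> ereal) \<Rightarrow> bool" where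
  "tendsto_zero_in_prob M W \<longleftrightarrow>
     (\<forall>n\<ge>1. W n \<in> borel_measurable M) \<and>
     (\<forall>e>0. (\<lambda>n. measure M {\<omega> \<in> space M. ereal e < \<bar>W n \<omega>\<bar>}) \<longlonglongrightarrow> 0)"

definition tendsto_zero_ae :: "'w measure \<Rightarrow> (nat \<Rightarrow> 'w \<Rightarrow> ereal) \<Rightarrow> bool" where
  "tendsto_zero_ae M W \<longleftrightarrow> (AE \<omega> in M. (\<lambda>n. W n \<omega>) \<longlonglongrightarrow> 0)"

end

theory Submission
  imports Defs
begin

text \<open>With the response adjoined as an extra feature, \<open>A u x - y\<close> is linear in the feature vector, so the
  empirical and the true risk are quadratic forms in \<open>(1, u)\<close> and differ by at most
  \<open>(1 + \<parallel>u\<parallel>\<^sup>2) \<Delta>\<^sub>n\<close>, where \<open>\<Delta>\<^sub>n\<close> is the Hilbert--Schmidt norm of an average of centred i.i.d. matrices.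
  Chebyshev's inequality gives \<open>\<Delta>\<^sub>n = O(1 / sqrt n)\<close> in probability; Kolmogorov's maximal inequality on
  dyadic blocks and Borel--Cantelli give \<open>\<Delta>\<^sub>n = O(ln n / sqrt n)\<close> almost surely. Coercivity of the penalty
  bounds the squared norm of the estimator by a multiple of \<open>\<lambda> powr (- 2 / r)\<close>, so its risk tends to the
  infimum over \<open>dom G\<close>, and the parallelogram law turns this into convergence in \<open>L\<^sup>2\<close>. For (iii), the
  penalty is uniformly convex on bounded sets, so points of \<open>{F \<le> min F + \<gamma>}\<close> whose penalty is almost
  minimal there form a Cauchy family in \<open>\<ell>\<^sup>r\<close>. This gives \<open>u\<^sup>\<dagger>\<close> and the convergence of every family that
  nearly minimizes first \<open>F\<close> and then \<open>G\<close>.\<close>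

section \<open>Square-summable families\<close>

text \<open>The estimator depends on the sample, so a law of large numbers at a fixed point does not
  suffice; the quadratic form gives a bound that holds at all \<open>u\<close> simultaneously. This
  splits the argument: on the event that the deviation is small everything is deterministic, and
  probability enters only through the size of that event. The exponents come from this bound.
  Comparison with \<open>0\<close> gives \<open>l * psum u \<le> Q\<close>, hence a squared norm of
  order \<open>l powr (- 2 / r)\<close>, so in (i) and (ii) the deviation must be small against
  \<open>l powr (2 / r)\<close>. In (iii) the error terms are divided by \<open>l\<close> to bound
  the penalty, and the points compared stay in a fixed ball, so the deviation must be small against
  \<open>l\<close> itself. Families are plain functions and no weak compactness is used: limits are
  built coordinatewise from Cauchy estimates. For \<open>r < 2\<close> no bound of
  \<open>|s - t|^r\<close> by a multiple of the midpoint gap of \<open>|.|^r\<close> can hold near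
  the diagonal; this is why uniform convexity is used with a slack that is small relative to the
  norms.\<close>

lemma summable_on_sum_le:
  fixes f :: "'k \<Rightarrow> real"
  assumes "\<And>k. k \<in> K \<Longrightarrow> 0 \<le> f k" "\<And>J. finite J \<Longrightarrow> J \<subseteq> K \<Longrightarrow> sum f J \<le> c"
  shows "f summable_on K" "infsum f K \<le> c"
proof -
  show s: "f summable_on K"
    using assms by (intro nonneg_bdd_above_summable_on) (auto intro!: bdd_aboveI2)
  show "infsum f K \<le> c"
    using s assms(2) by (intro infsum_le_finite_sums) auto
qed

lemma summable_on_le:
  fixes f g :: "'k \<Rightarrow> real"
  assumes "\<And>k. k \<in> K \<Longrightarrow> 0 \<le> f k" "\<And>k. k \<in> K \<Longrightarrow> f k \<le> g k" "g summable_on K"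
  shows "f summable_on K" "infsum f K \<le> infsum g K"
proof -
  show s: "f summable_on K"
    using assms(3) by (rule summable_on_comparison_test) (use assms in auto)
  show "infsum f K \<le> infsum g K"
    by (rule infsum_mono[OF s assms(3) assms(2)])
qed

lemma finite_sum_le_infsum_real:
  "f summable_on K \<Longrightarrow> finite J \<Longrightarrow> J \<subseteq> K \<Longrightarrow> (\<And>k. k \<in> K \<Longrightarrow> 0 \<le> f k) \<Longrightarrow> sum f J \<le> (infsum f K :: real)"
  by (intro finite_sum_le_infsum) auto

lemma term_le_infsum_real:
  "f summable_on K \<Longrightarrow> k \<in> K \<Longrightarrow> (\<And>k. k \<in> K \<Longrightarrow> 0 \<le> f k) \<Longrightarrow> f k \<le> (infsum f K :: real)"
  using finite_sum_le_infsum_real[of f K "{k}"] by auto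

text \<open>Summability over \<open>K\<close> is unconditional, so the sum equals a series along an
  enumeration of \<open>K\<close>, to which measurability of \<open>suminf\<close> applies.\<close>

lemma borel_measurable_infsum:
  fixes f :: "'k \<Rightarrow> 'a \<Rightarrow> real"
  assumes K: "countable K" and f: "\<And>k. k \<in> K \<Longrightarrow> f k \<in> borel_measurable M"
    and s: "\<And>x. x \<in> space M \<Longrightarrow> (\<lambda>k. f k x) summable_on K"
  shows "(\<lambda>x. \<Sum>\<^sub>\<infinity>k\<in>K. f k x) \<in> borel_measurable M"
proof (cases "finite K")
  case True
  then show ?thesis using f by simp
next
  case False
  have b: "bij_betw (from_nat_into K) UNIV K"
    using K False by (rule bij_betw_from_nat_into)
  have eq: "(\<Sum>\<^sub>\<infinity>k\<in>K. f k x) = (\<Sum>i. f (from_nat_into K i) x)" if "x \<in> space M" for x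
  proof -
    have "(\<lambda>i. f (from_nat_into K i) x) summable_on UNIV"
      using s[OF that] summable_on_reindex_bij_betw[OF b, of "\<lambda>k. f k x"] by simp
    then have "(\<lambda>i. f (from_nat_into K i) x) sums (\<Sum>\<^sub>\<infinity>i\<in>UNIV. f (from_nat_into K i) x)"
      by (intro has_sum_imp_sums has_sum_infsum)
    then show ?thesis
      using infsum_reindex_bij_betw[OF b, of "\<lambda>k. f k x"] by (simp add: sums_iff)
  qed
  have "(\<lambda>x. \<Sum>i. f (from_nat_into K i) x) \<in> borel_measurable M"
    by (intro borel_measurable_suminf f) (metis b bij_betwE UNIV_I)
  then show ?thesis
    by (subst measurable_cong[OF eq])
qed

text \<open>The squared norm of \<open>ell 2 K\<close> as a real number. \<open>infsum\<close>
  returns \<open>0\<close> on families that are not summable, so nonnegativity and homogeneity hold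
  without side conditions.\<close>

definition sqsum :: "'k set \<Rightarrow> ('k \<Rightarrow> real) \<Rightarrow> real" where
  "sqsum K u = (\<Sum>\<^sub>\<infinity>k\<in>K. (u k)\<^sup>2)"

lemma abs_powr_2 [simp]: "\<bar>x::real\<bar> powr 2 = x\<^sup>2"
  by (cases "x = 0") (auto simp: powr_numeral)

lemma ell_2_iff: "u \<in> ell 2 K \<longleftrightarrow> (\<forall>k. k \<notin> K \<longrightarrow> u k = 0) \<and> (\<lambda>k. (u k)\<^sup>2) summable_on K"
  by (simp add: ell_def)

lemma ell_2_summable: "u \<in> ell 2 K \<Longrightarrow> (\<lambda>k. (u k)\<^sup>2) summable_on K"
  by (simp add: ell_2_iff)

lemma sqsum_nonneg [simp]: "0 \<le> sqsum K u"
  by (simp add: sqsum_def infsum_nonneg)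

lemma ell_norm_2: "(\<lambda>k. (u k)\<^sup>2) summable_on K \<Longrightarrow> ell_norm 2 K u = ereal (sqrt (sqsum K u))"
  by (simp add: ell_norm_def sqsum_def infsum_nonneg powr_half_sqrt)

lemma sqsum_scale: "sqsum K (\<lambda>k. c * u k) = c\<^sup>2 * sqsum K u"
  by (simp add: sqsum_def power_mult_distrib infsum_cmult_right')

lemma ell_2_scale: "u \<in> ell 2 K \<Longrightarrow> (\<lambda>k. c * u k) \<in> ell 2 K"
  by (auto simp: ell_2_iff power_mult_distrib intro: summable_on_cmult_right)

text \<open>Cauchy-Schwarz on \<open>J\<close>, after which both factors are enlarged to the full
  sums. The bound does not depend on \<open>J\<close>, and this uniformity gives summability over
  \<open>K\<close>.\<close>

lemma sum_mult_le_sqrt: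
  fixes u v :: "'k \<Rightarrow> real"
  assumes "(\<lambda>k. (u k)\<^sup>2) summable_on K" "(\<lambda>k. (v k)\<^sup>2) summable_on K" "finite J" "J \<subseteq> K"
  shows "(\<Sum>k\<in>J. \<bar>u k * v k\<bar>) \<le> sqrt (sqsum K u) * sqrt (sqsum K v)"
proof -
  have "(\<Sum>k\<in>J. \<bar>u k * v k\<bar>) \<le> L2_set u J * L2_set v J"
    using L2_set_mult_ineq[of u v J] by (simp add: abs_mult)
  also have "\<dots> \<le> sqrt (sqsum K u) * sqrt (sqsum K v)"
    unfolding L2_set_def sqsum_def
    by (intro mult_mono real_sqrt_le_mono finite_sum_le_infsum_real assms) (auto simp: sum_nonneg infsum_nonneg)
  finally show ?thesis .
qed

lemma Cauchy_Schwarz_infsum: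
  fixes u v :: "'k \<Rightarrow> real"
  assumes "(\<lambda>k. (u k)\<^sup>2) summable_on K" "(\<lambda>k. (v k)\<^sup>2) summable_on K"
  shows "(\<lambda>k. u k * v k) summable_on K"
    and "\<bar>\<Sum>\<^sub>\<infinity>k\<in>K. u k * v k\<bar> \<le> sqrt (sqsum K u) * sqrt (sqsum K v)"
proof -
  note s = summable_on_sum_le[of K "\<lambda>k. \<bar>u k * v k\<bar>", OF _ sum_mult_le_sqrt[OF assms]]
  show "(\<lambda>k. u k * v k) summable_on K"
    using s(1) summable_on_iff_abs_summable_on_real[of "\<lambda>k. u k * v k" K] by simp
  have "\<bar>\<Sum>\<^sub>\<infinity>k\<in>K. u k * v k\<bar> \<le> (\<Sum>\<^sub>\<infinity>k\<in>K. \<bar>u k * v k\<bar>)"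
    using norm_infsum_bound[of "\<lambda>k. u k * v k" K] s(1) by simp
  also have "\<dots> \<le> sqrt (sqsum K u) * sqrt (sqsum K v)"
    using s(2) by simp
  finally show "\<bar>\<Sum>\<^sub>\<infinity>k\<in>K. u k * v k\<bar> \<le> sqrt (sqsum K u) * sqrt (sqsum K v)" .
qed

text \<open>Minkowski's inequality on finite index sets has a bound independent of the set, which
  yields summability and the norm bound together.\<close>

lemma sqsum_triangle:
  assumes "(\<lambda>k. (u k)\<^sup>2) summable_on K" "(\<lambda>k. (v k)\<^sup>2) summable_on K"
  shows "(\<lambda>k. (u k + v k)\<^sup>2) summable_on K"
    and "sqrt (sqsum K (\<lambda>k. u k + v k)) \<le> sqrt (sqsum K u) + sqrt (sqsum K v)"
proof -
  let ?c = "sqrt (sqsum K u) + sqrt (sqsum K v)"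
  have "(\<Sum>k\<in>J. (u k + v k)\<^sup>2) \<le> ?c\<^sup>2" if J: "finite J" "J \<subseteq> K" for J
  proof -
    have "L2_set (\<lambda>k. u k + v k) J \<le> L2_set u J + L2_set v J"
      by (rule L2_set_triangle_ineq)
    also have "\<dots> \<le> ?c"
      unfolding L2_set_def sqsum_def
      by (intro add_mono real_sqrt_le_mono finite_sum_le_infsum_real assms J) auto
    finally have "(L2_set (\<lambda>k. u k + v k) J)\<^sup>2 \<le> ?c\<^sup>2"
      by (intro power_mono) (auto simp: L2_set_nonneg)
    then show ?thesis
      by (simp add: L2_set_def sum_nonneg)
  qed
  note s = summable_on_sum_le[of K "\<lambda>k. (u k + v k)\<^sup>2", OF _ this]
  show "(\<lambda>k. (u k + v k)\<^sup>2) summable_on K"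
    using s(1) by simp
  have "sqsum K (\<lambda>k. u k + v k) \<le> ?c\<^sup>2"
    unfolding sqsum_def[of K "\<lambda>k. u k + v k"] using s(2) by simp
  then show "sqrt (sqsum K (\<lambda>k. u k + v k)) \<le> ?c"
    by (metis add_nonneg_nonneg real_sqrt_ge_zero real_sqrt_le_iff real_sqrt_pow2 sqsum_nonneg real_sqrt_abs abs_of_nonneg)
qed

lemma ell_2_add: "u \<in> ell 2 K \<Longrightarrow> v \<in> ell 2 K \<Longrightarrow> (\<lambda>k. u k + v k) \<in> ell 2 K"
  using sqsum_triangle(1)[of u K v] by (auto simp: ell_2_iff)

lemma ell_2_diff: "u \<in> ell 2 K \<Longrightarrow> v \<in> ell 2 K \<Longrightarrow> (\<lambda>k. u k - v k) \<in> ell 2 K"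
  using ell_2_add[OF _ ell_2_scale[of v K "-1"], of u] by simp

section \<open>Metric and Borel structure of the square-summable families\<close>

lemma ell2_dist:
  assumes "u \<in> ell 2 K" "v \<in> ell 2 K"
  shows "real_of_ereal (ell_norm 2 K (\<lambda>k. u k - v k)) = sqrt (sqsum K (\<lambda>k. u k - v k))"
  using ell_2_summable[OF ell_2_diff[OF assms]] by (simp add: ell_norm_2)

text \<open>\<open>ell2_borel\<close> is generated by \<open>mtopology\<close>, whose facts require
  a \<open>Metric_space\<close>. Nonnegativity and symmetry are demanded for arbitrary functions,
  also for pairs with infinite \<open>ell_norm\<close>; there \<open>real_of_ereal\<close> returns
  \<open>0\<close>.\<close>

lemma Metric_space_ell2:
  "Metric_space (ell 2 K) (\<lambda>u v. real_of_ereal (ell_norm 2 K (\<lambda>k. u k - v k)))"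
proof
  fix u v :: "'a \<Rightarrow> real"
  show "0 \<le> real_of_ereal (ell_norm 2 K (\<lambda>k. u k - v k))"
    by (simp add: ell_norm_def)
  show "real_of_ereal (ell_norm 2 K (\<lambda>k. u k - v k)) = real_of_ereal (ell_norm 2 K (\<lambda>k. v k - u k))"
    by (simp add: ell_norm_def power2_commute)
next
  fix u v w :: "'a \<Rightarrow> real"
  assume uv: "u \<in> ell 2 K" "v \<in> ell 2 K"
  have "sqsum K (\<lambda>k. u k - v k) = 0 \<longleftrightarrow> (\<forall>k\<in>K. u k - v k = 0)"
  proof
    assume "sqsum K (\<lambda>k. u k - v k) = 0"
    then show "\<forall>k\<in>K. u k - v k = 0"
      using nonneg_infsum_le_0D[OF _ ell_2_summable[OF ell_2_diff[OF uv]]] by (auto simp: sqsum_def)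
  qed (simp add: sqsum_def cong: infsum_cong)
  then show "(real_of_ereal (ell_norm 2 K (\<lambda>k. u k - v k)) = 0) = (u = v)"
    using uv by (auto simp: ell2_dist[OF uv] ell_2_iff fun_eq_iff)
  assume w: "w \<in> ell 2 K"
  have "(\<lambda>k. (u k - v k) + (v k - w k)) = (\<lambda>k. u k - w k)" by auto
  then show "real_of_ereal (ell_norm 2 K (\<lambda>k. u k - w k))
      \<le> real_of_ereal (ell_norm 2 K (\<lambda>k. u k - v k)) + real_of_ereal (ell_norm 2 K (\<lambda>k. v k - w k))"
    using sqsum_triangle(2)[OF ell_2_summable[OF ell_2_diff[OF uv]] ell_2_summable[OF ell_2_diff[OF uv(2) w]]]
    by (simp add: ell2_dist uv w)
qed

lemma space_ell2_borel: "space (ell2_borel K) = ell 2 K"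
  unfolding ell2_borel_def by (rule space_measure_of_conv)

text \<open>Coordinates are 1-Lipschitz for the metric, so preimages of open sets are open.
  Measurability of functionals of the estimator is later reduced to its coordinates.\<close>

lemma measurable_ell2_coord: "(\<lambda>u. u k) \<in> borel_measurable (ell2_borel K)"
proof (cases "k \<in> K")
  case False
  then have "(u::'a \<Rightarrow> real) k = 0" if "u \<in> space (ell2_borel K)" for u
    using that by (auto simp: space_ell2_borel ell_2_iff)
  then show ?thesis
    by (simp add: measurable_cong[of "ell2_borel K" "\<lambda>u. u k" "\<lambda>_. 0"])
next
  case True
  interpret Metric_space "ell 2 K" "\<lambda>u v. real_of_ereal (ell_norm 2 K (\<lambda>k. u k - v k))"
    by (rule Metric_space_ell2)
  show ?thesis
  proof (rule borel_measurableI)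
    fix U :: "real set" assume U: "open U"
    let ?V = "{u \<in> ell 2 K. u k \<in> U}"
    have "openin mtopology ?V"
      unfolding openin_mtopology
    proof (intro conjI ballI impI allI)
      fix u assume u: "u \<in> ?V"
      then obtain e where e: "e > 0" "\<And>x. \<bar>x - u k\<bar> < e \<Longrightarrow> x \<in> U"
        using U by (auto simp: open_dist dist_real_def)
      have "v \<in> ?V" if "v \<in> mball u e" for v
      proof -
        from that have v: "v \<in> ell 2 K" and d: "real_of_ereal (ell_norm 2 K (\<lambda>k. u k - v k)) < e"
          by (auto simp: in_mball)
        have "(u k - v k)\<^sup>2 \<le> sqsum K (\<lambda>k. u k - v k)"
          unfolding sqsum_def using u v True
          by (intro term_le_infsum_real[of "\<lambda>k. (u k - v k)\<^sup>2"] ell_2_summable ell_2_diff) auto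
        then have "\<bar>u k - v k\<bar> \<le> sqrt (sqsum K (\<lambda>k. u k - v k))"
          by (metis real_sqrt_abs real_sqrt_le_iff)
        then have "\<bar>v k - u k\<bar> < e" using d u v by (simp add: ell2_dist)
        then show ?thesis using v e(2) by blast
      qed
      then show "\<exists>e>0. mball u e \<subseteq> ?V" using e(1) by blast
    qed auto
    then have "?V \<in> sets (ell2_borel K)"
      unfolding ell2_borel_def by (subst sets_measure_of) (auto dest!: openin_subset)
    moreover have "(\<lambda>u. u k) -` U \<inter> space (ell2_borel K) = ?V"
      by (auto simp: space_ell2_borel)
    ultimately show "(\<lambda>u. u k) -` U \<inter> space (ell2_borel K) \<in> sets (ell2_borel K)"
      by simp
  qed
qed

text \<open>Every \<open>|u k|^p\<close> is at most the total \<open>q\<close>, so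
  \<open>|u k|^2 = |u k|^p * |u k|^(2 - p)\<close> is at most
  \<open>|u k|^p * q^((2 - p) / p)\<close>, and summing gives \<open>q^(2 / p)\<close>. This
  embedding links the penalty to the risk.\<close>

lemma sqsum_le_powr_sum:
  assumes p: "1 < p" "p \<le> 2" and s: "(\<lambda>k. \<bar>u k\<bar> powr p) summable_on K"
  shows "(\<lambda>k. (u k)\<^sup>2) summable_on K"
    and "sqsum K u \<le> (\<Sum>\<^sub>\<infinity>k\<in>K. \<bar>u k\<bar> powr p) powr (2 / p)"
proof -
  define q where "q = (\<Sum>\<^sub>\<infinity>k\<in>K. \<bar>u k\<bar> powr p)"
  have q0: "q \<ge> 0" unfolding q_def by (intro infsum_nonneg) auto
  have le: "(u k)\<^sup>2 \<le> \<bar>u k\<bar> powr p * q powr ((2 - p) / p)" if k: "k \<in> K" for k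
  proof -
    have "\<bar>u k\<bar> powr p \<le> q"
      unfolding q_def by (intro term_le_infsum_real[OF s k]) auto
    then have "(\<bar>u k\<bar> powr p) powr ((2 - p) / p) \<le> q powr ((2 - p) / p)"
      using p by (intro powr_mono2) auto
    then have "\<bar>u k\<bar> powr (2 - p) \<le> q powr ((2 - p) / p)"
      using p by (simp add: powr_powr)
    then have "\<bar>u k\<bar> powr p * \<bar>u k\<bar> powr (2 - p) \<le> \<bar>u k\<bar> powr p * q powr ((2 - p) / p)"
      by (intro mult_left_mono) auto
    then show ?thesis by (simp flip: powr_add)
  qed
  have s': "(\<lambda>k. \<bar>u k\<bar> powr p * q powr ((2 - p) / p)) summable_on K"
    by (intro summable_on_cmult_left s)
  note c = summable_on_le[of K "\<lambda>k. (u k)\<^sup>2", OF _ le s']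
  show "(\<lambda>k. (u k)\<^sup>2) summable_on K" using c(1) by simp
  have "sqsum K u \<le> q * q powr ((2 - p) / p)"
    unfolding sqsum_def using c(2) by (simp add: infsum_cmult_left' q_def)
  also have "\<dots> = q powr (2 / p)"
  proof (cases "q = 0")
    case False
    then have "q * q powr ((2 - p) / p) = q powr 1 * q powr ((2 - p) / p)" using q0 by simp
    also have "\<dots> = q powr (1 + (2 - p) / p)" by (simp only: powr_add)
    also have "1 + (2 - p) / p = 2 / p" using p by (simp add: field_simps)
    finally show ?thesis .
  qed simp
  finally show "sqsum K u \<le> (\<Sum>\<^sub>\<infinity>k\<in>K. \<bar>u k\<bar> powr p) powr (2 / p)"
    unfolding q_def .
qed

section \<open>Deviations of i.i.d. sums of bounded features\<close>

text \<open>The terms are nonnegative and the integral is a series along an enumeration, so it is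
  the limit of finite partial sums.\<close>

lemma nn_integral_count_space_le:
  fixes f :: "'i \<Rightarrow> ennreal"
  assumes I: "countable I" and le: "\<And>J. finite J \<Longrightarrow> J \<subseteq> I \<Longrightarrow> sum f J \<le> c"
  shows "(\<integral>\<^sup>+i. f i \<partial>count_space I) \<le> c"
proof (cases "finite I")
  case True
  then show ?thesis using le[of I] by (simp add: nn_integral_count_space_finite)
next
  case False
  note b = bij_betw_from_nat_into[OF I False]
  have "(\<integral>\<^sup>+i. f i \<partial>count_space I) = (\<Sum>n. f (from_nat_into I n))"
    by (simp add: nn_integral_bij_count_space[symmetric, OF b] nn_integral_count_space_nat)
  also have "\<dots> \<le> c"
  proof (intro suminf_le_const summableI)
    fix n
    have "(\<Sum>i<n. f (from_nat_into I i)) = sum f (from_nat_into I ` {..<n})"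
      using b by (subst sum.reindex) (auto simp: bij_betw_def intro: inj_on_subset)
    also have "\<dots> \<le> c"
      using b by (intro le) (auto simp: bij_betw_def)
    finally show "(\<Sum>i<n. f (from_nat_into I i)) \<le> c" .
  qed
  finally show ?thesis .
qed

lemma sum_le_nn_integral_count_space:
  fixes f :: "'i \<Rightarrow> ennreal"
  assumes "finite J" "J \<subseteq> I"
  shows "sum f J \<le> (\<integral>\<^sup>+i. f i \<partial>count_space I)"
proof -
  have "sum f J = (\<integral>\<^sup>+i. f i \<partial>count_space J)"
    using assms by (simp add: nn_integral_count_space_finite)
  also have "\<dots> = (\<integral>\<^sup>+i. f i * indicator J i \<partial>count_space UNIV)"
    by (rule nn_integral_count_space_indicator) simp
  also have "\<dots> \<le> (\<integral>\<^sup>+i. f i * indicator I i \<partial>count_space UNIV)"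
    using assms by (intro nn_integral_mono) (auto simp: indicator_def)
  also have "\<dots> = (\<integral>\<^sup>+i. f i \<partial>count_space I)"
    by (rule nn_integral_count_space_indicator[symmetric]) simp
  finally show ?thesis .
qed

section \<open>The filtration of an i.i.d. sample and its independence from later
  observations\<close>

locale iid_sample = prob_space M
  for M :: "'w measure" and P :: "'z measure" and X :: "nat \<Rightarrow> 'w \<Rightarrow> 'z" +
  assumes indep: "indep_vars (\<lambda>_. P) X UNIV" and distr_X: "\<And>i. distr M P (X i) = P"
begin

lemma X_measurable [measurable]: "X i \<in> M \<rightarrow>\<^sub>M P"
  using indep by (auto simp: indep_vars_def)

lemma prob_space_P: "prob_space P"
  using prob_space_distr[OF X_measurable[of 0]] by (simp add: distr_X)

lemma integral_X:
  fixes f :: "'z \<Rightarrow> real"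
  assumes [measurable]: "f \<in> borel_measurable P"
  shows "(\<integral>x. f (X m x) \<partial>M) = (\<integral>z. f z \<partial>P)"
  using integral_distr[of "X m" M P f] by (simp add: distr_X)

text \<open>The natural filtration, with observations counted from \<open>1\<close>. It is generated
  by a single product-valued map, the form in which \<open>indep_var_restrict\<close> delivers
  independence of blocks.\<close>

definition past :: "nat \<Rightarrow> 'w measure" where
  "past k = vimage_algebra (space M) (\<lambda>x. \<lambda>i\<in>{1..k}. X i x) (PiM {1..k} (\<lambda>_. P))"

lemma space_past [simp]: "space (past k) = space M"
  by (simp add: past_def)

lemma restrict_in_space: "(\<lambda>x. \<lambda>i\<in>{1..k}. X i x) \<in> space M \<rightarrow> space (PiM {1..k} (\<lambda>_. P))"
  using X_measurable by (auto simp: space_PiM measurable_def Pi_iff)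

lemma restrict_past: "(\<lambda>x. \<lambda>i\<in>{1..k}. X i x) \<in> past k \<rightarrow>\<^sub>M PiM {1..k} (\<lambda>_. P)"
  unfolding past_def by (rule measurable_vimage_algebra1[OF restrict_in_space])

lemma X_past:
  assumes "m \<in> {1..k}"
  shows "X m \<in> past k \<rightarrow>\<^sub>M P"
proof -
  have "(\<lambda>x. (\<lambda>i\<in>{1..k}. X i x) m) \<in> past k \<rightarrow>\<^sub>M P"
    by (rule measurable_compose[OF restrict_past]) (use assms in simp)
  then show ?thesis using assms by simp
qed

lemma sets_past: "sets (past k) = {(\<lambda>x. \<lambda>i\<in>{1..k}. X i x) -` A \<inter> space M | A. A \<in> sets (PiM {1..k} (\<lambda>_. P))}"
  unfolding past_def by (rule sets_vimage_algebra2[OF restrict_in_space])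

lemma past_mono:
  assumes "k \<le> l"
  shows "sets (past k) \<subseteq> sets (past l)"
proof
  fix B assume "B \<in> sets (past k)"
  then obtain A where A: "A \<in> sets (PiM {1..k} (\<lambda>_. P))"
    "B = (\<lambda>x. \<lambda>i\<in>{1..k}. X i x) -` A \<inter> space (past l)"
    by (auto simp: sets_past[of k])
  have "(\<lambda>x. \<lambda>i\<in>{1..k}. X i x) \<in> past l \<rightarrow>\<^sub>M PiM {1..k} (\<lambda>_. P)"
    by (intro measurable_restrict X_past) (use assms in auto)
  from measurable_sets[OF this A(1)] show "B \<in> sets (past l)"
    unfolding A(2) .
qed

lemma past_subset: "sets (past k) \<subseteq> sets M"
proof
  fix B assume "B \<in> sets (past k)"
  then obtain A where A: "A \<in> sets (PiM {1..k} (\<lambda>_. P))"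
    "B = (\<lambda>x. \<lambda>i\<in>{1..k}. X i x) -` A \<inter> space M"
    by (auto simp: sets_past)
  have "(\<lambda>x. \<lambda>i\<in>{1..k}. X i x) \<in> M \<rightarrow>\<^sub>M PiM {1..k} (\<lambda>_. P)"
    by (intro measurable_restrict X_measurable)
  from measurable_sets[OF this A(1)] show "B \<in> sets M"
    unfolding A(2) .
qed

lemma measurable_past_M: "f \<in> borel_measurable (past k) \<Longrightarrow> f \<in> borel_measurable M"
  using past_subset[of k] by (auto simp: measurable_def)

text \<open>Disjoint blocks of an independent family are independent. A function measurable in the
  past and a function of \<open>X m\<close> generate sub-algebras of the two block algebras, and
  independence passes to these.\<close>

lemma indep_past_next:
  fixes f :: "'w \<Rightarrow> real" and g :: "'z \<Rightarrow> real"
  assumes f: "f \<in> borel_measurable (past k)" and g: "g \<in> borel_measurable P" and "k < m"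
  shows "indep_var borel f borel (\<lambda>x. g (X m x))"
proof -
  let ?R = "\<lambda>x. \<lambda>i\<in>{1..k}. X i x" and ?R' = "\<lambda>x. \<lambda>i\<in>{m}. X i x"
  let ?V = "vimage_algebra (space M) ?R' (PiM {m} (\<lambda>_. P))"
  have "indep_var (PiM {1..k} (\<lambda>_. P)) ?R (PiM {m} (\<lambda>_. P)) ?R'"
    using indep \<open>k < m\<close> by (intro indep_var_restrict) auto
  then have i: "indep_set (sets (past k)) (sets ?V)"
    by (simp add: indep_var_eq past_def sets_vimage_algebra)
  have R': "?R' \<in> ?V \<rightarrow>\<^sub>M PiM {m} (\<lambda>_. P)"
    using X_measurable
    by (intro measurable_vimage_algebra1) (auto simp: space_PiM measurable_def Pi_iff)
  have "(\<lambda>x. g (?R' x m)) \<in> borel_measurable ?V"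
    by (rule measurable_compose[OF R' measurable_compose[OF _ g]]) simp
  then have gV: "(\<lambda>x. g (X m x)) \<in> borel_measurable ?V" by simp
  have "sigma_sets (space M) {f -` A \<inter> space M | A. A \<in> sets borel} \<subseteq> sets (past k)"
    using sets.sigma_sets_subset[of "{f -` A \<inter> space M | A. A \<in> sets borel}" "past k"]
      measurable_sets[OF f] by auto
  moreover have "sigma_sets (space M) {(\<lambda>x. g (X m x)) -` A \<inter> space M | A. A \<in> sets borel} \<subseteq> sets ?V"
    using sets.sigma_sets_subset[of "{(\<lambda>x. g (X m x)) -` A \<inter> space M | A. A \<in> sets borel}" ?V]
      measurable_sets[OF gV] by auto
  ultimately have "indep_set (sigma_sets (space M) {f -` A \<inter> space M | A. A \<in> sets borel})
      (sigma_sets (space M) {(\<lambda>x. g (X m x)) -` A \<inter> space M | A. A \<in> sets borel})"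
    using i unfolding indep_sets2_eq by (meson subset_iff)
  then show ?thesis
    using measurable_past_M[OF f] measurable_compose[OF X_measurable g]
    unfolding indep_var_eq by simp
qed

text \<open>The martingale-difference property: by independence the expectation of the product
  factorizes, and the factor of the centred function is \<open>0\<close>.\<close>

lemma past_next_orthogonal:
  fixes f :: "'w \<Rightarrow> real" and g :: "'z \<Rightarrow> real"
  assumes f: "f \<in> borel_measurable (past k)" "integrable M f"
    and g: "integrable P g" "(\<integral>z. g z \<partial>P) = 0" and m: "k < m"
  shows "integrable M (\<lambda>x. f x * g (X m x))" "(\<integral>x. f x * g (X m x) \<partial>M) = 0"
proof -
  have gm: "g \<in> borel_measurable P" using g(1) by simp
  have i: "integrable M (\<lambda>x. g (X m x))"
    using g(1) integrable_distr_eq[of "X m" M P g] by (simp add: distr_X)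
  note iv = indep_past_next[OF f(1) gm m]
  show "integrable M (\<lambda>x. f x * g (X m x))"
    by (rule indep_var_integrable[OF iv f(2) i])
  show "(\<integral>x. f x * g (X m x) \<partial>M) = 0"
    using indep_var_lebesgue_integral[OF iv f(2) i] g(2) by (simp add: integral_X gm)
qed

end

section \<open>The martingale of centred feature sums and its maximal inequality\<close>

locale bounded_features = iid_sample M P X
  for M :: "'w measure" and P :: "'z measure" and X :: "nat \<Rightarrow> 'w \<Rightarrow> 'z" +
  fixes I :: "'i set" and \<psi> :: "'i \<Rightarrow> 'z \<Rightarrow> real" and c :: real
  assumes countable_I: "countable I"
    and \<psi>_measurable: "\<And>i. i \<in> I \<Longrightarrow> \<psi> i \<in> borel_measurable P"
    and \<psi>_bound: "\<And>z J. z \<in> space P \<Longrightarrow> finite J \<Longrightarrow> J \<subseteq> I \<Longrightarrow> (\<Sum>i\<in>J. (\<psi> i z)\<^sup>2) \<le> c\<^sup>2"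
    and c_nonneg: "0 \<le> c"
begin

definition centred :: "'i \<Rightarrow> 'z \<Rightarrow> real" where
  "centred i z = \<psi> i z - (\<integral>z. \<psi> i z \<partial>P)"

definition dev :: "'i \<Rightarrow> nat \<Rightarrow> 'w \<Rightarrow> real" where
  "dev i n x = (\<Sum>m=1..n. centred i (X m x))"

text \<open>The squared Hilbert norm of the sums, not of the averages, so a factor \<open>n\<close>
  accompanies every later threshold. As an \<open>ennreal\<close> integral over
  \<open>count_space I\<close> it can be exchanged with expectation by Tonelli's theorem without
  summability arguments.\<close>

definition devsq :: "nat \<Rightarrow> 'w \<Rightarrow> ennreal" where
  "devsq n x = (\<integral>\<^sup>+i. ennreal ((dev i n x)\<^sup>2) \<partial>count_space I)"

abbreviation "energy A i n \<equiv> \<integral>x. indicator A x * (dev i n x)\<^sup>2 \<partial>M"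
abbreviation "mass A n \<equiv> \<integral>\<^sup>+x. indicator A x * devsq n x \<partial>M"

lemma \<psi>_le: "i \<in> I \<Longrightarrow> z \<in> space P \<Longrightarrow> \<bar>\<psi> i z\<bar> \<le> c"
  by (rule power2_le_imp_le) (use \<psi>_bound[of z "{i}"] c_nonneg in auto)

interpretation P: prob_space P by (rule prob_space_P)

lemma \<psi>_integrable: "i \<in> I \<Longrightarrow> integrable P (\<psi> i)"
  using \<psi>_le \<psi>_measurable by (intro P.integrable_const_bound[where B=c]) auto

lemma \<psi>_sq_integrable: "i \<in> I \<Longrightarrow> integrable P (\<lambda>z. (\<psi> i z)\<^sup>2)"
  using \<psi>_bound[of _ "{i}"] \<psi>_measurable by (intro P.integrable_const_bound[where B="c\<^sup>2"]) auto

lemma centred_measurable: "i \<in> I \<Longrightarrow> centred i \<in> borel_measurable P"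
  unfolding centred_def using \<psi>_measurable by auto

lemma centred_le: "i \<in> I \<Longrightarrow> z \<in> space P \<Longrightarrow> \<bar>centred i z\<bar> \<le> 2 * c"
proof -
  assume i: "i \<in> I" and z: "z \<in> space P"
  have "\<bar>\<integral>z. \<psi> i z \<partial>P\<bar> \<le> (\<integral>z. \<bar>\<psi> i z\<bar> \<partial>P)"
    by (rule integral_abs_bound)
  also have "\<dots> \<le> (\<integral>z. c \<partial>P)"
    by (intro integral_mono integrable_abs \<psi>_integrable i) (auto intro: \<psi>_le i)
  finally have "\<bar>\<integral>z. \<psi> i z \<partial>P\<bar> \<le> c" by (simp add: P.prob_space)
  then show ?thesis
    using \<psi>_le[OF i z] by (simp add: centred_def)
qed

lemma centred_integrable: "i \<in> I \<Longrightarrow> integrable P (centred i)"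
  and centred_integral: "i \<in> I \<Longrightarrow> (\<integral>z. centred i z \<partial>P) = 0"
  and centred_sq: "i \<in> I \<Longrightarrow> (\<integral>z. (centred i z)\<^sup>2 \<partial>P) \<le> (\<integral>z. (\<psi> i z)\<^sup>2 \<partial>P)"
proof -
  assume i: "i \<in> I"
  show "integrable P (centred i)"
    unfolding centred_def using \<psi>_integrable[OF i] by simp
  show "(\<integral>z. centred i z \<partial>P) = 0"
    unfolding centred_def using \<psi>_integrable[OF i] by (simp add: P.prob_space)
  have "(\<integral>z. (centred i z)\<^sup>2 \<partial>P) = (\<integral>z. (\<psi> i z)\<^sup>2 \<partial>P) - (\<integral>z. \<psi> i z \<partial>P)\<^sup>2"
    unfolding centred_def using P.variance_eq[OF \<psi>_integrable[OF i] \<psi>_sq_integrable[OF i]] .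
  then show "(\<integral>z. (centred i z)\<^sup>2 \<partial>P) \<le> (\<integral>z. (\<psi> i z)\<^sup>2 \<partial>P)" by simp
qed

lemma dev_past:
  assumes "i \<in> I" "n \<le> k"
  shows "dev i n \<in> borel_measurable (past k)"
  unfolding dev_def using assms
  by (intro borel_measurable_sum measurable_compose[OF X_past centred_measurable]) auto

lemma devsq_past:
  assumes "n \<le> k"
  shows "devsq n \<in> borel_measurable (past k)"
proof -
  have "(\<lambda>x. \<integral>\<^sup>+i. ennreal ((dev i n x)\<^sup>2) \<partial>count_space I) \<in> borel_measurable (past k)"
  proof (rule sigma_finite_measure.borel_measurable_nn_integral)
    show "sigma_finite_measure (count_space I)"
      by (rule sigma_finite_measure_count_space_countable[OF countable_I])
    show "(\<lambda>(x, i). ennreal ((dev i n x)\<^sup>2)) \<in> borel_measurable (past k \<Otimes>\<^sub>M count_space I)"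
    proof -
      have "(\<lambda>(i, x). ennreal ((dev i n x)\<^sup>2)) \<in> borel_measurable (count_space I \<Otimes>\<^sub>M past k)"
        using dev_past[OF _ assms] by (intro measurable_pair_measure_countable1[OF countable_I]) auto
      from measurable_pair_swap[OF this] show ?thesis by (simp add: case_prod_unfold)
    qed
  qed
  then show ?thesis by (simp add: devsq_def[abs_def])
qed

lemma devsq_measurable [measurable]: "devsq n \<in> borel_measurable M"
  by (rule measurable_past_M[OF devsq_past[OF order_refl]])

lemma dev_le:
  assumes i: "i \<in> I" and w: "x \<in> space M"
  shows "\<bar>dev i n x\<bar> \<le> real n * (2 * c)"
proof -
  have "\<bar>dev i n x\<bar> \<le> (\<Sum>m=1..n. \<bar>centred i (X m x)\<bar>)"
    unfolding dev_def by (rule sum_abs)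
  also have "\<dots> \<le> (\<Sum>m=1..n. 2 * c)"
    by (intro sum_mono centred_le i measurable_space[OF X_measurable w])
  finally show ?thesis by simp
qed

lemma dev_Suc: "dev i (Suc n) x = dev i n x + centred i (X (Suc n) x)"
  by (simp add: dev_def)

text \<open>Expanding the square leaves a cross term, \<open>centred i (X (Suc n) x)\<close> times
  the past-measurable \<open>indicator A x * dev i n x\<close>, whose expectation vanishes. This is
  where \<open>A\<close> has to be known at time \<open>n\<close>.\<close>

lemma dev_sq_step:
  assumes i: "i \<in> I" and A: "A \<in> sets (past n)"
  shows "energy A i (Suc n) =
    energy A i n + (\<integral>x. indicator A x * (centred i (X (Suc n) x))\<^sup>2 \<partial>M)"
proof -
  have [measurable]: "A \<in> sets M" using A past_subset by blast
  have dp: "dev i n \<in> borel_measurable (past n)" by (rule dev_past[OF i order_refl])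
  have [measurable]: "dev i n \<in> borel_measurable M" by (rule measurable_past_M[OF dp])
  have [measurable]: "centred i \<in> borel_measurable P" by (rule centred_measurable[OF i])
  have "\<bar>indicator A x * dev i n x\<bar> \<le> real n * (2 * c)" if "x \<in> space M" for x
    using dev_le[OF i that, of n] c_nonneg by (auto simp: indicator_def)
  then have i1: "integrable M (\<lambda>x. indicator A x * dev i n x)"
    by (intro integrable_const_bound[where B="real n * (2*c)"]) auto
  have p1: "(\<lambda>x. indicator A x * dev i n x) \<in> borel_measurable (past n)"
    using A dp by measurable
  note o = past_next_orthogonal[OF p1 i1 centred_integrable[OF i] centred_integral[OF i], of "Suc n"]
  have "\<bar>indicator A x * (dev i n x)\<^sup>2\<bar> \<le> (real n * (2 * c))\<^sup>2" if "x \<in> space M" for x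
    using power_mono[OF dev_le[OF i that, of n], of 2] by (auto simp: indicator_def)
  then have i2: "integrable M (\<lambda>x. indicator A x * (dev i n x)\<^sup>2)"
    by (intro integrable_const_bound[where B="(real n * (2*c))\<^sup>2"]) auto
  have "\<bar>indicator A x * (centred i (X (Suc n) x))\<^sup>2\<bar> \<le> (2 * c)\<^sup>2" if "x \<in> space M" for x
    using power_mono[OF centred_le[OF i measurable_space[OF X_measurable[of "Suc n"] that]], where n=2] by (auto simp: indicator_def)
  then have i3: "integrable M (\<lambda>x. indicator A x * (centred i (X (Suc n) x))\<^sup>2)"
    by (intro integrable_const_bound[where B="(2*c)\<^sup>2"]) auto
  have "energy A i (Suc n) =
    (\<integral>x. indicator A x * (dev i n x)\<^sup>2 + 2 * (indicator A x * dev i n x * centred i (X (Suc n) x))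
       + indicator A x * (centred i (X (Suc n) x))\<^sup>2 \<partial>M)"
    by (intro Bochner_Integration.integral_cong) (auto simp: dev_Suc power2_sum algebra_simps)
  then show ?thesis
    using o i2 i3 by simp
qed

text \<open>Tonelli's theorem reduces the vector quantity to its coordinates, where the integrands
  are bounded and \<open>dev_sq_step\<close> applies.\<close>

lemma devsq_eq_sum_integrals:
  assumes A: "A \<in> sets (past k)" and n: "n \<le> k"
  shows "mass A n =
    (\<integral>\<^sup>+i. ennreal (energy A i n) \<partial>count_space I)"
proof -
  have [measurable]: "A \<in> sets M" using A past_subset by blast
  have [measurable]: "dev i n \<in> borel_measurable M" if "i \<in> I" for i
    using measurable_past_M[OF dev_past[OF that order_refl]] .
  have "mass A n =
    (\<integral>\<^sup>+x. \<integral>\<^sup>+i. ennreal (indicator A x * (dev i n x)\<^sup>2) \<partial>count_space I \<partial>M)"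
    by (intro nn_integral_cong) (auto simp: devsq_def indicator_def)
  also have "\<dots> = (\<integral>\<^sup>+i. \<integral>\<^sup>+x. ennreal (indicator A x * (dev i n x)\<^sup>2) \<partial>M \<partial>count_space I)"
    by (rule nn_integral_count_space_nn_integral[OF countable_I]) measurable
  also have "\<dots> = (\<integral>\<^sup>+i. ennreal (energy A i n) \<partial>count_space I)"
  proof (intro nn_integral_cong nn_integral_eq_integral)
    fix i assume "i \<in> space (count_space I)"
    then have i: "i \<in> I" by simp
    then have [measurable]: "dev i n \<in> borel_measurable M" by measurable
    have "\<bar>indicator A x * (dev i n x)\<^sup>2\<bar> \<le> (real n * (2 * c))\<^sup>2" if "x \<in> space M" for x
      using power_mono[OF dev_le[OF i that, of n], of 2] by (auto simp: indicator_def)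
    then show "integrable M (\<lambda>x. indicator A x * (dev i n x)\<^sup>2)"
      by (intro integrable_const_bound[where B="(real n * (2*c))\<^sup>2"]) auto
  qed auto
  finally show ?thesis .
qed

text \<open>Each step adds, in every coordinate, the nonnegative integral from
  \<open>dev_sq_step\<close>; \<open>past_mono\<close> keeps \<open>A\<close> in the growing
  algebras.\<close>

lemma devsq_submartingale:
  assumes A: "A \<in> sets (past k)" and kn: "k \<le> n"
  shows "mass A k \<le> mass A n"
  using kn
proof (induction n rule: dec_induct)
  case (step n)
  have An: "A \<in> sets (past n)" "A \<in> sets (past (Suc n))"
    using A past_mono[of k n] past_mono[of k "Suc n"] step by auto
  have "mass A n \<le> mass A (Suc n)"
    unfolding devsq_eq_sum_integrals[OF An(1) order_refl] devsq_eq_sum_integrals[OF An(2) order_refl]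
    by (intro nn_integral_mono ennreal_leI) (use An(1) in \<open>auto simp: dev_sq_step\<close>)
  with step.IH show ?case by order
qed simp

text \<open>Increments are orthogonal, so each step adds at most the second moment of
  \<open>\<psi> i\<close>. These moments sum over \<open>I\<close> to at most \<open>c^2\<close>,
  whatever the number of features.\<close>

lemma devsq_expectation: "(\<integral>\<^sup>+x. devsq n x \<partial>M) \<le> ennreal (real n * c\<^sup>2)"
proof -
  have sp: "space M \<in> sets (past n)" for n
    using sets.top[of "past n"] by simp
  have d: "energy (space M) i n \<le> real n * (\<integral>z. (\<psi> i z)\<^sup>2 \<partial>P)" if i: "i \<in> I" for i
  proof (induction n)
    case (Suc n)
    have [measurable]: "centred i \<in> borel_measurable P" by (rule centred_measurable[OF i])
    have "(\<integral>x. indicator (space M) x * (centred i (X (Suc n) x))\<^sup>2 \<partial>M) = (\<integral>x. (centred i (X (Suc n) x))\<^sup>2 \<partial>M)"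
      by (intro Bochner_Integration.integral_cong) auto
    also have "\<dots> = (\<integral>z. (centred i z)\<^sup>2 \<partial>P)"
      by (rule integral_X) measurable
    also have "\<dots> \<le> (\<integral>z. (\<psi> i z)\<^sup>2 \<partial>P)" by (rule centred_sq[OF i])
    finally show ?case
      using Suc dev_sq_step[OF i sp, of n] by (simp add: algebra_simps)
  qed (simp add: dev_def)
  have "(\<integral>\<^sup>+x. devsq n x \<partial>M) = mass (space M) n"
    by (intro nn_integral_cong) auto
  also have "\<dots> = (\<integral>\<^sup>+i. ennreal (energy (space M) i n) \<partial>count_space I)"
    by (rule devsq_eq_sum_integrals[OF sp order_refl])
  also have "\<dots> \<le> (\<integral>\<^sup>+i. ennreal (real n) * (\<integral>\<^sup>+z. ennreal ((\<psi> i z)\<^sup>2) \<partial>P) \<partial>count_space I)"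
  proof (intro nn_integral_mono)
    fix i assume "i \<in> space (count_space I)"
    then have i: "i \<in> I" by simp
    have "ennreal (real n) * (\<integral>\<^sup>+z. ennreal ((\<psi> i z)\<^sup>2) \<partial>P) = ennreal (real n * (\<integral>z. (\<psi> i z)\<^sup>2 \<partial>P))"
      by (subst nn_integral_eq_integral[OF \<psi>_sq_integrable[OF i]]) (auto simp: ennreal_mult)
    then show "ennreal (energy (space M) i n) \<le> ennreal (real n) * (\<integral>\<^sup>+z. ennreal ((\<psi> i z)\<^sup>2) \<partial>P)"
      using d[OF i] by (simp add: ennreal_leI)
  qed
  also have "\<dots> = ennreal (real n) * (\<integral>\<^sup>+z. \<integral>\<^sup>+i. ennreal ((\<psi> i z)\<^sup>2) \<partial>count_space I \<partial>P)"
    by (subst nn_integral_count_space_nn_integral[OF countable_I])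
      (auto simp: nn_integral_cmult intro!: measurable_compose[OF \<psi>_measurable])
  also have "\<dots> \<le> ennreal (real n) * (\<integral>\<^sup>+z. ennreal (c\<^sup>2) \<partial>P)"
  proof (intro mult_left_mono nn_integral_mono)
    fix z assume z: "z \<in> space P"
    show "(\<integral>\<^sup>+i. ennreal ((\<psi> i z)\<^sup>2) \<partial>count_space I) \<le> ennreal (c\<^sup>2)"
      by (rule nn_integral_count_space_le[OF countable_I])
        (use \<psi>_bound[OF z] in \<open>auto simp: ennreal_leI\<close>)
  qed auto
  also have "\<dots> = ennreal (real n * c\<^sup>2)"
    by (simp add: P.emeasure_space_1 ennreal_mult)
  finally show ?thesis .
qed

text \<open>The event is split by the first time of exceedance. The piece for time \<open>k\<close>
  lies in \<open>past k\<close>; on it the threshold is below \<open>devsq k\<close>, and the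
  submartingale property replaces time \<open>k\<close> by \<open>N\<close>. Summing the disjoint
  pieces leaves one expectation at time \<open>N\<close>.\<close>

lemma devsq_maximal:
  assumes t: "0 < t"
  shows "emeasure M {x\<in>space M. \<exists>n\<in>{1..N}. ennreal t < devsq n x} \<le> ennreal (real N * c\<^sup>2 / t)"
    (is "emeasure M ?E \<le> _")
proof -
  define B where "B k = {x\<in>space M. ennreal t < devsq k x \<and> (\<forall>j\<in>{1..<k}. devsq j x \<le> ennreal t)}" for k
  have B: "B k \<in> sets (past k)" for k
  proof -
    have [measurable]: "devsq j \<in> borel_measurable (past k)" if "j \<in> {1..<k} \<union> {k}" for j
      using that by (intro devsq_past) auto
    have "{x\<in>space (past k). ennreal t < devsq k x \<and> (\<forall>j\<in>{1..<k}. devsq j x \<le> ennreal t)} \<in> sets (past k)"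
      by measurable
    then show ?thesis by (simp add: B_def)
  qed
  have BM: "B k \<in> sets M" for k using B past_subset by blast
  have disj: "disjoint_family_on B {1..N}"
  proof (unfold disjoint_family_on_def, intro ballI impI)
    fix j k :: nat assume jk: "j \<in> {1..N}" "k \<in> {1..N}" "j \<noteq> k"
    then consider "j < k" | "k < j" by linarith
    then show "B j \<inter> B k = {}"
      by cases (use jk in \<open>force simp: B_def\<close>)+
  qed
  have "?E = (\<Union>k\<in>{1..N}. B k)"
  proof (intro equalityI subsetI)
    fix x assume "x \<in> ?E"
    then have w: "x \<in> space M" "\<exists>n. n \<in> {1..N} \<and> ennreal t < devsq n x" by auto
    define k where "k = (LEAST n. n \<in> {1..N} \<and> ennreal t < devsq n x)"
    have k: "k \<in> {1..N}" "ennreal t < devsq k x"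
      using LeastI_ex[OF w(2)] by (auto simp: k_def)
    have "devsq j x \<le> ennreal t" if "j \<in> {1..<k}" for j
    proof -
      have "j < (LEAST n. n \<in> {1..N} \<and> ennreal t < devsq n x)"
        using that by (simp add: k_def)
      from not_less_Least[OF this] show ?thesis
        using that k(1) by (auto simp: not_less)
    qed
    then have "x \<in> B k" using w k by (auto simp: B_def)
    then show "x \<in> (\<Union>k\<in>{1..N}. B k)" using k by blast
  qed (auto simp: B_def)
  then have "ennreal t * emeasure M ?E = (\<Sum>k=1..N. ennreal t * emeasure M (B k))"
    using BM disj by (simp add: sum_emeasure[symmetric] sum_distrib_left image_subset_iff)
  also have "\<dots> \<le> (\<Sum>k=1..N. mass (B k) N)"
  proof (intro sum_mono)
    fix k assume k: "k \<in> {1..N}"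
    have "ennreal t * emeasure M (B k) = (\<integral>\<^sup>+x. ennreal t * indicator (B k) x \<partial>M)"
      using BM by (simp add: nn_integral_cmult_indicator)
    also have "\<dots> \<le> mass (B k) k"
      by (intro nn_integral_mono) (auto simp: indicator_def B_def)
    also have "\<dots> \<le> mass (B k) N"
      using k by (intro devsq_submartingale B) auto
    finally show "ennreal t * emeasure M (B k) \<le> mass (B k) N" .
  qed
  also have "\<dots> = (\<integral>\<^sup>+x. (\<Sum>k=1..N. indicator (B k) x * devsq N x) \<partial>M)"
    using BM by (subst nn_integral_sum) auto
  also have "\<dots> \<le> (\<integral>\<^sup>+x. devsq N x \<partial>M)"
  proof (intro nn_integral_mono)
    fix x
    have "(\<Sum>k=1..N. indicator (B k) x * devsq N x) = (\<Sum>k=1..N. indicator (B k) x) * devsq N x"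
      by (simp add: sum_distrib_right)
    also have "(\<Sum>k=1..N. indicator (B k) x :: ennreal) = indicator (\<Union>k\<in>{1..N}. B k) x"
      using disj by (intro indicator_UN_disjoint[symmetric]) auto
    finally show "(\<Sum>k=1..N. indicator (B k) x * devsq N x) \<le> devsq N x"
      by (auto simp: indicator_def)
  qed
  also have "\<dots> \<le> ennreal (real N * c\<^sup>2)" by (rule devsq_expectation)
  finally have "ennreal t * emeasure M ?E \<le> ennreal (real N * c\<^sup>2)" .
  then have "t * measure M ?E \<le> real N * c\<^sup>2"
    using t unfolding emeasure_eq_measure by (subst (asm) ennreal_mult[symmetric]) auto
  then have "measure M ?E \<le> real N * c\<^sup>2 / t"
    using t by (simp add: pos_le_divide_eq mult.commute)
  then show ?thesis
    unfolding emeasure_eq_measure by (rule ennreal_leI)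
qed

text \<open>The maximal event up to time \<open>n\<close> contains the event at time
  \<open>n\<close>. The case \<open>n = 0\<close> is separate because the maximal event ranges over
  \<open>{1..n}\<close>.\<close>

lemma devsq_Markov:
  assumes "0 < t"
  shows "measure M {x\<in>space M. ennreal t < devsq n x} \<le> real n * c\<^sup>2 / t"
proof -
  have "emeasure M {x\<in>space M. ennreal t < devsq n x} \<le> ennreal (real n * c\<^sup>2 / t)"
  proof (cases "n = 0")
    case True
    then show ?thesis by (simp add: devsq_def dev_def)
  next
    case False
    then have "emeasure M {x\<in>space M. ennreal t < devsq n x}
      \<le> emeasure M {x\<in>space M. \<exists>m\<in>{1..n}. ennreal t < devsq m x}"
      by (intro emeasure_mono) auto
    also note devsq_maximal[OF assms]
    finally show ?thesis .
  qed
  then show ?thesis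
    using assms by (simp add: emeasure_eq_measure)
qed

lemma devsq_AE_le:
  "AE x in M. \<forall>\<^sub>F n in sequentially. devsq n x \<le> ennreal (16 * (real n * (ln (real n))\<^sup>2))"
proof -
  \<comment> \<open>The threshold for block \<open>j\<close> is
    \<open>T (j + 1) / 2 = (j + 1)^2 * 2^j\<close>: the power of two cancels the block length in the
    maximal inequality, and the square leaves the summable probabilities
    \<open>2 * c^2 / (j + 1)^2\<close>. As \<open>j\<close> is comparable to \<open>ln n\<close>,
    the square becomes the factor \<open>(ln n)^2\<close>.\<close>
  define T where "T j = (real j)\<^sup>2 * 2 ^ j" for j :: nat
  define B where "B j = {x\<in>space M. \<exists>n\<in>{1..2^(j+1)}. ennreal (T (j+1) / 2) < devsq n x}" for j
  have "B j \<in> sets M" for j unfolding B_def by measurable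
  have em: "emeasure M (B j) \<le> ennreal (2 * c\<^sup>2 / (real (Suc j))\<^sup>2)" for j
  proof -
    have "emeasure M (B j) \<le> ennreal (real (2^(j+1)) * c\<^sup>2 / (T (j+1) / 2))"
      unfolding B_def by (rule devsq_maximal) (simp add: T_def)
    also have "real (2^(j+1)) * c\<^sup>2 / (T (j+1) / 2) = 2 * c\<^sup>2 / (real (Suc j))\<^sup>2"
      by (simp add: T_def field_simps)
    finally show ?thesis .
  qed
  have "AE x in M. \<forall>\<^sub>F j in sequentially. x \<in> space M - B j"
  proof (rule borel_cantelli_AE1)
    show "emeasure M (B j) < \<infinity>" for j using em[of j] by (simp add: emeasure_eq_measure)
    have "summable (\<lambda>j. 2 * c\<^sup>2 * (1 / (real (Suc j))\<^sup>2))"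
      using inverse_squares_sums by (intro summable_mult) (auto simp: sums_iff)
    moreover have "norm (measure M (B j)) \<le> 2 * c\<^sup>2 * (1 / (real (Suc j))\<^sup>2)" for j
    proof -
      have "measure M (B j) \<le> 2 * c\<^sup>2 / (real (Suc j))\<^sup>2"
        using em[of j] unfolding emeasure_eq_measure by (rule ennreal_le_iff[THEN iffD1, rotated]) simp
      then show ?thesis by simp
    qed
    ultimately show "summable (\<lambda>j. measure M (B j))"
      by (rule summable_comparison_test'[where N=0])
  qed fact
  then show ?thesis
  proof (rule AE_mp, intro AE_I2 impI)
    fix x assume "x \<in> space M" and "\<forall>\<^sub>F j in sequentially. x \<in> space M - B j"
    then obtain J where J: "\<And>j. j \<ge> J \<Longrightarrow> x \<in> space M - B j"
      by (auto simp: eventually_sequentially)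
    show "\<forall>\<^sub>F n in sequentially. devsq n x \<le> ennreal (16 * (real n * (ln (real n))\<^sup>2))"
      unfolding eventually_sequentially
    proof (intro exI[of _ "2^(J+1)"] allI impI)
      fix n :: nat assume n: "2^(J+1) \<le> n"
      then have n0: "n > 0" by (metis gr0I le_zero_eq power_not_zero zero_neq_numeral)
      obtain j where j: "2^j \<le> n" "n < 2^(j+1)"
        using ex_power_ivl1[of 2 n] n0 by auto
      have "J < j"
      proof (rule ccontr)
        assume "\<not> J < j"
        then have "(2::nat) ^ (j + 1) \<le> 2 ^ (J + 1)" by (intro power_increasing) auto
        with n j show False by linarith
      qed
      then have "x \<notin> B j" using J[of j] by auto
      then have "devsq n x \<le> ennreal (T (j + 1) / 2)"
        using j n0 \<open>x \<in> space M\<close> by (auto simp: B_def not_less)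
      also have "\<dots> \<le> ennreal (16 * (real n * (ln (real n))\<^sup>2))"
      proof (intro ennreal_leI)
        have j': "(2::real) ^ j \<le> real n"
          using of_nat_mono[OF j(1), where 'a=real] by simp
        \<comment> \<open>From \<open>j * ln 2 \<le> ln n\<close> and
          \<open>ln 2 \<ge> 1 / 2\<close> follows \<open>j \<le> 2 * ln n\<close>; with
          \<open>j \<ge> 1\<close> this gives \<open>j + 1 \<le> 2 * j \<le> 4 * ln n\<close>, whose
          square is the source of \<open>16\<close>.\<close>
        have "real j * ln 2 = ln (2 ^ j)" by (simp add: ln_realpow)
        also have "\<dots> \<le> ln (real n)"
          using j' n0 by (subst ln_le_cancel_iff) auto
        finally have "real j * ln 2 \<le> ln (real n)" .
        moreover have "real j * (1/2) \<le> real j * ln 2"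
          using ln2_ge_two_thirds by (intro mult_left_mono) auto
        moreover have "1 \<le> real j" using \<open>J < j\<close> by simp
        ultimately have "real j + 1 \<le> 4 * ln (real n)" by linarith
        then have "(real j + 1)\<^sup>2 * 2 ^ j \<le> (4 * ln (real n))\<^sup>2 * real n"
          using j' by (intro mult_mono power_mono) auto
        then show "T (j + 1) / 2 \<le> 16 * (real n * (ln (real n))\<^sup>2)"
          by (simp add: T_def algebra_simps power2_eq_square)
      qed
      finally show "devsq n x \<le> ennreal (16 * (real n * (ln (real n))\<^sup>2))" .
    qed
  qed
qed

end

section \<open>Uniform convexity of the power function\<close>

text \<open>Mean value theorem and strict monotonicity of \<open>z powr (r - 1)\<close>, on either
  side of \<open>m\<close>. The derivative is taken at positive points only; at \<open>x = 0\<close>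
  the tangent has the negative value \<open>(1 - r) * m powr r\<close>.\<close>

lemma powr_above_tangent:
  fixes r x m :: real
  assumes r: "1 < r" and m: "0 < m" and x: "0 \<le> x" "x \<noteq> m"
  shows "m powr r + r * m powr (r - 1) * (x - m) < x powr r"
proof (cases "x = 0")
  case True
  have "m powr (r - 1) * m = m powr r"
    using m by (simp add: powr_diff)
  then have "m powr r + r * m powr (r - 1) * (x - m) = (1 - r) * m powr r"
    using True by (simp add: algebra_simps)
  also have "\<dots> < 0" using r m by (intro mult_neg_pos) auto
  finally show ?thesis using True by simp
next
  case False
  then have x0: "0 < x" using x by simp
  have d: "((\<lambda>y. y powr r) has_real_derivative r * y powr (r - 1)) (at y)" if "0 < y" for y
    using that by (rule has_real_derivative_powr)
  consider "x < m" | "m < x" using x by linarith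
  then show ?thesis
  proof cases
    case 1
    obtain z where z: "x < z" "z < m" "m powr r - x powr r = (m - x) * (r * z powr (r - 1))"
      using MVT2[OF 1, of "\<lambda>y. y powr r" "\<lambda>y. r * y powr (r - 1)"] d x0 by force
    have "z powr (r - 1) < m powr (r - 1)"
      using z x0 r by (intro powr_less_mono2) auto
    then have "(m - x) * (r * z powr (r - 1)) < (m - x) * (r * m powr (r - 1))"
      using 1 r by (intro mult_strict_left_mono) auto
    then show ?thesis using z(3) by (simp add: algebra_simps)
  next
    case 2
    obtain z where z: "m < z" "z < x" "x powr r - m powr r = (x - m) * (r * z powr (r - 1))"
      using MVT2[OF 2, of "\<lambda>y. y powr r" "\<lambda>y. r * y powr (r - 1)"] d m by force
    have "m powr (r - 1) < z powr (r - 1)"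
      using z m r by (intro powr_less_mono2) auto
    then have "(x - m) * (r * m powr (r - 1)) < (x - m) * (r * z powr (r - 1))"
      using 2 r by (intro mult_strict_left_mono) auto
    then show ?thesis using z(3) by (simp add: algebra_simps)
  qed
qed

text \<open>The midpoint convexity defect of the \<open>r\<close>-th power of the absolute value; it
  is the amount by which the penalty beats plain convexity.\<close>

definition midgap :: "real \<Rightarrow> real \<Rightarrow> real \<Rightarrow> real" where
  "midgap r s t = (\<bar>s\<bar> powr r + \<bar>t\<bar> powr r) / 2 - \<bar>(s + t) / 2\<bar> powr r"

text \<open>The tangent at \<open>m = |(s + t) / 2|\<close> lies below the power at
  \<open>|s|\<close> and \<open>|t|\<close>, strictly at one of them, and its mean over both is at
  least \<open>m powr r\<close> because \<open>|s| + |t| \<ge> 2 * m\<close>. The tangent requires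
  \<open>m > 0\<close>, hence the case \<open>s + t = 0\<close>.\<close>

lemma midgap_pos:
  assumes r: "1 < r" and st: "s \<noteq> t"
  shows "0 < midgap r s t"
proof (cases "s + t = 0")
  case True
  then have "s \<noteq> 0" using st by auto
  then show ?thesis using True r by (simp add: midgap_def add_pos_nonneg)
next
  case False
  define m where "m = \<bar>(s + t) / 2\<bar>"
  define T where "T x = m powr r + r * m powr (r - 1) * (x - m)" for x
  have m: "0 < m" using False by (simp add: m_def)
  have T: "T x \<le> x powr r" "x \<noteq> m \<Longrightarrow> T x < x powr r" if "0 \<le> x" for x
    using powr_above_tangent[OF r m that] by (cases "x = m"; simp add: T_def)+
  \<comment> \<open>If both absolute values were \<open>m\<close>, then \<open>s \<noteq> t\<close>
    would force \<open>s = - t\<close>.\<close>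
  have "\<bar>s\<bar> \<noteq> m \<or> \<bar>t\<bar> \<noteq> m" using st False by (auto simp: m_def)
  then have "T \<bar>s\<bar> + T \<bar>t\<bar> < \<bar>s\<bar> powr r + \<bar>t\<bar> powr r"
    using T[of "\<bar>s\<bar>"] T[of "\<bar>t\<bar>"] by linarith
  moreover have "2 * m powr r \<le> T \<bar>s\<bar> + T \<bar>t\<bar>"
  proof -
    have "T \<bar>s\<bar> + T \<bar>t\<bar> = 2 * m powr r + r * m powr (r - 1) * (\<bar>s\<bar> + \<bar>t\<bar> - 2 * m)"
      by (simp add: T_def algebra_simps)
    moreover have "0 \<le> r * m powr (r - 1) * (\<bar>s\<bar> + \<bar>t\<bar> - 2 * m)"
      using r by (intro mult_nonneg_nonneg) (auto simp: m_def)
    ultimately show ?thesis by simp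
  qed
  ultimately show ?thesis by (simp add: midgap_def m_def)
qed

lemma midgap_nonneg: "1 < r \<Longrightarrow> 0 \<le> midgap r s t"
  using midgap_pos[of r s t] by (cases "s = t") (auto simp: midgap_def)

text \<open>By homogeneity it suffices to bound the gap from below on a compact set.\<close>
lemma abs_diff_powr_le_midgap:
  fixes r \<tau> :: real
  assumes r: "1 < r" and \<tau>: "0 < \<tau>"
  obtains c where "0 \<le> c"
    "\<And>s t. \<bar>s - t\<bar> powr r \<le> c * midgap r s t + \<tau> * (\<bar>s\<bar> powr r + \<bar>t\<bar> powr r)"
proof -
  \<comment> \<open>Normalized pairs whose difference is not small. The gap has a positive minimum
    on this compact set, and all other normalized pairs are absorbed by the \<open>\<tau>\<close>
    term.\<close>
  define Q where "Q = {x::real\<times>real. \<bar>fst x\<bar> powr r + \<bar>snd x\<bar> powr r = 1 \<and> \<tau> \<le> \<bar>fst x - snd x\<bar> powr r}"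
  have cont: "continuous_on UNIV (\<lambda>x. \<bar>f x\<bar> powr r)" if "continuous_on UNIV f" for f :: "real \<times> real \<Rightarrow> real"
    using that r by (intro continuous_on_powr' continuous_intros) auto
  have le1: "\<bar>s\<bar> \<le> 1 \<and> \<bar>t\<bar> \<le> 1" if "\<bar>s\<bar> powr r + \<bar>t\<bar> powr r = 1" for s t
  proof -
    have "\<bar>a\<bar> \<le> 1" if "\<bar>a\<bar> powr r \<le> 1" for a :: real
    proof (rule ccontr)
      assume "\<not> \<bar>a\<bar> \<le> 1"
      then have "1 powr r < \<bar>a\<bar> powr r" using r by (intro powr_less_mono2) auto
      with that show False by simp
    qed
    moreover have "\<bar>s\<bar> powr r \<le> 1" "\<bar>t\<bar> powr r \<le> 1"
      using that powr_ge_zero[of "\<bar>s\<bar>" r] powr_ge_zero[of "\<bar>t\<bar>" r] by linarith+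
    ultimately show ?thesis by blast
  qed
  have "closed Q"
    unfolding Q_def
    by (intro closed_Collect_conj closed_Collect_eq closed_Collect_le continuous_intros cont)
  moreover have "Q \<subseteq> cbox (-1, -1) (1, 1)"
    using le1 by (fastforce simp: Q_def cbox_Pair_eq mem_box)
  ultimately have Q: "compact Q"
    by (metis compact_Int_closed compact_cbox inf.absorb_iff2 inf_commute)
  have "\<exists>d>0. \<forall>x\<in>Q. d \<le> midgap r (fst x) (snd x)"
  proof (cases "Q = {}")
    case False
    have "continuous_on UNIV (\<lambda>x. midgap r (fst x) (snd x))"
      unfolding midgap_def by (intro continuous_intros cont) auto
    then have "continuous_on Q (\<lambda>x. midgap r (fst x) (snd x))"
      by (rule continuous_on_subset) simp
    from continuous_attains_inf[OF Q False this]
    obtain x where x: "x \<in> Q" "\<forall>y\<in>Q. midgap r (fst x) (snd x) \<le> midgap r (fst y) (snd y)" by blast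
    have "fst x \<noteq> snd x" using x(1) \<tau> r by (auto simp: Q_def)
    from midgap_pos[OF r this] x(2) show ?thesis by blast
  qed (auto intro!: exI[of _ 1])
  then obtain d where d: "d > 0" "\<And>x. x \<in> Q \<Longrightarrow> d \<le> midgap r (fst x) (snd x)" by blast
  \<comment> \<open>\<open>d\<close> bounds the gap from below on \<open>Q\<close>, and
    \<open>2 powr r\<close> bounds \<open>|s - t|^r\<close> for entries in
    \<open>[-1, 1]\<close>.\<close>
  let ?c = "2 powr r / d"
  have "\<bar>s - t\<bar> powr r \<le> ?c * midgap r s t + \<tau> * (\<bar>s\<bar> powr r + \<bar>t\<bar> powr r)" for s t
  proof (cases "s = t")
    case False
    define N where "N = \<bar>s\<bar> powr r + \<bar>t\<bar> powr r"
    have N: "0 < N" using False by (cases "s = 0") (auto simp: N_def add_pos_nonneg)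
    define l where "l = N powr (1 / r)"
    have l: "l > 0" "l powr r = N" using N r by (auto simp: l_def powr_powr)
    have sc: "\<bar>a / l\<bar> powr r = \<bar>a\<bar> powr r / N" for a
      using l by (simp add: abs_divide powr_divide)
    have one: "\<bar>s / l\<bar> powr r + \<bar>t / l\<bar> powr r = 1"
      unfolding sc using N by (simp add: N_def flip: add_divide_distrib)
    have gap: "midgap r (s / l) (t / l) = midgap r s t / N"
    proof -
      have e: "(s / l + t / l) / 2 = (s + t) / 2 / l" by (simp add: add_divide_distrib mult.commute)
      show ?thesis
        unfolding midgap_def e sc by (simp add: add_divide_distrib diff_divide_distrib mult.commute)
    qed
    have diff: "\<bar>s / l - t / l\<bar> powr r = \<bar>s - t\<bar> powr r / N"
      using sc[of "s - t"] by (simp add: diff_divide_distrib)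
    have g0: "0 \<le> midgap r s t" by (rule midgap_nonneg[OF r])
    show ?thesis
    proof (cases "\<tau> \<le> \<bar>s / l - t / l\<bar> powr r")
      case True
      then have "d \<le> midgap r s t / N"
        using d(2)[of "(s / l, t / l)"] one gap by (auto simp: Q_def)
      then have "2 powr r * 1 \<le> 2 powr r * (midgap r s t / N / d)"
        using d(1) by (intro mult_left_mono) (auto simp: pos_le_divide_eq simp del: divide_divide_eq_left)
      moreover have "\<bar>s / l - t / l\<bar> powr r \<le> 2 powr r"
      proof (rule powr_mono2)
        show "\<bar>s / l - t / l\<bar> \<le> 2"
          using le1[OF one] abs_triangle_ineq4[of "s / l" "t / l"] by linarith
      qed (use r in auto)
      ultimately have "\<bar>s - t\<bar> powr r / N \<le> ?c * midgap r s t / N"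
        unfolding diff by (simp add: mult.commute)
      then have "\<bar>s - t\<bar> powr r \<le> ?c * midgap r s t"
        using N by (metis divide_le_cancel not_less_iff_gr_or_eq)
      then show ?thesis using \<tau> N by (simp add: N_def add_increasing2)
    next
      case False
      then have "\<bar>s - t\<bar> powr r \<le> \<tau> * N" using N unfolding diff by (simp add: field_simps)
      moreover have "0 \<le> ?c * midgap r s t" using d(1) g0 by simp
      ultimately show ?thesis by (simp add: N_def)
    qed
  qed (use \<tau> in \<open>simp add: midgap_def\<close>)
  then show thesis using d(1) by (intro that[of ?c]) auto
qed

text \<open>Either \<open>d \<le> \<eta> / 2 * x powr (r - 1)\<close> and the product is absorbed by
  the power term, or \<open>x\<close> is bounded by a power of \<open>d\<close>. With the
  coefficient \<open>\<eta> / 2\<close>, half of the lower bound \<open>\<eta> |t|^r\<close> of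
  \<open>h k\<close> survives.\<close>

lemma Young_scaled:
  fixes d x :: real
  assumes r: "1 < r" and eta: "0 < \<eta>" and d: "0 \<le> d" and x: "0 \<le> x"
  shows "d * x \<le> \<eta> / 2 * x powr r + (2 / \<eta>) powr (1 / (r - 1)) * d powr (r / (r - 1))"
proof (cases "d \<le> \<eta> / 2 * x powr (r - 1)")
  case True
  have "d * x \<le> \<eta> / 2 * x powr (r - 1) * x" using True x by (rule mult_right_mono)
  also have "x powr (r - 1) * x = x powr r"
    using x by (cases "x = 0") (auto simp: powr_diff)
  then have "\<eta> / 2 * x powr (r - 1) * x = \<eta> / 2 * x powr r" by simp
  finally show ?thesis by (simp add: add_increasing2)
next
  case False
  then have "x powr (r - 1) < 2 / \<eta> * d"
    using eta by (auto simp: field_simps)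
  then have "(x powr (r - 1)) powr (1 / (r - 1)) \<le> (2 / \<eta> * d) powr (1 / (r - 1))"
    using r by (intro powr_mono2) auto
  then have "x \<le> (2 / \<eta>) powr (1 / (r - 1)) * d powr (1 / (r - 1))"
    using r x eta d by (simp add: powr_powr flip: powr_mult)
  then have "d * x \<le> d * ((2 / \<eta>) powr (1 / (r - 1)) * d powr (1 / (r - 1)))"
    using d by (rule mult_left_mono)
  also have "\<dots> = (2 / \<eta>) powr (1 / (r - 1)) * (d powr 1 * d powr (1 / (r - 1)))"
    using d by simp
  also have "d powr 1 * d powr (1 / (r - 1)) = d powr (r / (r - 1))"
  proof -
    have "1 + 1 / (r - 1) = r / (r - 1)" using r by (simp add: field_simps)
    then show ?thesis by (simp only: powr_add[symmetric])
  qed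
  finally show ?thesis using eta by (simp add: add_increasing)
qed

text \<open>The supremum is attained at an endpoint chosen by the sign of \<open>t\<close>, and
  closedness puts both endpoints into \<open>D\<close>.\<close>

lemma support_fun_interval:
  assumes "D \<noteq> {}" "closed D" "bounded (D::real set)"
  shows "support_fun D t = ereal (max (Inf D * t) (Sup D * t))"
proof (rule antisym)
  have bdd: "bdd_below D" "bdd_above D"
    using assms by (auto simp: bounded_imp_bdd_below bounded_imp_bdd_above)
  show "support_fun D t \<le> ereal (max (Inf D * t) (Sup D * t))"
    unfolding support_fun_def
  proof (rule SUP_least)
    fix \<nu> assume "\<nu> \<in> D"
    then have "Inf D \<le> \<nu>" "\<nu> \<le> Sup D" using bdd by (auto intro: cInf_lower cSup_upper)
    then show "ereal (\<nu> * t) \<le> ereal (max (Inf D * t) (Sup D * t))"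
      by (cases "0 \<le> t") (auto simp: le_max_iff_disj mult_right_mono mult_right_mono_neg)
  qed
  have "Inf D \<in> D" "Sup D \<in> D"
    using assms bdd by (auto intro: closed_contains_Inf closed_contains_Sup)
  then show "ereal (max (Inf D * t) (Sup D * t)) \<le> support_fun D t"
    unfolding support_fun_def by (auto simp: max_def intro: SUP_upper2)
qed

text \<open>\<open>lsc\<close> speaks of punctured neighbourhoods; the strict inequality at
  \<open>x\<close> itself completes them to full ones.\<close>

lemma lsc_eventually_greater:
  assumes "lsc f" "a < f x"
  shows "\<forall>\<^sub>F y in nhds x. a < f y"
  using assms le_Liminf_iff[of "f x" "at x" f] unfolding lsc_def
  by (auto simp: eventually_nhds_conv_at)

section \<open>The composite penalty\<close>

locale composite_penalty =
  fixes K :: "'k set" and r \<eta> :: real and C D :: "'k \<Rightarrow> real set" and h :: "'k \<Rightarrow> real \<Rightarrow> ereal"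
  assumes r: "1 < r" "r \<le> 2" and eta: "0 < \<eta>"
    and C: "\<And>k. k \<in> K \<Longrightarrow> closed (C k) \<and> is_interval (C k) \<and> 0 \<in> C k"
    and D: "\<And>k. k \<in> K \<Longrightarrow> D k \<noteq> {} \<and> closed (D k) \<and> bounded (D k) \<and> is_interval (D k)"
    and D_Inf: "(\<lambda>k. \<bar>max (Inf (D k)) 0\<bar> powr (r / (r - 1))) summable_on K"
    and D_Sup: "(\<lambda>k. \<bar>max (- Sup (D k)) 0\<bar> powr (r / (r - 1))) summable_on K"
    and h: "\<And>k. k \<in> K \<Longrightarrow> h k \<in> Gamma0_plus \<and> h k 0 = 0 \<and>
      (\<lambda>t. h k t - ereal (\<eta> * \<bar>t\<bar> powr r)) \<in> Gamma0_plus"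
begin

definition supp :: "'k \<Rightarrow> real \<Rightarrow> real" where
  "supp k t = max (Inf (D k) * t) (Sup (D k) * t)"

text \<open>\<open>real_of_ereal\<close> sends \<open>\<infinity>\<close> to \<open>0\<close>, so
  \<open>hr\<close>, and with it \<open>gr\<close>, is meaningful only on
  \<open>dom k\<close>.\<close>

definition hr :: "'k \<Rightarrow> real \<Rightarrow> real" where
  "hr k t = real_of_ereal (h k t)"

definition dom :: "'k \<Rightarrow> real set" where
  "dom k = {t \<in> C k. h k t < \<infinity>}"

definition gr :: "'k \<Rightarrow> real \<Rightarrow> real" where
  "gr k t = supp k t + hr k t"

text \<open>The constant from Young's inequality that makes \<open>gr k t + beta k \<ge> \<eta> / 2 * \<bar>t\<bar> powr r\<close>.\<close>
definition beta :: "'k \<Rightarrow> real" where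
  "beta k = (2 / \<eta>) powr (1 / (r - 1)) *
     (\<bar>max (Inf (D k)) 0\<bar> powr (r / (r - 1)) + \<bar>max (- Sup (D k)) 0\<bar> powr (r / (r - 1)))"

abbreviation "B \<equiv> infsum beta K"

text \<open>A description by real sums; coercivity places its elements in \<open>ell 2 K\<close>,
  and \<open>penalty_dom_eq\<close> identifies it with \<open>penalty_dom\<close>.\<close>

definition domG :: "('k \<Rightarrow> real) set" where
  "domG = {u. (\<forall>k. k \<notin> K \<longrightarrow> u k = 0) \<and> (\<forall>k\<in>K. u k \<in> dom k) \<and> (\<lambda>k. gr k (u k)) summable_on K}"

definition Gr :: "('k \<Rightarrow> real) \<Rightarrow> real" where
  "Gr u = (\<Sum>\<^sub>\<infinity>k\<in>K. gr k (u k))"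

abbreviation "gapsum u v \<equiv> \<Sum>\<^sub>\<infinity>k\<in>K. midgap r (u k) (v k)"
abbreviation "psum u \<equiv> \<Sum>\<^sub>\<infinity>k\<in>K. \<bar>u k\<bar> powr r"

section \<open>Coercivity and convexity of the scalar terms\<close>

lemma beta_nonneg: "0 \<le> beta k"
  by (simp add: beta_def)

lemma beta_summable: "beta summable_on K"
  unfolding beta_def[abs_def] by (intro summable_on_cmult_right summable_on_add D_Inf D_Sup)

lemma B_nonneg: "0 \<le> B"
  by (intro infsum_nonneg beta_nonneg)

lemma h_nonneg: "k \<in> K \<Longrightarrow> 0 \<le> h k t"
  using h[of k] by (auto simp: Gamma0_plus_def)

lemma h_lsc: "k \<in> K \<Longrightarrow> lsc (h k)"
  using h[of k] by (auto simp: Gamma0_plus_def Gamma0_def)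

lemma h_real: "k \<in> K \<Longrightarrow> h k t < \<infinity> \<Longrightarrow> h k t = ereal (hr k t)"
  using h_nonneg[of k t] by (cases "h k t") (auto simp: hr_def)

lemma hr_ge:
  assumes k: "k \<in> K" and f: "h k t < \<infinity>"
  shows "\<eta> * \<bar>t\<bar> powr r \<le> hr k t"
proof -
  have "0 \<le> h k t - ereal (\<eta> * \<bar>t\<bar> powr r)"
    using h[OF k] by (auto simp: Gamma0_plus_def)
  then show ?thesis by (simp add: h_real[OF k f])
qed

text \<open>The third claim is convexity of \<open>h k - \<eta> |.|^r\<close>, kept apart from that
  of \<open>h k\<close> because it is the source of the gap in \<open>gr_midpoint\<close>.\<close>

lemma h_convex:
  assumes k: "k \<in> K" and fin: "h k s < \<infinity>" "h k t < \<infinity>" and \<theta>: "0 < \<theta>" "\<theta> < 1"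
  shows "h k ((1 - \<theta>) * s + \<theta> * t) < \<infinity>"
    and "hr k ((1 - \<theta>) * s + \<theta> * t) \<le> (1 - \<theta>) * hr k s + \<theta> * hr k t"
    and "hr k ((1 - \<theta>) * s + \<theta> * t) - \<eta> * \<bar>(1 - \<theta>) * s + \<theta> * t\<bar> powr r
      \<le> (1 - \<theta>) * (hr k s - \<eta> * \<bar>s\<bar> powr r) + \<theta> * (hr k t - \<eta> * \<bar>t\<bar> powr r)"
proof -
  have "h k ((1 - \<theta>) *\<^sub>R s + \<theta> *\<^sub>R t) \<le> ereal (1 - \<theta>) * h k s + ereal \<theta> * h k t"
    using h[OF k] \<theta> unfolding Gamma0_plus_def Gamma0_def by auto
  then have le: "h k ((1 - \<theta>) * s + \<theta> * t) \<le> ereal ((1 - \<theta>) * hr k s + \<theta> * hr k t)"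
    by (simp add: h_real[OF k fin(1)] h_real[OF k fin(2)])
  also have "\<dots> < \<infinity>" by simp
  finally show f: "h k ((1 - \<theta>) * s + \<theta> * t) < \<infinity>" .
  show "hr k ((1 - \<theta>) * s + \<theta> * t) \<le> (1 - \<theta>) * hr k s + \<theta> * hr k t"
    using le by (simp add: h_real[OF k f])
  have "h k ((1 - \<theta>) *\<^sub>R s + \<theta> *\<^sub>R t) - ereal (\<eta> * \<bar>(1 - \<theta>) *\<^sub>R s + \<theta> *\<^sub>R t\<bar> powr r)
    \<le> ereal (1 - \<theta>) * (h k s - ereal (\<eta> * \<bar>s\<bar> powr r)) + ereal \<theta> * (h k t - ereal (\<eta> * \<bar>t\<bar> powr r))"
    using h[OF k] \<theta> unfolding Gamma0_plus_def Gamma0_def by auto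
  then show "hr k ((1 - \<theta>) * s + \<theta> * t) - \<eta> * \<bar>(1 - \<theta>) * s + \<theta> * t\<bar> powr r
      \<le> (1 - \<theta>) * (hr k s - \<eta> * \<bar>s\<bar> powr r) + \<theta> * (hr k t - \<eta> * \<bar>t\<bar> powr r)"
    by (simp add: h_real[OF k fin(1)] h_real[OF k fin(2)] h_real[OF k f])
qed

lemma supp_convex:
  assumes "0 \<le> \<theta>" "\<theta> \<le> 1"
  shows "supp k ((1 - \<theta>) * s + \<theta> * t) \<le> (1 - \<theta>) * supp k s + \<theta> * supp k t"
proof -
  have "a * ((1 - \<theta>) * s + \<theta> * t) \<le> (1 - \<theta>) * supp k s + \<theta> * supp k t"
    if "a = Inf (D k) \<or> a = Sup (D k)" for a
  proof -
    have "a * s \<le> supp k s" "a * t \<le> supp k t"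
      using that by (auto simp: supp_def)
    then have "(1 - \<theta>) * (a * s) + \<theta> * (a * t) \<le> (1 - \<theta>) * supp k s + \<theta> * supp k t"
      using assms by (intro add_mono mult_left_mono) auto
    then show ?thesis by (simp add: algebra_simps)
  qed
  then show ?thesis unfolding supp_def[of k "(1 - \<theta>) * s + \<theta> * t"] by simp
qed

text \<open>Only a negative \<open>Sup (D k)\<close> on the positive axis and a positive
  \<open>Inf (D k)\<close> on the negative axis can make the support function negative; these are
  the quantities with summable powers.\<close>

lemma supp_ge:
  "- max \<bar>max (Inf (D k)) 0\<bar> \<bar>max (- Sup (D k)) 0\<bar> * \<bar>t\<bar> \<le> supp k t"
proof -
  let ?d = "max \<bar>max (Inf (D k)) 0\<bar> \<bar>max (- Sup (D k)) 0\<bar>"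
  show ?thesis
  proof (cases "0 \<le> t")
    case True
    have "- ?d * \<bar>t\<bar> = - (?d * t)" using True by simp
    also have "\<dots> \<le> - (- Sup (D k) * t)"
      using True by (intro le_imp_neg_le mult_right_mono) auto
    also have "\<dots> \<le> supp k t" by (simp add: supp_def)
    finally show ?thesis .
  next
    case False
    have "- ?d * \<bar>t\<bar> = ?d * t" using False by simp
    also have "\<dots> \<le> Inf (D k) * t"
      using False by (intro mult_right_mono_neg) auto
    also have "\<dots> \<le> supp k t" by (simp add: supp_def)
    finally show ?thesis .
  qed
qed

text \<open>\<open>Young_scaled\<close> with \<open>d\<close> the larger of the two one-sided
  slopes; its power is at most the sum of both powers, which is the summable expression in
  \<open>beta\<close>.\<close>

lemma supp_beta: "- beta k - \<eta> / 2 * \<bar>t\<bar> powr r \<le> supp k t"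
proof -
  let ?a = "\<bar>max (Inf (D k)) 0\<bar>" and ?b = "\<bar>max (- Sup (D k)) 0\<bar>" and ?p = "r / (r - 1)"
  have "max ?a ?b * \<bar>t\<bar> \<le> \<eta> / 2 * \<bar>t\<bar> powr r + (2 / \<eta>) powr (1 / (r - 1)) * max ?a ?b powr ?p"
    by (rule Young_scaled[OF r(1) eta]) auto
  also have "max ?a ?b powr ?p \<le> ?a powr ?p + ?b powr ?p"
    by (cases "?a \<le> ?b") (auto simp: max_def)
  then have "(2 / \<eta>) powr (1 / (r - 1)) * max ?a ?b powr ?p \<le> beta k"
    unfolding beta_def by (intro mult_left_mono) auto
  finally show ?thesis using supp_ge[of k t] by simp
qed

lemma gr_ge:
  assumes "k \<in> K" "t \<in> dom k"
  shows "\<eta> / 2 * \<bar>t\<bar> powr r \<le> gr k t + beta k"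
  using supp_beta[of k t] hr_ge[of k t] assms by (auto simp: gr_def dom_def)

lemma gr_beta_nonneg: "k \<in> K \<Longrightarrow> t \<in> dom k \<Longrightarrow> 0 \<le> gr k t + beta k"
  by (rule order_trans[OF _ gr_ge]) (use eta in auto)

lemma penalty_term:
  assumes k: "k \<in> K"
  shows "indicator_fun (C k) t + support_fun (D k) t + h k t = (if t \<in> dom k then ereal (gr k t) else \<infinity>)"
  using h_real[OF k, of t] h_nonneg[OF k, of t] D[OF k]
  by (auto simp: indicator_fun_def support_fun_interval dom_def gr_def supp_def simp del: ereal_max)

lemma dom_convex:
  assumes k: "k \<in> K" and "s \<in> dom k" "t \<in> dom k" and \<theta>: "0 < \<theta>" "\<theta> < 1"
  shows "(1 - \<theta>) * s + \<theta> * t \<in> dom k"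
proof -
  have "convex (C k)" using C[OF k] by (simp add: is_interval_convex)
  then have "(1 - \<theta>) *\<^sub>R s + \<theta> *\<^sub>R t \<in> C k"
    using assms by (intro convexD) (auto simp: dom_def)
  then show ?thesis using h_convex(1)[OF k _ _ \<theta>] assms by (simp add: dom_def)
qed

lemma zero_dom: "k \<in> K \<Longrightarrow> 0 \<in> dom k"
  using C h by (auto simp: dom_def)

lemma gr_0: "k \<in> K \<Longrightarrow> gr k 0 = 0"
  using h by (auto simp: gr_def supp_def hr_def)

lemma gr_convex:
  assumes k: "k \<in> K" and st: "s \<in> dom k" "t \<in> dom k" and \<theta>: "0 < \<theta>" "\<theta> < 1"
  shows "gr k ((1 - \<theta>) * s + \<theta> * t) \<le> (1 - \<theta>) * gr k s + \<theta> * gr k t"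
  using h_convex(2)[OF k _ _ \<theta>, of s t] supp_convex[of \<theta> k s t] st \<theta>
  by (auto simp: gr_def dom_def algebra_simps)

text \<open>At \<open>\<theta> = 1 / 2\<close> the third part of \<open>h_convex\<close> is the
  midpoint inequality with the gap of \<open>\<eta> |.|^r\<close> moved to the left; the support
  function contributes plain convexity.\<close>

lemma gr_midpoint:
  assumes k: "k \<in> K" and st: "s \<in> dom k" "t \<in> dom k"
  shows "gr k ((s + t) / 2) + \<eta> * midgap r s t \<le> (gr k s + gr k t) / 2"
proof -
  have e: "(1 - 1/2) * s + 1/2 * t = (s + t) / 2" by (simp add: field_simps)
  show ?thesis
    using h_convex(3)[OF k, of s t "1/2"] supp_convex[of "1/2" k s t] st
    unfolding e by (auto simp: gr_def dom_def midgap_def algebra_simps add_divide_distrib)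
qed

section \<open>The summed penalty: coercivity and uniform convexity\<close>

lemma domG_gr_beta:
  assumes "u \<in> domG"
  shows "(\<lambda>k. gr k (u k) + beta k) summable_on K" "(\<Sum>\<^sub>\<infinity>k\<in>K. gr k (u k) + beta k) = Gr u + B"
  using assms beta_summable by (auto simp: domG_def Gr_def summable_on_add infsum_add)

text \<open>The terms \<open>gr k (u k)\<close> may have either sign. Sums are therefore handled
  after adding \<open>beta\<close>, which makes the terms nonnegative and comparison possible; this
  lemma removes the shift again.\<close>

lemma domG_I:
  assumes "\<And>k. k \<notin> K \<Longrightarrow> u k = 0" "\<And>k. k \<in> K \<Longrightarrow> u k \<in> dom k"
    and "(\<lambda>k. gr k (u k) + beta k) summable_on K"
  shows "u \<in> domG"
proof -
  have "(\<lambda>k. (gr k (u k) + beta k) + - beta k) summable_on K"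
    by (intro summable_on_add assms(3)) (simp add: summable_on_uminus beta_summable)
  then show ?thesis using assms by (simp add: domG_def)
qed

text \<open>Termwise coercivity \<open>gr_ge\<close>, summed; every bound on \<open>Gr\<close>
  thereby becomes a norm bound.\<close>

lemma domG_powr:
  assumes u: "u \<in> domG"
  shows "(\<lambda>k. \<bar>u k\<bar> powr r) summable_on K"
    and "psum u \<le> 2 / \<eta> * (Gr u + B)"
proof -
  have le: "\<bar>u k\<bar> powr r \<le> 2 / \<eta> * (gr k (u k) + beta k)" if "k \<in> K" for k
    using gr_ge[OF that, of "u k"] u that eta by (auto simp: domG_def field_simps)
  note s = summable_on_le[of K "\<lambda>k. \<bar>u k\<bar> powr r", OF _ le summable_on_cmult_right[OF domG_gr_beta(1)[OF u]]]
  show "(\<lambda>k. \<bar>u k\<bar> powr r) summable_on K" using s(1) by simp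
  show "psum u \<le> 2 / \<eta> * (Gr u + B)"
    using s(2) unfolding infsum_cmult_right' domG_gr_beta(2)[OF u] by simp
qed

lemma Gr_ge:
  assumes "u \<in> domG"
  shows "- B \<le> Gr u"
proof -
  have "0 \<le> (\<Sum>\<^sub>\<infinity>k\<in>K. gr k (u k) + beta k)"
    using assms by (intro infsum_nonneg gr_beta_nonneg) (auto simp: domG_def)
  then show ?thesis by (simp add: domG_gr_beta(2)[OF assms])
qed

lemma domG_ell_2: "u \<in> domG \<Longrightarrow> u \<in> ell 2 K"
  using sqsum_le_powr_sum(1)[OF r domG_powr(1)] by (auto simp: ell_2_iff domG_def)

lemma zero_domG: "(\<lambda>_. 0) \<in> domG" and Gr_0: "Gr (\<lambda>_. 0) = 0"
  using summable_on_cong[of K "\<lambda>k. gr k 0" "\<lambda>_. 0"] infsum_cong[of K "\<lambda>k. gr k 0" "\<lambda>_. 0"]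
  by (auto simp: domG_def Gr_def zero_dom gr_0)

lemma finite_support_domG:
  assumes "finite J" "J \<subseteq> K" "\<And>k. k \<notin> J \<Longrightarrow> u k = 0" "\<And>k. k \<in> J \<Longrightarrow> u k \<in> dom k"
  shows "u \<in> domG"
proof -
  have "(\<lambda>k. gr k (u k)) summable_on K"
    by (rule finite_nonzero_values_imp_summable_on, rule finite_subset[OF _ assms(1)])
      (use assms gr_0 in force)
  then show ?thesis using assms zero_dom by (fastforce simp: domG_def)
qed

lemma convex_comb_domG:
  assumes u: "u \<in> domG" and v: "v \<in> domG" and \<theta>: "0 < \<theta>" "\<theta> < 1"
  shows "(\<lambda>k. (1 - \<theta>) * u k + \<theta> * v k) \<in> domG"
    and "Gr (\<lambda>k. (1 - \<theta>) * u k + \<theta> * v k) \<le> (1 - \<theta>) * Gr u + \<theta> * Gr v"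
proof -
  let ?w = "\<lambda>k. (1 - \<theta>) * u k + \<theta> * v k"
  have w: "?w k \<in> dom k" if "k \<in> K" for k
    using u v that \<theta> by (intro dom_convex) (auto simp: domG_def)
  have le: "gr k (?w k) + beta k \<le> (1 - \<theta>) * (gr k (u k) + beta k) + \<theta> * (gr k (v k) + beta k)" if "k \<in> K" for k
    using gr_convex[of k "u k" "v k" \<theta>] u v that \<theta> by (auto simp: domG_def algebra_simps)
  have sm: "(\<lambda>k. (1 - \<theta>) * (gr k (u k) + beta k) + \<theta> * (gr k (v k) + beta k)) summable_on K"
    by (intro summable_on_add summable_on_cmult_right domG_gr_beta u v)
  note s = summable_on_le[of K "\<lambda>k. gr k (?w k) + beta k", OF gr_beta_nonneg[OF _ w] le sm]
  show d: "?w \<in> domG"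
    using u v w s(1) by (intro domG_I) (auto simp: domG_def)
  have "Gr ?w + B \<le> (1 - \<theta>) * (Gr u + B) + \<theta> * (Gr v + B)"
    using s(2) by (simp add: domG_gr_beta(2)[OF d] domG_gr_beta[OF u] domG_gr_beta[OF v]
        infsum_add summable_on_cmult_right infsum_cmult_right')
  then show "Gr ?w \<le> (1 - \<theta>) * Gr u + \<theta> * Gr v" by (simp add: algebra_simps)
qed

text \<open>The inequality of \<open>gr_midpoint\<close> is summed in shifted form: the weights
  \<open>1/2\<close>, \<open>1/2\<close> and \<open>-1\<close> add up to \<open>0\<close>, so the
  shifts cancel. Summability of the gaps follows by comparison.\<close>

lemma midpoint_domG:
  assumes u: "u \<in> domG" and v: "v \<in> domG"
  shows "(\<lambda>k. (u k + v k) / 2) \<in> domG"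
    and "(\<lambda>k. midgap r (u k) (v k)) summable_on K"
    and "Gr (\<lambda>k. (u k + v k) / 2) + \<eta> * gapsum u v \<le> (Gr u + Gr v) / 2"
proof -
  let ?w = "\<lambda>k. (u k + v k) / 2"
  have e: "(\<lambda>k. (1 - 1/2) * u k + 1/2 * v k) = ?w" by (auto simp: field_simps)
  show w: "?w \<in> domG" using convex_comb_domG(1)[OF u v, of "1/2"] unfolding e by simp
  have le: "\<eta> * midgap r (u k) (v k) \<le> 1/2 * (gr k (u k) + beta k) + 1/2 * (gr k (v k) + beta k) + (-1) * (gr k (?w k) + beta k)"
    if "k \<in> K" for k
  proof -
    have "gr k (?w k) + \<eta> * midgap r (u k) (v k) \<le> (gr k (u k) + gr k (v k)) / 2"
      using u v that by (intro gr_midpoint) (auto simp: domG_def)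
    moreover have "x + y \<le> (a + b) / 2 \<Longrightarrow> y \<le> 1/2 * (a + c) + 1/2 * (b + c) + (-1) * (x + c)" for x y a b c :: real
      by (simp add: field_simps)
    ultimately show ?thesis by blast
  qed
  have sm: "(\<lambda>k. 1/2 * (gr k (u k) + beta k) + 1/2 * (gr k (v k) + beta k) + (-1) * (gr k (?w k) + beta k)) summable_on K"
    by (intro summable_on_add summable_on_cmult_right domG_gr_beta u v w)
  note s = summable_on_le[of K "\<lambda>k. \<eta> * midgap r (u k) (v k)", OF _ le sm]
  have "(\<lambda>k. \<eta> * midgap r (u k) (v k)) summable_on K"
    using s(1) eta midgap_nonneg[OF r(1)] by simp
  then show "(\<lambda>k. midgap r (u k) (v k)) summable_on K"
    using eta summable_on_cmult_right'[of \<eta> "\<lambda>k. midgap r (u k) (v k)" K] by simp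
  have "\<eta> * gapsum u v = (\<Sum>\<^sub>\<infinity>k\<in>K. \<eta> * midgap r (u k) (v k))"
    by (simp add: infsum_cmult_right')
  also have "\<dots> \<le> (\<Sum>\<^sub>\<infinity>k\<in>K. 1/2 * (gr k (u k) + beta k) + 1/2 * (gr k (v k) + beta k) + (-1) * (gr k (?w k) + beta k))"
    using s(2) eta midgap_nonneg[OF r(1)] by simp
  also have "\<dots> = 1/2 * (Gr u + B) + 1/2 * (Gr v + B) + (-1) * (Gr ?w + B)"
    by (simp only: infsum_add infsum_cmult_right' domG_gr_beta[OF u] domG_gr_beta[OF v] domG_gr_beta[OF w]
       summable_on_add summable_on_cmult_right)
  finally show "Gr ?w + \<eta> * gapsum u v \<le> (Gr u + Gr v) / 2"
    by (simp add: field_simps)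
qed

section \<open>Lower semicontinuity of the penalty under coordinatewise convergence\<close>

lemma tendsto_supp: "(f \<longlongrightarrow> t) F \<Longrightarrow> ((\<lambda>x. supp k (f x)) \<longlongrightarrow> supp k t) F"
  unfolding supp_def by (intro tendsto_max tendsto_intros)

text \<open>If \<open>h k\<close> were \<open>\<infinity>\<close> at the limit, lower semicontinuity
  would push \<open>h k (x j)\<close> above every real bound, whereas
  \<open>gr k (x j) \<le> c\<close> and continuity of the support function keep it bounded.\<close>

lemma dom_limit:
  assumes k: "k \<in> K" and x: "x \<longlonglongrightarrow> t" and xd: "\<And>j. x j \<in> dom k" and le: "\<And>j. gr k (x j) \<le> c"
  shows "t \<in> dom k"
proof -
  have "\<forall>j. x j \<in> C k" using xd by (auto simp: dom_def)
  then have tC: "t \<in> C k" using C[OF k] closed_sequentially[of "C k" x t] x by blast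
  have hx: "h k (x j) = ereal (hr k (x j))" for j
    using h_real[OF k] xd by (auto simp: dom_def)
  have hle: "hr k (x j) \<le> c - supp k (x j)" for j
    using le[of j] by (simp add: gr_def)
  have key: "a \<le> c - supp k t" if "ereal a < h k t" for a
  proof -
    have "\<forall>\<^sub>F j in sequentially. ereal a < h k (x j)"
      using lsc_eventually_greater[OF h_lsc[OF k] that] x unfolding filterlim_iff by blast
    then have "\<forall>\<^sub>F j in sequentially. a \<le> c - supp k (x j)"
    proof eventually_elim
      case (elim j)
      then have "a < hr k (x j)" by (simp add: hx)
      then show ?case using hle[of j] by simp
    qed
    moreover have "(\<lambda>j. c - supp k (x j)) \<longlonglongrightarrow> c - supp k t"
      by (intro tendsto_intros tendsto_supp x)
    ultimately show ?thesis
      using tendsto_lowerbound[of "\<lambda>j. c - supp k (x j)" _ sequentially a] by simp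
  qed
  have "h k t < \<infinity>"
  proof (rule ccontr)
    assume "\<not> h k t < \<infinity>"
    \<comment> \<open>Every real lies below \<open>\<infinity>\<close>; this one exceeds the bound
      in \<open>key\<close> by one.\<close>
    then have "ereal (c - supp k t + 1) < h k t" by simp
    from key[OF this] show False by simp
  qed
  then show ?thesis using tC by (simp add: dom_def)
qed

lemma gr_limit:
  assumes k: "k \<in> K" and x: "x \<longlonglongrightarrow> t" and xd: "\<And>j. x j \<in> dom k" and t: "t \<in> dom k"
    and e: "0 < e"
  shows "\<forall>\<^sub>F j in sequentially. gr k t - e < gr k (x j)"
proof -
  have hx: "h k (x j) = ereal (hr k (x j))" for j
    using h_real[OF k] xd by (auto simp: dom_def)
  have ht: "h k t = ereal (hr k t)"
    using h_real[OF k] t by (auto simp: dom_def)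
  have "\<forall>\<^sub>F j in sequentially. ereal (hr k t - e / 2) < h k (x j)"
    using lsc_eventually_greater[OF h_lsc[OF k], of "ereal (hr k t - e / 2)" t] ht e x
    unfolding filterlim_iff by auto
  moreover have "\<forall>\<^sub>F j in sequentially. supp k t - e / 2 < supp k (x j)"
    by (rule order_tendstoD(1)[OF tendsto_supp[OF x]]) (use e in simp)
  ultimately show ?thesis
    by eventually_elim (auto simp: hx gr_def)
qed

text \<open>Fatou's argument: finite partial sums of the nonnegative shifted terms are lower
  semicontinuous, and their bound \<open>c + B\<close> is the same for all finite sets.\<close>

lemma domG_closed:
  assumes u: "\<And>j. u j \<in> domG" and le: "\<And>j. Gr (u j) \<le> c"
    and lim: "\<And>k. k \<in> K \<Longrightarrow> (\<lambda>j. u j k) \<longlonglongrightarrow> v k" and v0: "\<And>k. k \<notin> K \<Longrightarrow> v k = 0"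
  shows "v \<in> domG" and "Gr v \<le> c"
proof -
  have ud: "u j k \<in> dom k" if "k \<in> K" for j k
    using u that by (auto simp: domG_def)
  have fin: "(\<Sum>k\<in>J. gr k (u j k) + beta k) \<le> c + B" if J: "finite J" "J \<subseteq> K" for J j
  proof -
    have "(\<Sum>k\<in>J. gr k (u j k) + beta k) \<le> (\<Sum>\<^sub>\<infinity>k\<in>K. gr k (u j k) + beta k)"
      using J by (intro finite_sum_le_infsum_real domG_gr_beta u gr_beta_nonneg ud)
    also have "\<dots> \<le> c + B" using le[of j] by (simp add: domG_gr_beta(2)[OF u])
    finally show ?thesis .
  qed
  have vd: "v k \<in> dom k" if k: "k \<in> K" for k
    by (rule dom_limit[OF k lim[OF k], of "c + B - beta k"])
      (use ud k fin[of "{k}"] in \<open>auto simp: algebra_simps\<close>)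
  have fin': "(\<Sum>k\<in>J. gr k (v k) + beta k) \<le> c + B" if J: "finite J" "J \<subseteq> K" for J
  proof (rule field_le_epsilon)
    fix e :: real assume e: "0 < e"
    \<comment> \<open>Each of the \<open>card J\<close> terms may lose \<open>d\<close>; the
      \<open>+ 1\<close> covers the empty set.\<close>
    define d where "d = e / (real (card J) + 1)"
    have d: "0 < d" using e by (simp add: d_def)
    have "\<forall>\<^sub>F j in sequentially. \<forall>k\<in>J. gr k (v k) - d < gr k (u j k)"
      using J by (intro eventually_ball_finite ballI gr_limit lim ud vd d) auto
    then obtain j where j: "\<forall>k\<in>J. gr k (v k) - d < gr k (u j k)"
      by (auto simp: eventually_sequentially)
    have "(\<Sum>k\<in>J. gr k (v k) + beta k) \<le> (\<Sum>k\<in>J. (gr k (u j k) + beta k) + d)"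
      using j by (intro sum_mono) force
    also have "\<dots> \<le> c + B + real (card J) * d"
      using fin[OF J, of j] by (simp add: sum.distrib)
    also have "real (card J) * d \<le> e"
      using e by (simp add: d_def field_simps)
    finally show "(\<Sum>k\<in>J. gr k (v k) + beta k) \<le> c + B + e" by simp
  qed
  note s = summable_on_sum_le[of K "\<lambda>k. gr k (v k) + beta k", OF gr_beta_nonneg[OF _ vd] fin']
  show v: "v \<in> domG" by (rule domG_I[OF v0 vd]) (use s(1) in auto)
  show "Gr v \<le> c" using s(2) by (simp add: domG_gr_beta(2)[OF v])
qed

text \<open>On \<open>domG\<close> the real sum is embedded into the extended reals. Otherwise the
  finite partial sums tend to \<open>\<infinity>\<close>: either one term is
  \<open>\<infinity>\<close>, and with it every sum containing it, or the shifted terms have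
  unbounded partial sums, from which the shift takes away at most \<open>B\<close>.\<close>

lemma penalty_eq:
  assumes u0: "\<And>k. k \<notin> K \<Longrightarrow> u k = 0"
  shows "penalty K C D h u = (if u \<in> domG then ereal (Gr u) else \<infinity>)"
proof -
  define e where "e k = (if u k \<in> dom k then ereal (gr k (u k)) else \<infinity>)" for k
  have pe: "penalty K C D h u = (\<Sum>\<^sub>\<infinity>k\<in>K. e k)"
    unfolding penalty_def e_def by (intro infsum_cong penalty_term)
  show ?thesis
  proof (cases "u \<in> domG")
    case True
    then have "((\<lambda>k. gr k (u k)) has_sum Gr u) K"
      by (auto simp: domG_def Gr_def)
    then have "((\<lambda>J. ereal (\<Sum>k\<in>J. gr k (u k))) \<longlongrightarrow> ereal (Gr u)) (finite_subsets_at_top K)"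
      unfolding has_sum_def by (rule tendsto_ereal)
    moreover have "\<forall>\<^sub>F J in finite_subsets_at_top K. ereal (\<Sum>k\<in>J. gr k (u k)) = sum e J"
      using True by (intro eventually_finite_subsets_at_top_weakI)
        (auto simp: e_def domG_def subset_iff simp flip: sum_ereal intro!: sum.cong)
    ultimately have "(e has_sum ereal (Gr u)) K"
      unfolding has_sum_def by (rule Lim_transform_eventually)
    then show ?thesis using True pe by (simp add: infsumI)
  next
    case False
    have "\<exists>J. finite J \<and> J \<subseteq> K \<and> (\<forall>J'. finite J' \<and> J \<subseteq> J' \<and> J' \<subseteq> K \<longrightarrow> ereal a < sum e J')" for a :: real
    proof (cases "\<forall>k\<in>K. u k \<in> dom k")
      case dm: True
      then have nn: "0 \<le> gr k (u k) + beta k" if "k \<in> K" for k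
        using that gr_beta_nonneg by blast
      have "\<not> (\<lambda>k. gr k (u k) + beta k) summable_on K"
        using domG_I[of u] u0 dm False by blast
      then obtain J where J: "finite J" "J \<subseteq> K" "a + B < (\<Sum>k\<in>J. gr k (u k) + beta k)"
        using summable_on_sum_le(1)[of K "\<lambda>k. gr k (u k) + beta k" "a + B"] nn by (meson not_le)
      have "ereal a < sum e J'" if J': "finite J'" "J \<subseteq> J'" "J' \<subseteq> K" for J'
      proof -
        have "(\<Sum>k\<in>J. gr k (u k) + beta k) \<le> (\<Sum>k\<in>J'. gr k (u k) + beta k)"
          using J' nn by (intro sum_mono2) auto
        moreover have "sum beta J' \<le> B"
          using J' by (intro finite_sum_le_infsum_real beta_summable beta_nonneg)
        ultimately have "a < (\<Sum>k\<in>J'. gr k (u k))"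
          using J(3) by (simp add: sum.distrib)
        moreover have "sum e J' = (\<Sum>k\<in>J'. ereal (gr k (u k)))"
          using dm J' by (intro sum.cong) (auto simp: e_def)
        ultimately show ?thesis by simp
      qed
      then show ?thesis using J by blast
    next
      case nd: False
      then obtain k where k: "k \<in> K" "u k \<notin> dom k" by blast
      have "sum e J' = \<infinity>" if "finite J'" "{k} \<subseteq> J'" for J'
        using that k by (auto simp: sum_Pinfty e_def)
      then show ?thesis using k by (intro exI[of _ "{k}"]) auto
    qed
    then have "(sum e \<longlongrightarrow> \<infinity>) (finite_subsets_at_top K)"
      unfolding tendsto_PInfty eventually_finite_subsets_at_top by blast
    then have "(e has_sum \<infinity>) K" by (simp add: has_sum_def)
    then show ?thesis using False pe by (simp add: infsumI)
  qed
qed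

lemma penalty_dom_eq: "penalty_dom K C D h = domG"
proof -
  have "u \<in> ell 2 K \<and> penalty K C D h u < \<infinity> \<longleftrightarrow> u \<in> domG" for u
  proof (cases "u \<in> ell 2 K")
    case True
    then show ?thesis using penalty_eq[of u] by (auto simp: ell_2_iff)
  qed (use domG_ell_2 in auto)
  then show ?thesis by (auto simp: penalty_dom_def)
qed

section \<open>Selection of a minimizer\<close>

text \<open>The \<open>r\<close>-th power of the distance in \<open>ell r K\<close>; the root is
  taken only in \<open>ell_norm_pdist\<close>.\<close>

definition pdist :: "('k \<Rightarrow> real) \<Rightarrow> ('k \<Rightarrow> real) \<Rightarrow> real" where
  "pdist u v = (\<Sum>\<^sub>\<infinity>k\<in>K. \<bar>u k - v k\<bar> powr r)"

lemma pdist_nonneg: "0 \<le> pdist u v"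
  unfolding pdist_def by (intro infsum_nonneg) auto

lemma pdist_summable:
  assumes "u \<in> domG" "v \<in> domG"
  shows "(\<lambda>k. \<bar>u k - v k\<bar> powr r) summable_on K"
proof (rule summable_on_le)
  fix k
  let ?m = "max \<bar>u k\<bar> \<bar>v k\<bar>"
  have "\<bar>u k - v k\<bar> powr r \<le> (2 * ?m) powr r"
    using r by (intro powr_mono2) auto
  also have "\<dots> = 2 powr r * ?m powr r" by (simp add: powr_mult)
  also have "\<dots> \<le> 2 powr r * (\<bar>u k\<bar> powr r + \<bar>v k\<bar> powr r)"
    by (intro mult_left_mono) (auto simp: max_def)
  finally show "\<bar>u k - v k\<bar> powr r \<le> 2 powr r * (\<bar>u k\<bar> powr r + \<bar>v k\<bar> powr r)" .
qed (use assms in \<open>auto intro!: summable_on_cmult_right summable_on_add domG_powr\<close>)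

lemma coord_le_pdist:
  assumes "u \<in> domG" "v \<in> domG" "k \<in> K"
  shows "\<bar>u k - v k\<bar> powr r \<le> pdist u v"
  unfolding pdist_def by (rule term_le_infsum_real[OF pdist_summable[OF assms(1,2)] assms(3)]) simp

lemma coord_less:
  assumes "u \<in> domG" "v \<in> domG" "k \<in> K" "0 < e" "pdist u v < e powr r"
  shows "\<bar>u k - v k\<bar> < e"
proof (rule ccontr)
  assume "\<not> \<bar>u k - v k\<bar> < e"
  then have "e powr r \<le> \<bar>u k - v k\<bar> powr r" using assms r by (intro powr_mono2) auto
  then show False using coord_le_pdist[OF assms(1-3)] assms(5) by simp
qed

lemma pdist_tendsto_coord:
  assumes u: "\<And>j. u j \<in> domG" and v: "v \<in> domG" and lim: "(\<lambda>j. pdist (u j) v) \<longlonglongrightarrow> 0"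
    and k: "k \<in> K"
  shows "(\<lambda>j. u j k) \<longlonglongrightarrow> v k"
proof (rule tendstoI)
  fix e :: real assume e: "0 < e"
  then have "0 < e powr r" by simp
  from order_tendstoD(2)[OF lim this] show "\<forall>\<^sub>F j in sequentially. dist (u j k) (v k) < e"
    by eventually_elim (use coord_less[OF u v k e] in \<open>auto simp: dist_real_def\<close>)
qed

text \<open>The scalar inequality summed, with coercivity replacing the two \<open>psum\<close>
  terms by penalties. The constant \<open>c\<close> is uniform over \<open>domG\<close>.\<close>

lemma pdist_le_midgap:
  assumes \<tau>: "0 < \<tau>"
  obtains c where "0 \<le> c" "\<And>u v. u \<in> domG \<Longrightarrow> v \<in> domG \<Longrightarrow>
    pdist u v \<le> c * gapsum u v + \<tau> * (2 / \<eta> * (Gr u + B) + 2 / \<eta> * (Gr v + B))"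
proof -
  obtain c where c: "0 \<le> c"
    "\<And>s t. \<bar>s - t\<bar> powr r \<le> c * midgap r s t + \<tau> * (\<bar>s\<bar> powr r + \<bar>t\<bar> powr r)"
    by (rule abs_diff_powr_le_midgap[OF r(1) \<tau>]) blast
  have "pdist u v \<le> c * gapsum u v + \<tau> * (2 / \<eta> * (Gr u + B) + 2 / \<eta> * (Gr v + B))"
    if u: "u \<in> domG" and v: "v \<in> domG" for u v
  proof -
    note sm = midpoint_domG(2)[OF u v] domG_powr(1)[OF u] domG_powr(1)[OF v]
    have "pdist u v \<le> (\<Sum>\<^sub>\<infinity>k\<in>K. c * midgap r (u k) (v k) + \<tau> * (\<bar>u k\<bar> powr r + \<bar>v k\<bar> powr r))"
      unfolding pdist_def
      by (intro infsum_mono pdist_summable u v c summable_on_add summable_on_cmult_right sm)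
    also have "\<dots> = c * gapsum u v +
       \<tau> * (psum u + psum v)"
      by (simp only: infsum_add infsum_cmult_right' summable_on_add summable_on_cmult_right sm)
    also have "\<dots> \<le> c * gapsum u v + \<tau> * (2 / \<eta> * (Gr u + B) + 2 / \<eta> * (Gr v + B))"
      using \<tau> by (intro add_left_mono mult_left_mono add_mono domG_powr(2) u v) auto
    finally show ?thesis .
  qed
  then show thesis using c(1) that by blast
qed

text \<open>Small midpoint defects make \<open>gapsum\<close> small, hence \<open>pdist\<close>
  small. Completeness is proved by hand: coordinates converge, \<open>domG_closed\<close> keeps the
  limit in \<open>domG\<close>, and finite sums carry the Cauchy bound over to the limit.\<close>

lemma pdist_Cauchy_limit:
  assumes u: "\<And>j. u j \<in> domG" and le: "\<And>j. Gr (u j) \<le> c0"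
    and gap: "\<And>e. 0 < e \<Longrightarrow> \<exists>N. \<forall>i\<ge>N. \<forall>j\<ge>N. (Gr (u i) + Gr (u j)) / 2 - Gr (\<lambda>k. (u i k + u j k) / 2) \<le> e"
  obtains v where "v \<in> domG" "(\<lambda>j. pdist (u j) v) \<longlonglongrightarrow> 0"
proof -
  have cauchy: "\<exists>N. \<forall>i\<ge>N. \<forall>j\<ge>N. pdist (u i) (u j) \<le> e" if e: "0 < e" for e
  proof -
    \<comment> \<open>\<open>A\<close> bounds the bracket in \<open>pdist_le_midgap\<close> for any
      two members of the sequence, so \<open>\<tau>\<close> keeps that part below
      \<open>e / 2\<close>; the defect bound \<open>e * \<eta> / (2 * (c + 1))\<close> does the same
      for the gap part.\<close>
    define A where "A = 4 / \<eta> * (c0 + B)"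
    have A: "0 \<le> A"
      using Gr_ge[OF u[of 0]] le[of 0] eta by (auto simp: A_def)
    define \<tau> where "\<tau> = e / (2 * (A + 1))"
    have frac: "e / (2 * (x + 1)) * x \<le> e / 2" if "0 \<le> x" for x
    proof -
      have "e / (2 * (x + 1)) * x = e / 2 * (x / (x + 1))" by simp
      also have "\<dots> \<le> e / 2 * 1" using that e by (intro mult_left_mono) auto
      finally show ?thesis by simp
    qed
    have \<tau>: "0 < \<tau>" "\<tau> * A \<le> e / 2"
      using e A frac[OF A] by (simp_all add: \<tau>_def)
    obtain c where c: "0 \<le> c" "\<And>u v. u \<in> domG \<Longrightarrow> v \<in> domG \<Longrightarrow>
      pdist u v \<le> c * gapsum u v + \<tau> * (2 / \<eta> * (Gr u + B) + 2 / \<eta> * (Gr v + B))"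
      by (rule pdist_le_midgap[OF \<tau>(1)]) blast
    have "0 < e * \<eta> / (2 * (c + 1))" using e eta c by simp
    from gap[OF this] obtain N where N: "\<And>i j. i \<ge> N \<Longrightarrow> j \<ge> N \<Longrightarrow>
       (Gr (u i) + Gr (u j)) / 2 - Gr (\<lambda>k. (u i k + u j k) / 2) \<le> e * \<eta> / (2 * (c + 1))" by blast
    have "pdist (u i) (u j) \<le> e" if ij: "i \<ge> N" "j \<ge> N" for i j
    proof -
      let ?g = "gapsum (u i) (u j)"
      have "\<eta> * ?g \<le> e * \<eta> / (2 * (c + 1))"
        using midpoint_domG(3)[OF u[of i] u[of j]] N[OF ij] by linarith
      also have "\<dots> = \<eta> * (e / (2 * (c + 1)))" by simp
      finally have "\<eta> * ?g \<le> \<eta> * (e / (2 * (c + 1)))" .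
      then have "?g \<le> e / (2 * (c + 1))" using eta by (simp only: mult_le_cancel_left_pos)
      then have "c * ?g \<le> c * (e / (2 * (c + 1)))" using c(1) by (rule mult_left_mono)
      also have "\<dots> \<le> e / 2" using frac[OF c(1)] by (simp only: mult.commute)
      finally have "c * ?g \<le> e / 2" .
      moreover have "2 / \<eta> * (Gr (u i) + B) + 2 / \<eta> * (Gr (u j) + B) \<le> 2 / \<eta> * (c0 + B) + 2 / \<eta> * (c0 + B)"
        using eta le by (intro add_mono mult_left_mono) auto
      then have "2 / \<eta> * (Gr (u i) + B) + 2 / \<eta> * (Gr (u j) + B) \<le> A"
        by (simp add: A_def)
      then have "\<tau> * (2 / \<eta> * (Gr (u i) + B) + 2 / \<eta> * (Gr (u j) + B)) \<le> \<tau> * A"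
        using \<tau>(1) by (intro mult_left_mono) auto
      ultimately show ?thesis using c(2)[OF u[of i] u[of j]] \<tau>(2) by linarith
    qed
    then show ?thesis by blast
  qed
  have conv: "convergent (\<lambda>j. u j k)" if k: "k \<in> K" for k
  proof (intro Cauchy_convergent CauchyI)
    fix e :: real assume e: "0 < e"
    then have "0 < e powr r / 2" by simp
    from cauchy[OF this] obtain N where "\<forall>i\<ge>N. \<forall>j\<ge>N. pdist (u i) (u j) \<le> e powr r / 2" by blast
    moreover have "e powr r / 2 < e powr r" using e by simp
    ultimately have "\<forall>i\<ge>N. \<forall>j\<ge>N. pdist (u i) (u j) < e powr r" by (meson le_less_trans)
    then show "\<exists>N. \<forall>i\<ge>N. \<forall>j\<ge>N. norm (u i k - u j k) < e"
      unfolding real_norm_def using coord_less[OF u u k e] by blast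
  qed
  define v where "v k = (if k \<in> K then lim (\<lambda>j. u j k) else 0)" for k
  have lim: "(\<lambda>j. u j k) \<longlonglongrightarrow> v k" if "k \<in> K" for k
    using conv[OF that] that by (simp add: v_def convergent_LIMSEQ_iff)
  have v: "v \<in> domG"
  proof (rule domG_closed(1)[OF u le lim])
    show "v k = 0" if "k \<notin> K" for k using that unfolding v_def by (rule if_not_P)
  qed
  have "(\<lambda>j. pdist (u j) v) \<longlonglongrightarrow> 0"
  proof (rule LIMSEQ_I)
    fix e :: real assume "0 < e"
    then have "0 < e / 2" by simp
    from cauchy[OF this] obtain N where N: "\<And>i j. i \<ge> N \<Longrightarrow> j \<ge> N \<Longrightarrow> pdist (u i) (u j) \<le> e / 2" by blast
    have "pdist (u j) v \<le> e / 2" if j: "j \<ge> N" for j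
      unfolding pdist_def
    proof (rule summable_on_sum_le(2))
      fix J assume J: "finite J" "J \<subseteq> K"
      have "(\<lambda>i. \<Sum>k\<in>J. \<bar>u j k - u i k\<bar> powr r) \<longlonglongrightarrow> (\<Sum>k\<in>J. \<bar>u j k - v k\<bar> powr r)"
        using J r by (intro tendsto_sum tendsto_powr' tendsto_rabs tendsto_diff tendsto_const lim) auto
      moreover have "(\<Sum>k\<in>J. \<bar>u j k - u i k\<bar> powr r) \<le> e / 2" if "i \<ge> N" for i
      proof -
        have "(\<Sum>k\<in>J. \<bar>u j k - u i k\<bar> powr r) \<le> pdist (u j) (u i)"
          unfolding pdist_def using J by (intro finite_sum_le_infsum_real pdist_summable u) auto
        then show ?thesis using N[OF j that] by simp
      qed
      ultimately show "(\<Sum>k\<in>J. \<bar>u j k - v k\<bar> powr r) \<le> e / 2"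
        by (intro LIMSEQ_le_const2) auto
    qed auto
    then show "\<exists>N. \<forall>j\<ge>N. norm (pdist (u j) v - 0) < e"
      using \<open>0 < e\<close> pdist_nonneg by (intro exI[of _ N]) (force intro: le_less_trans)
  qed
  with v show thesis by (rule that)
qed

text \<open>The infimum \<open>m n\<close> of the penalty over the sublevel set \<open>L n\<close>
  increases to some \<open>\<mu>\<close>. Two points of \<open>L N\<close> with penalty close to
  \<open>\<mu>\<close> have their midpoint in \<open>L N\<close>, so its penalty is at least
  \<open>m N\<close>; the midpoint defect is small and \<open>pdist_Cauchy_limit\<close> applies. Of
  \<open>F\<close> only midpoint-convex sublevel sets, continuity in \<open>pdist\<close> and an
  attained infimum are asked.\<close>

lemma selected_minimizer:
  fixes F :: "('k \<Rightarrow> real) \<Rightarrow> real"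
  assumes mid: "\<And>u v. u \<in> domG \<Longrightarrow> v \<in> domG \<Longrightarrow> F (\<lambda>k. (u k + v k) / 2) \<le> max (F u) (F v)"
    and cont: "\<And>u v. (\<And>j. u j \<in> domG) \<Longrightarrow> v \<in> domG \<Longrightarrow> (\<lambda>j. pdist (u j) v) \<longlonglongrightarrow> 0 \<Longrightarrow> (\<lambda>j. F (u j)) \<longlonglongrightarrow> F v"
    and inf: "\<And>u. u \<in> domG \<Longrightarrow> f \<le> F u" and u0: "u0 \<in> domG" "F u0 = f"
  obtains w where "w \<in> domG" "F w = f" "\<And>v. v \<in> domG \<Longrightarrow> F v = f \<Longrightarrow> Gr w \<le> Gr v"
    "\<And>v. v \<in> domG \<Longrightarrow> F v = f \<Longrightarrow> Gr v \<le> Gr w \<Longrightarrow> v = w"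
    "\<And>e. 0 < e \<Longrightarrow> \<exists>\<gamma>>0. \<forall>u\<in>domG. F u \<le> f + \<gamma> \<longrightarrow> Gr u \<le> Gr w + \<gamma> \<longrightarrow> pdist u w < e"
proof -
  define L where "L n = {u \<in> domG. F u \<le> f + 1 / real (Suc n)}" for n
  define m where "m n = Inf (Gr ` L n)" for n
  have bdd: "bdd_below (Gr ` L n)" for n
    using Gr_ge by (intro bdd_belowI2[of _ "-B"]) (auto simp: L_def)
  have minL: "v \<in> L n" if "v \<in> domG" "F v = f" for v n
    using that by (simp add: L_def)
  have m_le: "m n \<le> Gr u" if "u \<in> L n" for u n
    unfolding m_def using bdd that by (intro cInf_lower) auto
  have L_mono: "L n \<subseteq> L l" if "l \<le> n" for n l
  proof -
    have "1 / real (Suc n) \<le> 1 / real (Suc l)" using that by (simp add: field_simps)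
    then show ?thesis by (auto simp: L_def)
  qed
  have "incseq m"
    unfolding m_def using bdd minL[OF u0] by (intro incseq_SucI cInf_superset_mono image_mono L_mono) auto
  moreover have "bdd_above (range m)"
    using m_le[OF minL[OF u0]] by (intro bdd_aboveI2[of _ _ "Gr u0"])
  ultimately have lim_m: "m \<longlonglongrightarrow> (SUP n. m n)"
    by (intro LIMSEQ_incseq_SUP)
  \<comment> \<open>At first \<open>\<mu>\<close> is only a lower bound for the penalty on the
    minimizers of \<open>F\<close>; \<open>claim\<close> shows that it is attained among
    them.\<close>
  define \<mu> where "\<mu> = (SUP n. m n)"
  have m_mu: "m n \<le> \<mu>" for n
    unfolding \<mu>_def using \<open>bdd_above (range m)\<close> by (intro cSUP_upper) auto
  have mu_le: "\<mu> \<le> Gr v" if "v \<in> domG" "F v = f" for v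
    unfolding \<mu>_def using m_le[OF minL[OF that]] by (intro cSUP_least) auto
  \<comment> \<open>This serves twice: a chosen sequence produces \<open>w\<close>, and a
    hypothetical bad sequence contradicts uniqueness in \<open>stab\<close>.\<close>
  have claim: "\<exists>v\<in>domG. F v = f \<and> Gr v = \<mu> \<and> (\<lambda>j. pdist (u j) v) \<longlonglongrightarrow> 0"
    if uL: "\<And>j. u j \<in> L j" and Gu: "\<And>j. Gr (u j) \<le> \<mu> + 1 / real (Suc j)" for u
  proof -
    have ud: "u j \<in> domG" for j using uL[of j] by (simp add: L_def)
    have inv: "1 / real (Suc j) \<le> 1 / real (Suc N)" if "N \<le> j" for j N
      using that by (simp add: field_simps)
    have lim_inv: "(\<lambda>n. 1 / real (Suc n)) \<longlonglongrightarrow> 0"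
      using LIMSEQ_inverse_real_of_nat by (simp add: inverse_eq_divide)
    obtain v where v: "v \<in> domG" "(\<lambda>j. pdist (u j) v) \<longlonglongrightarrow> 0"
    proof (rule pdist_Cauchy_limit[OF ud])
      show "Gr (u j) \<le> \<mu> + 1 / real (Suc 0)" for j using Gu[of j] inv[of 0 j] by linarith
      fix e :: real assume "0 < e"
      have "(\<lambda>n. \<mu> + 1 / real (Suc n) - m n) \<longlonglongrightarrow> \<mu> + 0 - \<mu>"
        using lim_m lim_inv unfolding \<mu>_def by (intro tendsto_intros)
      then have "\<forall>\<^sub>F n in sequentially. \<mu> + 1 / real (Suc n) - m n < e"
        using \<open>0 < e\<close> by (intro order_tendstoD(2)[where y=0]) auto
      then obtain N where N: "\<mu> + 1 / real (Suc N) - m N < e"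
        by (auto simp: eventually_sequentially)
      have "(Gr (u i) + Gr (u j)) / 2 - Gr (\<lambda>k. (u i k + u j k) / 2) \<le> e" if "N \<le> i" "N \<le> j" for i j
      proof -
        have "u i \<in> L N" "u j \<in> L N" using uL L_mono that by blast+
        then have "(\<lambda>k. (u i k + u j k) / 2) \<in> L N"
          using mid[of "u i" "u j"] midpoint_domG(1)[of "u i" "u j"] by (auto simp: L_def)
        from m_le[OF this] show ?thesis
          using Gu[of i] Gu[of j] inv[OF that(1)] inv[OF that(2)] N by argo
      qed
      then show "\<exists>N. \<forall>i\<ge>N. \<forall>j\<ge>N. (Gr (u i) + Gr (u j)) / 2 - Gr (\<lambda>k. (u i k + u j k) / 2) \<le> e"
        by blast
    qed
    have "F v \<le> f + 0"
    proof (rule LIMSEQ_le[OF cont[OF ud v]])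
      show "(\<lambda>j. f + 1 / real (Suc j)) \<longlonglongrightarrow> f + 0" by (intro tendsto_intros lim_inv)
      show "\<exists>N. \<forall>j\<ge>N. F (u j) \<le> f + 1 / real (Suc j)" using uL by (auto simp: L_def)
    qed
    then have Fv: "F v = f" using inf[OF v(1)] by simp
    \<comment> \<open>\<open>domG_closed\<close> wants one bound for the whole sequence, so it is
      applied to each tail.\<close>
    have "Gr v \<le> \<mu> + 1 / real (Suc N)" for N
    proof (rule domG_closed(2))
      show "u (j + N) \<in> domG" for j by (rule ud)
      show "Gr (u (j + N)) \<le> \<mu> + 1 / real (Suc N)" for j
        using Gu[of "j + N"] inv[of N "j + N"] by simp
      show "(\<lambda>j. u (j + N) k) \<longlonglongrightarrow> v k" if "k \<in> K" for k
        using pdist_tendsto_coord[OF ud v that] by (rule LIMSEQ_ignore_initial_segment)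
      show "v k = 0" if "k \<notin> K" for k using v(1) that by (simp add: domG_def)
    qed
    then have "Gr v \<le> \<mu> + 0"
      by (intro LIMSEQ_le_const[OF tendsto_add[OF tendsto_const lim_inv]]) auto
    then show ?thesis using v Fv mu_le[OF v(1) Fv] by (intro bexI[of _ v]) auto
  qed
  have "\<exists>u. u \<in> L j \<and> Gr u \<le> \<mu> + 1 / real (Suc j)" for j
  proof -
    have "Inf (Gr ` L j) < \<mu> + 1 / real (Suc j)"
      using m_mu[of j] unfolding m_def by (simp add: add_strict_increasing2 le_less_trans less_add_same_cancel1)
    from cInf_lessD[OF _ this] minL[OF u0] show ?thesis by fastforce
  qed
  then obtain u where "\<And>j. u j \<in> L j" "\<And>j. Gr (u j) \<le> \<mu> + 1 / real (Suc j)" by metis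
  from claim[OF this] obtain w where w: "w \<in> domG" "F w = f" "Gr w = \<mu>" by blast
  have uniq: "v = w" if v: "v \<in> domG" "F v = f" "Gr v \<le> Gr w" for v
  proof -
    \<comment> \<open>The midpoint again minimizes \<open>F\<close>, so its penalty is at least
      \<open>\<mu>\<close>; this leaves no room for a positive gap.\<close>
    have "F (\<lambda>k. (v k + w k) / 2) = f"
      using mid[OF v(1) w(1)] inf[OF midpoint_domG(1)[OF v(1) w(1)]] v(2) w(2) by simp
    from mu_le[OF midpoint_domG(1)[OF v(1) w(1)] this]
    have "\<eta> * gapsum v w \<le> 0"
      using midpoint_domG(3)[OF v(1) w(1)] v(3) w(3) by argo
    then have "gapsum v w \<le> 0"
      using eta by (simp add: mult_le_0_iff)
    then have "midgap r (v k) (w k) = 0" if "k \<in> K" for k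
      using that by (intro nonneg_infsum_le_0D[OF _ midpoint_domG(2)[OF v(1) w(1)]] midgap_nonneg r)
    then have "v k = w k" if "k \<in> K" for k
      using midgap_pos[OF r(1), of "v k" "w k"] that by fastforce
    moreover have "v k = w k" if "k \<notin> K" for k using v(1) w(1) that by (simp add: domG_def)
    ultimately show "v = w" by blast
  qed
  have stab: "\<exists>\<gamma>>0. \<forall>u\<in>domG. F u \<le> f + \<gamma> \<longrightarrow> Gr u \<le> Gr w + \<gamma> \<longrightarrow> pdist u w < e" if e: "0 < e" for e
  proof (rule ccontr)
    assume *: "\<not> ?thesis"
    have "\<exists>u. u \<in> domG \<and> F u \<le> f + 1 / real (Suc j) \<and> Gr u \<le> Gr w + 1 / real (Suc j) \<and> e \<le> pdist u w" for j
    proof -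
      have "0 < 1 / real (Suc j)" by simp
      with * show ?thesis by (meson not_le)
    qed
    then obtain u where u: "\<And>j. u j \<in> domG" "\<And>j. F (u j) \<le> f + 1 / real (Suc j)"
      "\<And>j. Gr (u j) \<le> Gr w + 1 / real (Suc j)" "\<And>j. e \<le> pdist (u j) w" by metis
    have "u j \<in> L j" for j using u by (simp add: L_def)
    from claim[OF this] u(3) w(3)
    obtain v where v: "v \<in> domG" "F v = f" "Gr v = \<mu>" "(\<lambda>j. pdist (u j) v) \<longlonglongrightarrow> 0" by auto
    then have "v = w" using uniq w(3) by simp
    from order_tendstoD(2)[OF v(4) e] this u(4) show False
      by (auto simp: eventually_sequentially not_less[symmetric])
  qed
  show thesis
    by (rule that[OF w(1,2) _ uniq stab]) (use mu_le w(3) in auto)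
qed

end

section \<open>Synthesis operator and risk\<close>

lemma sqsum_truncate:
  assumes u: "u \<in> ell 2 K" and e: "0 < e"
  obtains J where "finite J" "J \<subseteq> K" "sqsum K (\<lambda>k. (if k \<in> J then u k else 0) - u k) < e"
proof -
  have s: "(\<lambda>k. (u k)\<^sup>2) summable_on K" using u by (simp add: ell_2_iff)
  obtain J where J: "finite J" "J \<subseteq> K" "dist (\<Sum>k\<in>J. (u k)\<^sup>2) (sqsum K u) \<le> e / 2"
    using infsum_finite_approximation[OF s, of "e / 2"] e unfolding sqsum_def by auto
  have "sqsum K (\<lambda>k. (if k \<in> J then u k else 0) - u k) = (\<Sum>\<^sub>\<infinity>k\<in>K - J. (u k)\<^sup>2)"
    unfolding sqsum_def using J(2) by (intro infsum_cong_neutral) auto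
  also have "\<dots> = sqsum K u - (\<Sum>k\<in>J. (u k)\<^sup>2)"
    unfolding sqsum_def using s J by (subst infsum_Diff) (auto intro: summable_on_subset)
  also have "\<dots> < e" using J(3) e unfolding dist_real_def abs_le_iff by linarith
  finally show thesis using J(1,2) that by blast
qed

lemma sqsum_restrict_le:
  assumes "u \<in> ell 2 K" "J \<subseteq> K"
  shows "(\<lambda>k. if k \<in> J then u k else 0) \<in> ell 2 K" "sqsum K (\<lambda>k. if k \<in> J then u k else 0) \<le> sqsum K u"
proof -
  note s = summable_on_le[of K "\<lambda>k. (if k \<in> J then u k else 0)\<^sup>2", OF _ _ ell_2_summable[OF assms(1)]]
  show "(\<lambda>k. if k \<in> J then u k else 0) \<in> ell 2 K"
    using s(1) assms by (auto simp: ell_2_iff)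
  show "sqsum K (\<lambda>k. if k \<in> J then u k else 0) \<le> sqsum K u"
    unfolding sqsum_def using s(2) by auto
qed

locale learning = composite_penalty K r \<eta> C D h
  for K :: "'k set" and r \<eta> :: real and C D :: "'k \<Rightarrow> real set" and h :: "'k \<Rightarrow> real \<Rightarrow> ereal" +
  fixes MX :: "'x measure" and Y :: "real set" and P :: "('x \<times> real) measure"
    and \<phi> :: "'k \<Rightarrow> 'x \<Rightarrow> real" and \<kappa> b :: real
  assumes Y_bound: "\<And>y. y \<in> Y \<Longrightarrow> \<bar>y\<bar> \<le> b" and b_nonneg: "0 \<le> b"
    and prob_P: "prob_space P" and sets_P: "sets P = sets (MX \<Otimes>\<^sub>M restrict_space borel Y)"
    and K: "countable K"
    and phi: "\<And>k. k \<in> K \<Longrightarrow> \<phi> k \<in> borel_measurable MX"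
    and kappa: "0 < \<kappa>"
      "\<And>x. x \<in> space MX \<Longrightarrow>
         (\<lambda>k. \<bar>\<phi> k x\<bar>\<^sup>2) summable_on K \<and> (\<Sum>\<^sub>\<infinity>k\<in>K. \<bar>\<phi> k x\<bar>\<^sup>2) \<le> \<kappa>\<^sup>2"
begin

sublocale P: prob_space P by (rule prob_P)

abbreviation "A \<equiv> synthesis K \<phi>"
abbreviation "PX \<equiv> distr P MX fst"

definition F :: "('k \<Rightarrow> real) \<Rightarrow> real" where
  "F u = risk P (A u)"

lemma space_P: "space P = space MX \<times> Y"
  using sets_eq_imp_space_eq[OF sets_P] by (simp add: space_pair_measure space_restrict_space)

lemma fst_measurable [measurable]: "fst \<in> P \<rightarrow>\<^sub>M MX"
  by (subst measurable_cong_sets[OF sets_P refl]) simp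

lemma snd_measurable [measurable]: "snd \<in> borel_measurable P"
proof -
  have "snd \<in> P \<rightarrow>\<^sub>M restrict_space borel Y"
    by (subst measurable_cong_sets[OF sets_P refl]) simp
  then show ?thesis by (rule measurable_restrict_space2_iff[THEN iffD1, THEN conjunct1])
qed

lemma prob_PX: "prob_space PX"
  by (rule P.prob_space_distr) simp

lemma snd_bound: "z \<in> space P \<Longrightarrow> \<bar>snd z\<bar> \<le> b"
  using Y_bound by (auto simp: space_P)

lemma phi_summable: "x \<in> space MX \<Longrightarrow> (\<lambda>k. (\<phi> k x)\<^sup>2) summable_on K"
  and phi_sqsum: "x \<in> space MX \<Longrightarrow> sqrt (sqsum K (\<lambda>k. \<phi> k x)) \<le> \<kappa>"
  using kappa by (auto simp: sqsum_def real_le_lsqrt)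

lemma A_summable: "u \<in> ell 2 K \<Longrightarrow> x \<in> space MX \<Longrightarrow> (\<lambda>k. u k * \<phi> k x) summable_on K"
  by (rule Cauchy_Schwarz_infsum(1)[OF ell_2_summable phi_summable])

lemma A_bound:
  assumes "u \<in> ell 2 K" "x \<in> space MX"
  shows "\<bar>A u x\<bar> \<le> \<kappa> * sqrt (sqsum K u)"
proof -
  have "\<bar>A u x\<bar> \<le> sqrt (sqsum K u) * sqrt (sqsum K (\<lambda>k. \<phi> k x))"
    unfolding synthesis_def using assms by (intro Cauchy_Schwarz_infsum(2) ell_2_summable phi_summable)
  also have "\<dots> \<le> sqrt (sqsum K u) * \<kappa>"
    by (intro mult_left_mono phi_sqsum assms) auto
  finally show ?thesis by (simp add: mult.commute)
qed

lemma A_lincomb: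
  assumes "u \<in> ell 2 K" "v \<in> ell 2 K" "x \<in> space MX"
  shows "A (\<lambda>k. s * u k + t * v k) x = s * A u x + t * A v x"
proof -
  have "A (\<lambda>k. s * u k + t * v k) x = (\<Sum>\<^sub>\<infinity>k\<in>K. s * (u k * \<phi> k x) + t * (v k * \<phi> k x))"
    unfolding synthesis_def by (simp add: algebra_simps)
  also have "\<dots> = s * A u x + t * A v x"
    unfolding synthesis_def using assms
    by (simp only: infsum_add infsum_cmult_right' summable_on_cmult_right A_summable)
  finally show ?thesis .
qed

lemma A_diff:
  assumes "u \<in> ell 2 K" "v \<in> ell 2 K" "x \<in> space MX"
  shows "A (\<lambda>k. u k - v k) x = A u x - A v x"
  using A_lincomb[OF assms, of 1 "-1"] by simp

lemma A_measurable: "u \<in> ell 2 K \<Longrightarrow> A u \<in> borel_measurable MX"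
  unfolding synthesis_def by (intro borel_measurable_infsum K A_summable) (auto intro!: borel_measurable_times phi)

section \<open>Square-integrable functions and the geometry of the risk\<close>

lemma L2_spaceD:
  assumes "f \<in> L2_space PX"
  shows "f \<in> borel_measurable MX" "integrable P (\<lambda>z. (f (fst z))\<^sup>2)"
    "(\<integral>x. (f x)\<^sup>2 \<partial>PX) = (\<integral>z. (f (fst z))\<^sup>2 \<partial>P)"
proof -
  show [measurable]: "f \<in> borel_measurable MX" using assms by (simp add: L2_space_def)
  show "integrable P (\<lambda>z. (f (fst z))\<^sup>2)"
    using assms integrable_distr_eq[of fst P MX "\<lambda>x. (f x)\<^sup>2"] by (simp add: L2_space_def)
  show "(\<integral>x. (f x)\<^sup>2 \<partial>PX) = (\<integral>z. (f (fst z))\<^sup>2 \<partial>P)"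
    by (rule integral_distr) measurable
qed

lemma A_L2:
  assumes "u \<in> ell 2 K"
  shows "A u \<in> L2_space PX"
proof -
  interpret PX: prob_space PX by (rule prob_PX)
  note [measurable] = A_measurable[OF assms]
  have "(A u x)\<^sup>2 \<le> (\<kappa> * sqrt (sqsum K u))\<^sup>2" if "x \<in> space MX" for x
    using power_mono[OF A_bound[OF assms that], where n=2] by simp
  then have "integrable PX (\<lambda>x. (A u x)\<^sup>2)"
    by (intro PX.integrable_const_bound[where B="(\<kappa> * sqrt (sqsum K u))\<^sup>2"]) auto
  then show ?thesis by (simp add: L2_space_def A_measurable[OF assms])
qed

lemma L2_lincomb:
  assumes f: "f \<in> L2_space PX" and g: "g \<in> L2_space PX"
  shows "(\<lambda>x. s * f x + t * g x) \<in> L2_space PX"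
proof -
  note [measurable] = L2_spaceD(1)[OF f] L2_spaceD(1)[OF g]
  have "integrable PX (\<lambda>x. 2 * (s\<^sup>2 * (f x)\<^sup>2 + t\<^sup>2 * (g x)\<^sup>2))"
    using f g by (simp add: L2_space_def)
  then have "integrable PX (\<lambda>x. (s * f x + t * g x)\<^sup>2)"
  proof (rule Bochner_Integration.integrable_bound)
    have "(s * f x + t * g x)\<^sup>2 \<le> 2 * (s\<^sup>2 * (f x)\<^sup>2 + t\<^sup>2 * (g x)\<^sup>2)" for x
      using zero_le_power2[of "s * f x - t * g x"]
      by (simp add: power2_eq_square algebra_simps)
    then show "AE x in PX. norm ((s * f x + t * g x)\<^sup>2) \<le> norm (2 * (s\<^sup>2 * (f x)\<^sup>2 + t\<^sup>2 * (g x)\<^sup>2))"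
      by (auto intro: order_trans[OF _ abs_ge_self])
  qed measurable
  then show ?thesis by (simp add: L2_space_def)
qed

lemma L2_diff: "f \<in> L2_space PX \<Longrightarrow> g \<in> L2_space PX \<Longrightarrow> (\<lambda>x. f x - g x) \<in> L2_space PX"
  using L2_lincomb[of f g 1 "-1"] by simp

lemma L2_mid: "f \<in> L2_space PX \<Longrightarrow> g \<in> L2_space PX \<Longrightarrow> (\<lambda>x. (f x + g x) / 2) \<in> L2_space PX"
  using L2_lincomb[of f g "1/2" "1/2"] by (simp add: add_divide_distrib)

lemma risk_integrable:
  assumes f: "f \<in> L2_space PX"
  shows "integrable P (\<lambda>z. (f (fst z) - snd z)\<^sup>2)"
proof -
  note [measurable] = L2_spaceD(1)[OF f]
  have "(snd z)\<^sup>2 \<le> b\<^sup>2" if "z \<in> space P" for z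
    using power_mono[OF snd_bound[OF that], where n=2] by simp
  then have "integrable P (\<lambda>z. (snd z)\<^sup>2)"
    by (intro P.integrable_const_bound[where B="b\<^sup>2"]) auto
  then have "integrable P (\<lambda>z. 2 * ((f (fst z))\<^sup>2 + (snd z)\<^sup>2))"
    using L2_spaceD(2)[OF f] by simp
  then show ?thesis
  proof (rule Bochner_Integration.integrable_bound)
    have "(f (fst z) - snd z)\<^sup>2 \<le> 2 * ((f (fst z))\<^sup>2 + (snd z)\<^sup>2)" for z
      using zero_le_power2[of "f (fst z) + snd z"]
      by (simp add: power2_eq_square algebra_simps)
    then show "AE z in P. norm ((f (fst z) - snd z)\<^sup>2) \<le> norm (2 * ((f (fst z))\<^sup>2 + (snd z)\<^sup>2))"
      by (auto intro: order_trans[OF _ abs_ge_self])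
  qed measurable
qed

lemma risk_eq: "risk P f = (\<integral>z. (f (fst z) - snd z)\<^sup>2 \<partial>P)"
  by (simp add: risk_def)

lemma risk_nonneg: "0 \<le> risk P f"
  by (simp add: risk_eq)

text \<open>The parallelogram law for the residuals \<open>f - y\<close> and \<open>g - y\<close>,
  whose difference is free of \<open>y\<close>.\<close>

lemma risk_midpoint:
  assumes f: "f \<in> L2_space PX" and g: "g \<in> L2_space PX"
  shows "risk P (\<lambda>x. (f x + g x) / 2) = (risk P f + risk P g) / 2 - (\<integral>x. (f x - g x)\<^sup>2 \<partial>PX) / 4"
proof -
  have "(\<integral>z. ((f (fst z) + g (fst z)) / 2 - snd z)\<^sup>2 \<partial>P) =
    (\<integral>z. 1/2 * (f (fst z) - snd z)\<^sup>2 + 1/2 * (g (fst z) - snd z)\<^sup>2 - 1/4 * (f (fst z) - g (fst z))\<^sup>2 \<partial>P)"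
    by (intro Bochner_Integration.integral_cong refl) (simp add: power2_eq_square field_simps)
  also have "\<dots> = 1/2 * risk P f + 1/2 * risk P g - 1/4 * (\<integral>z. (f (fst z) - g (fst z))\<^sup>2 \<partial>P)"
    using risk_integrable[OF f] risk_integrable[OF g] L2_spaceD(2)[OF L2_diff[OF f g]]
    by (simp add: risk_eq)
  finally show ?thesis
    by (simp add: risk_eq L2_spaceD(3)[OF L2_diff[OF f g]])
qed

text \<open>The inequality \<open>2 * p * q \<le> \<theta> * p^2 + q^2 / \<theta>\<close> under the
  integral. With small \<open>\<theta>\<close> it shows that a small distance changes the risk
  little.\<close>

lemma risk_le:
  assumes f: "f \<in> L2_space PX" and g: "g \<in> L2_space PX" and \<theta>: "0 < \<theta>"
  shows "risk P g \<le> (1 + \<theta>) * risk P f + (1 + 1 / \<theta>) * (\<integral>x. (g x - f x)\<^sup>2 \<partial>PX)"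
proof -
  have "risk P g \<le> (\<integral>z. (1 + \<theta>) * (f (fst z) - snd z)\<^sup>2 + (1 + 1 / \<theta>) * (g (fst z) - f (fst z))\<^sup>2 \<partial>P)"
    unfolding risk_eq
  proof (intro integral_mono risk_integrable g)
    show "integrable P (\<lambda>z. (1 + \<theta>) * (f (fst z) - snd z)\<^sup>2 + (1 + 1 / \<theta>) * (g (fst z) - f (fst z))\<^sup>2)"
      using risk_integrable[OF f] L2_spaceD(2)[OF L2_diff[OF g f]] by simp
    fix z
    define p q where "p = f (fst z) - snd z" and "q = g (fst z) - f (fst z)"
    have "0 \<le> (\<theta> * p - q)\<^sup>2 / \<theta>" using \<theta> by simp
    also have "\<dots> = \<theta> * p\<^sup>2 - 2 * p * q + 1 / \<theta> * q\<^sup>2"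
      using \<theta> by (simp add: power2_eq_square field_simps)
    finally have "(p + q)\<^sup>2 \<le> (1 + \<theta>) * p\<^sup>2 + (1 + 1 / \<theta>) * q\<^sup>2"
      by (simp add: power2_eq_square algebra_simps)
    moreover have "p + q = g (fst z) - snd z" by (simp add: p_def q_def)
    ultimately show "(g (fst z) - snd z)\<^sup>2 \<le> (1 + \<theta>) * (f (fst z) - snd z)\<^sup>2 + (1 + 1 / \<theta>) * (g (fst z) - f (fst z))\<^sup>2"
      by (simp add: p_def q_def)
  qed
  also have "\<dots> = (1 + \<theta>) * risk P f + (1 + 1 / \<theta>) * (\<integral>z. (g (fst z) - f (fst z))\<^sup>2 \<partial>P)"
    using risk_integrable[OF f] L2_spaceD(2)[OF L2_diff[OF g f]] by (simp add: risk_eq)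
  finally show ?thesis by (simp add: L2_spaceD(3)[OF L2_diff[OF g f]])
qed

text \<open>With residual \<open>p\<close> and increment \<open>q\<close> the squared loss changes
  by \<open>2 * p * q + q^2\<close>; this bounds the change uniformly in the data point and so
  serves the true and the empirical risk alike.\<close>

definition modulus :: "('k \<Rightarrow> real) \<Rightarrow> ('k \<Rightarrow> real) \<Rightarrow> real" where
  "modulus u v = 2 * (\<kappa> * sqrt (sqsum K u) + b) * (\<kappa> * sqrt (sqsum K (\<lambda>k. v k - u k)))
     + (\<kappa> * sqrt (sqsum K (\<lambda>k. v k - u k)))\<^sup>2"

lemma loss_modulus:
  assumes u: "u \<in> ell 2 K" and v: "v \<in> ell 2 K" and z: "z \<in> space P"
  shows "\<bar>(A v (fst z) - snd z)\<^sup>2 - (A u (fst z) - snd z)\<^sup>2\<bar> \<le> modulus u v"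
proof -
  have x: "fst z \<in> space MX" using z by (auto simp: space_P)
  define p q where "p = A u (fst z) - snd z" and "q = A v (fst z) - A u (fst z)"
  have p: "\<bar>p\<bar> \<le> \<kappa> * sqrt (sqsum K u) + b"
    using A_bound[OF u x] snd_bound[OF z] by (simp add: p_def)
  have q: "\<bar>q\<bar> \<le> \<kappa> * sqrt (sqsum K (\<lambda>k. v k - u k))"
    using A_bound[OF ell_2_diff[OF v u] x] by (simp add: q_def A_diff[OF v u x])
  have "(A v (fst z) - snd z)\<^sup>2 - (A u (fst z) - snd z)\<^sup>2 = 2 * p * q + q\<^sup>2"
    by (simp add: p_def q_def power2_eq_square algebra_simps)
  also have "\<bar>\<dots>\<bar> \<le> 2 * (\<bar>p\<bar> * \<bar>q\<bar>) + \<bar>q\<bar>\<^sup>2"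
    by (rule order_trans[OF abs_triangle_ineq]) (simp add: abs_mult)
  also have "\<dots> \<le> 2 * ((\<kappa> * sqrt (sqsum K u) + b) * (\<kappa> * sqrt (sqsum K (\<lambda>k. v k - u k))))
      + (\<kappa> * sqrt (sqsum K (\<lambda>k. v k - u k)))\<^sup>2"
    using p q kappa(1) b_nonneg by (intro add_mono mult_left_mono mult_mono power_mono) auto
  finally show ?thesis by (simp only: modulus_def mult.assoc)
qed

lemma F_modulus:
  assumes u: "u \<in> ell 2 K" and v: "v \<in> ell 2 K"
  shows "\<bar>F v - F u\<bar> \<le> modulus u v"
proof -
  have i: "integrable P (\<lambda>z. (A w (fst z) - snd z)\<^sup>2)" if "w \<in> ell 2 K" for w
    by (rule risk_integrable[OF A_L2[OF that]])
  have "\<bar>F v - F u\<bar> = \<bar>\<integral>z. (A v (fst z) - snd z)\<^sup>2 - (A u (fst z) - snd z)\<^sup>2 \<partial>P\<bar>"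
    using i[OF u] i[OF v] by (simp add: F_def risk_eq)
  also have "\<dots> \<le> (\<integral>z. \<bar>(A v (fst z) - snd z)\<^sup>2 - (A u (fst z) - snd z)\<^sup>2\<bar> \<partial>P)"
    by (rule integral_abs_bound)
  also have "\<dots> \<le> (\<integral>z. modulus u v \<partial>P)"
    using i[OF u] i[OF v] loss_modulus[OF u v] by (intro integral_mono) auto
  finally show ?thesis by (simp add: P.prob_space)
qed

lemma modulus_small:
  assumes e: "0 < e"
  obtains \<delta> where "0 < \<delta>" "\<And>v. sqsum K (\<lambda>k. v k - u k) < \<delta> \<Longrightarrow> modulus u v < e"
proof -
  define m where "m t = 2 * (\<kappa> * sqrt (sqsum K u) + b) * (\<kappa> * sqrt t) + (\<kappa> * sqrt t)\<^sup>2" for t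
  have "isCont m 0" unfolding m_def by (intro continuous_intros)
  then have "\<exists>\<delta>>0. \<forall>t. dist t 0 < \<delta> \<longrightarrow> dist (m t) (m 0) < e"
    using e unfolding continuous_at_eps_delta by simp
  then obtain \<delta> where \<delta>: "0 < \<delta>" "\<And>t. \<bar>t\<bar> < \<delta> \<Longrightarrow> \<bar>m t\<bar> < e"
    by (auto simp: m_def dist_real_def)
  have "modulus u v < e" if "sqsum K (\<lambda>k. v k - u k) < \<delta>" for v
  proof -
    have "\<bar>m (sqsum K (\<lambda>k. v k - u k))\<bar> < e" using that by (intro \<delta>) simp
    then show ?thesis by (simp add: m_def modulus_def)
  qed
  with \<delta>(1) show thesis by (rule that)
qed

lemma F_midpoint:
  assumes u: "u \<in> ell 2 K" and v: "v \<in> ell 2 K"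
  shows "F (\<lambda>k. (u k + v k) / 2) \<le> (F u + F v) / 2"
proof -
  have "F (\<lambda>k. (u k + v k) / 2) = risk P (\<lambda>x. (A u x + A v x) / 2)"
    unfolding F_def risk_eq
  proof (intro Bochner_Integration.integral_cong refl)
    fix z assume "z \<in> space P"
    then have "A (\<lambda>k. (u k + v k) / 2) (fst z) = (A u (fst z) + A v (fst z)) / 2"
      using A_lincomb[OF u v, of "fst z" "1/2" "1/2"] by (auto simp: space_P add_divide_distrib)
    then show "(A (\<lambda>k. (u k + v k) / 2) (fst z) - snd z)\<^sup>2 = ((A u (fst z) + A v (fst z)) / 2 - snd z)\<^sup>2"
      by (simp only:)
  qed
  also have "\<dots> = (F u + F v) / 2 - (\<integral>x. (A u x - A v x)\<^sup>2 \<partial>PX) / 4"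
    using risk_midpoint[OF A_L2[OF u] A_L2[OF v]] by (simp only: F_def)
  also have "\<dots> \<le> (F u + F v) / 2"
  proof -
    have "0 \<le> (\<integral>x. (A u x - A v x)\<^sup>2 \<partial>PX)" by simp
    then show ?thesis by argo
  qed
  finally show ?thesis .
qed

text \<open>Convergence in \<open>pdist\<close> implies convergence in \<open>ell 2 K\<close> by
  \<open>sqsum_le_powr_sum\<close>, and \<open>modulus\<close> makes \<open>F\<close> continuous
  there.\<close>

lemma F_pdist_continuous:
  assumes u: "\<And>j. u j \<in> domG" and v: "v \<in> domG" and lim: "(\<lambda>j. pdist (u j) v) \<longlonglongrightarrow> 0"
  shows "(\<lambda>j. F (u j)) \<longlonglongrightarrow> F v"
proof (rule tendstoI)
  fix e :: real assume "0 < e"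
  then obtain \<delta> where \<delta>: "0 < \<delta>" "\<And>w. sqsum K (\<lambda>k. w k - v k) < \<delta> \<Longrightarrow> modulus v w < e"
    by (rule modulus_small[where u=v]) blast
  have "(\<lambda>j. pdist (u j) v powr (2 / r)) \<longlonglongrightarrow> 0 powr (2 / r)"
    using lim r pdist_nonneg by (intro tendsto_powr' tendsto_const) auto
  then have "\<forall>\<^sub>F j in sequentially. pdist (u j) v powr (2 / r) < \<delta>"
    using \<delta>(1) by (intro order_tendstoD(2)[where y=0]) auto
  then show "\<forall>\<^sub>F j in sequentially. dist (F (u j)) (F v) < e"
  proof eventually_elim
    case (elim j)
    have "sqsum K (\<lambda>k. u j k - v k) \<le> pdist (u j) v powr (2 / r)"
      unfolding pdist_def using pdist_summable[OF u v] by (rule sqsum_le_powr_sum(2)[OF r])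
    then have "modulus v (u j) < e" using elim by (intro \<delta>(2)) simp
    then show ?case
      using F_modulus[OF domG_ell_2[OF v] domG_ell_2[OF u[of j]]] by (simp add: dist_real_def)
  qed
qed

section \<open>The constraint set and its approximation from the domain of the penalty\<close>

definition CC :: "('x \<Rightarrow> real) set" where
  "CC = L2_closure PX (A ` {u \<in> ell 2 K. \<forall>k\<in>K. u k \<in> C k})"

lemma L2_norm_less_iff:
  assumes "f \<in> L2_space PX" "0 < e"
  shows "L2_norm PX f < ereal e \<longleftrightarrow> (\<integral>x. (f x)\<^sup>2 \<partial>PX) < e\<^sup>2"
proof -
  have "sqrt (\<integral>x. (f x)\<^sup>2 \<partial>PX) < e \<longleftrightarrow> (\<integral>x. (f x)\<^sup>2 \<partial>PX) < e\<^sup>2"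
    using assms(2) by (metis abs_of_pos real_sqrt_abs real_sqrt_less_iff)
  then show ?thesis using assms by (simp add: L2_norm_def)
qed

lemma CC_L2: "f \<in> CC \<Longrightarrow> f \<in> L2_space PX"
  by (simp add: CC_def L2_closure_def)

lemma CC_approx:
  assumes "f \<in> CC" "0 < e"
  obtains u where "u \<in> ell 2 K" "\<And>k. k \<in> K \<Longrightarrow> u k \<in> C k" "(\<integral>x. (A u x - f x)\<^sup>2 \<partial>PX) < e"
proof -
  have "0 < sqrt e" using assms by simp
  then obtain u where u: "u \<in> ell 2 K" "\<forall>k\<in>K. u k \<in> C k" "L2_norm PX (\<lambda>x. A u x - f x) < ereal (sqrt e)"
    using assms(1) unfolding CC_def L2_closure_def by blast
  then show thesis
    using that L2_norm_less_iff[OF L2_diff[OF A_L2[OF u(1)] CC_L2[OF assms(1)]], of "sqrt e"] assms(2) by simp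
qed

lemma CC_I:
  assumes f: "f \<in> L2_space PX"
    and app: "\<And>e. 0 < e \<Longrightarrow> \<exists>u\<in>ell 2 K. (\<forall>k\<in>K. u k \<in> C k) \<and> (\<integral>x. (A u x - f x)\<^sup>2 \<partial>PX) < e"
  shows "f \<in> CC"
  unfolding CC_def L2_closure_def
proof (intro CollectI conjI f allI impI)
  fix e :: real assume "0 < e"
  then obtain u where "u \<in> ell 2 K" "\<forall>k\<in>K. u k \<in> C k" "(\<integral>x. (A u x - f x)\<^sup>2 \<partial>PX) < e\<^sup>2"
    using app[of "e\<^sup>2"] by auto
  then show "\<exists>g\<in>A ` {u \<in> ell 2 K. \<forall>k\<in>K. u k \<in> C k}. L2_norm PX (\<lambda>x. g x - f x) < ereal e"
    using L2_norm_less_iff[OF L2_diff[OF A_L2 f] \<open>0 < e\<close>] by blast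
qed

lemma A_CC: "u \<in> ell 2 K \<Longrightarrow> (\<And>k. k \<in> K \<Longrightarrow> u k \<in> C k) \<Longrightarrow> A u \<in> CC"
  by (rule CC_I[OF A_L2]) (auto intro!: bexI[of _ u])

lemma A_domG_CC: "u \<in> domG \<Longrightarrow> A u \<in> CC"
  by (rule A_CC[OF domG_ell_2]) (auto simp: domG_def dom_def)

lemma CC_midpoint:
  assumes f: "f \<in> CC" and g: "g \<in> CC"
  shows "(\<lambda>x. (f x + g x) / 2) \<in> CC"
proof (rule CC_I[OF L2_mid[OF CC_L2[OF f] CC_L2[OF g]]])
  fix e :: real assume e: "0 < e"
  obtain u where u: "u \<in> ell 2 K" "\<And>k. k \<in> K \<Longrightarrow> u k \<in> C k" "(\<integral>x. (A u x - f x)\<^sup>2 \<partial>PX) < e"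
    using CC_approx[OF f e] by blast
  obtain v where v: "v \<in> ell 2 K" "\<And>k. k \<in> K \<Longrightarrow> v k \<in> C k" "(\<integral>x. (A v x - g x)\<^sup>2 \<partial>PX) < e"
    using CC_approx[OF g e] by blast
  let ?w = "\<lambda>k. 1/2 * u k + 1/2 * v k"
  have w: "?w \<in> ell 2 K" by (intro ell_2_add ell_2_scale u v)
  have wC: "?w k \<in> C k" if k: "k \<in> K" for k
  proof -
    have "convex (C k)" using C[OF k] by (simp add: is_interval_convex)
    from convexD[OF this u(2)[OF k] v(2)[OF k], of "1/2" "1/2"] show ?thesis by simp
  qed
  have if': "integrable PX (\<lambda>x. (A u x - f x)\<^sup>2)" and ig: "integrable PX (\<lambda>x. (A v x - g x)\<^sup>2)"
    using L2_diff[OF A_L2[OF u(1)] CC_L2[OF f]] L2_diff[OF A_L2[OF v(1)] CC_L2[OF g]] by (auto simp: L2_space_def)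
  have "(\<integral>x. (A ?w x - (f x + g x) / 2)\<^sup>2 \<partial>PX)
     \<le> (\<integral>x. 1/2 * (A u x - f x)\<^sup>2 + 1/2 * (A v x - g x)\<^sup>2 \<partial>PX)"
  proof (intro integral_mono)
    show "integrable PX (\<lambda>x. (A ?w x - (f x + g x) / 2)\<^sup>2)"
      using L2_diff[OF A_L2[OF w] L2_mid[OF CC_L2[OF f] CC_L2[OF g]]] by (simp add: L2_space_def)
    show "integrable PX (\<lambda>x. 1/2 * (A u x - f x)\<^sup>2 + 1/2 * (A v x - g x)\<^sup>2)"
      using if' ig by simp
    fix x assume "x \<in> space PX"
    then have "A ?w x = 1/2 * A u x + 1/2 * A v x"
      by (intro A_lincomb u v) simp
    moreover have "1/2 * p + 1/2 * q - (s + t) / 2 = ((p - s) + (q - t)) / 2" for p q s t :: real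
      by (simp add: field_simps)
    ultimately have eq: "A ?w x - (f x + g x) / 2 = ((A u x - f x) + (A v x - g x)) / 2" by (simp only:)
    have sq: "((p + q) / 2)\<^sup>2 \<le> 1/2 * p\<^sup>2 + 1/2 * q\<^sup>2" for p q :: real
      using zero_le_power2[of "p - q"] by (simp add: power2_eq_square field_simps)
    show "(A ?w x - (f x + g x) / 2)\<^sup>2 \<le> 1/2 * (A u x - f x)\<^sup>2 + 1/2 * (A v x - g x)\<^sup>2"
      unfolding eq by (rule sq)
  qed
  also have "\<dots> = 1/2 * (\<integral>x. (A u x - f x)\<^sup>2 \<partial>PX) + 1/2 * (\<integral>x. (A v x - g x)\<^sup>2 \<partial>PX)"
    using if' ig by (subst Bochner_Integration.integral_add) auto
  also have "\<dots> < e" using u(3) v(3) by argo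
  finally show "\<exists>u\<in>ell 2 K. (\<forall>k\<in>K. u k \<in> C k) \<and> (\<integral>x. (A u x - (f x + g x) / 2)\<^sup>2 \<partial>PX) < e"
    by (intro bexI[of _ ?w] conjI ballI wC w)
qed

text \<open>The midpoint of \<open>f\<close> and \<open>fC\<close> lies in \<open>CC\<close>, so its
  risk is at least the minimum; by the parallelogram law a quarter of the squared distance is then
  at most half of the excess risk.\<close>

lemma CC_minimizer_dist:
  assumes fC: "fC \<in> CC" "\<And>f. f \<in> CC \<Longrightarrow> risk P fC \<le> risk P f" and f: "f \<in> CC"
  shows "(\<integral>x. (f x - fC x)\<^sup>2 \<partial>PX) \<le> 2 * (risk P f - risk P fC)"
  using risk_midpoint[OF CC_L2[OF f] CC_L2[OF fC(1)]] fC(2)[OF CC_midpoint[OF f fC(1)]] by argo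

text \<open>Shrinking a truncation of an admissible point towards \<open>0\<close> moves it into the domain of the
  penalty, because \<open>dom k\<close> is an interval containing \<open>0\<close>.\<close>
lemma domG_dense:
  assumes dense: "\<And>k. k \<in> K \<Longrightarrow> C k \<subseteq> closure {t. h k t < \<infinity>}"
    and u: "u \<in> ell 2 K" "\<And>k. k \<in> K \<Longrightarrow> u k \<in> C k" and e: "0 < e"
  obtains v where "v \<in> domG" "F v < F u + e"
proof -
  obtain \<delta> where \<delta>: "0 < \<delta>" "\<And>w. sqsum K (\<lambda>k. w k - u k) < \<delta> \<Longrightarrow> modulus u w < e"
    by (rule modulus_small[OF e, where u=u]) blast
  \<comment> \<open>Truncation and shrinking may each move the point by less than
    \<open>sqrt (\<delta> / 4)\<close>, half of \<open>sqrt \<delta>\<close>.\<close>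
  obtain J where J: "finite J" "J \<subseteq> K" "sqsum K (\<lambda>k. (if k \<in> J then u k else 0) - u k) < \<delta> / 4"
    using \<delta>(1) sqsum_truncate[OF u(1), of "\<delta> / 4"] by (metis divide_pos_pos zero_less_numeral)
  let ?uJ = "\<lambda>k. if k \<in> J then u k else 0"
  \<comment> \<open>Shrinking by \<open>1 - t\<close> costs at most
    \<open>t^2 * sqsum K u \<le> t * sqsum K u\<close> in squared norm; the \<open>+ 1\<close>
    covers \<open>u = 0\<close>.\<close>
  define t where "t = min (1/2) (\<delta> / (4 * (sqsum K u + 1)) / 2)"
  have S: "0 < sqsum K u + 1" by (simp add: add_nonneg_pos)
  have t: "0 < t" "t < 1" "t * sqsum K u < \<delta> / 4"
  proof -
    show "0 < t" "t < 1" using \<delta>(1) S by (auto simp: t_def)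
    have "t * (sqsum K u + 1) \<le> \<delta> / (4 * (sqsum K u + 1)) / 2 * (sqsum K u + 1)"
      using S by (intro mult_right_mono) (auto simp: t_def)
    also have "\<dots> = \<delta> / 8" using S by (simp add: field_simps)
    finally show "t * sqsum K u < \<delta> / 4" using \<open>0 < t\<close> \<delta>(1) by (simp add: algebra_simps)
  qed
  let ?v = "\<lambda>k. (1 - t) * ?uJ k"
  have vdom: "?v k \<in> dom k" if k: "k \<in> J" for k
  proof -
    have kK: "k \<in> K" using k J by blast
    have mult_dom: "(1 - t) * u k \<in> dom k" if "u k \<noteq> 0"
    proof -
      have "u k \<in> closure {t. h k t < \<infinity>}" using dense[OF kK] u(2)[OF kK] by blast
      moreover have "0 < t * \<bar>u k\<bar>" using t that by simp
      ultimately obtain s where s: "h k s < \<infinity>" "\<bar>s - u k\<bar> < t * \<bar>u k\<bar>"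
        unfolding closure_approachable dist_real_def by blast
      \<comment> \<open>\<open>s\<close> is closer to \<open>u k\<close> than
        \<open>t * |u k|\<close>, so seen from \<open>0\<close> it lies strictly beyond
        \<open>(1 - t) * u k\<close>, which is therefore a proper convex combination of
        \<open>0\<close> and \<open>s\<close>.\<close>
      have "\<exists>\<theta>. 0 < \<theta> \<and> \<theta> < 1 \<and> (1 - t) * u k = \<theta> * s"
      proof (cases "0 < u k")
        case True
        then have "(1 - t) * u k < s" "0 < (1 - t) * u k" using s t by (auto simp: algebra_simps)
        then show ?thesis by (intro exI[of _ "(1 - t) * u k / s"]) auto
      next
        case False
        then have "u k < 0" using that by simp
        then have "s < (1 - t) * u k" "(1 - t) * u k < 0"
          using s t by (auto simp: algebra_simps mult_less_0_iff mult_pos_neg)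
        then show ?thesis by (intro exI[of _ "(1 - t) * u k / s"]) (auto simp: neg_less_divide_eq neg_divide_less_eq divide_neg_neg)
      qed
      then obtain \<theta> where \<theta>: "0 < \<theta>" "\<theta> < 1" "(1 - t) * u k = \<theta> * s" by blast
      have "h k ((1 - t) * u k) < \<infinity>"
        using h_convex(1)[OF kK _ s(1) \<theta>(1,2), of 0] h[OF kK] \<theta>(3) by simp
      moreover have "(1 - t) * u k \<in> C k"
      proof -
        have "convex (C k)" using C[OF kK] by (simp add: is_interval_convex)
        from convexD[OF this _ u(2)[OF kK], of 0 t "1 - t"] show ?thesis using C[OF kK] t by simp
      qed
      ultimately show ?thesis by (simp add: dom_def)
    qed
    show ?thesis
      using mult_dom zero_dom[OF kK] k by (cases "u k = 0") auto
  qed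
  have v: "?v \<in> domG"
    by (rule finite_support_domG[OF J(1,2) _ vdom]) auto
  have uJ: "?uJ \<in> ell 2 K" "sqsum K ?uJ \<le> sqsum K u"
    using sqsum_restrict_le[OF u(1) J(2)] by auto
  have sq4: "sqrt (\<delta> / 4) + sqrt (\<delta> / 4) = sqrt \<delta>"
    by (simp add: real_sqrt_divide)
  have "(- t)\<^sup>2 * sqsum K ?uJ \<le> t * sqsum K u"
  proof (rule mult_mono)
    show "(- t)\<^sup>2 \<le> t" using t by (simp add: power2_eq_square mult_left_le)
  qed (use uJ t in auto)
  then have a: "sqrt (sqsum K (\<lambda>k. - t * ?uJ k)) < sqrt (\<delta> / 4)"
    unfolding sqsum_scale using t(3) by simp
  have b: "sqrt (sqsum K (\<lambda>k. ?uJ k - u k)) < sqrt (\<delta> / 4)" using J(3) by simp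
  have "sqrt (sqsum K (\<lambda>k. - t * ?uJ k + (?uJ k - u k))) < sqrt (\<delta> / 4) + sqrt (\<delta> / 4)"
    using sqsum_triangle(2)[OF ell_2_summable[OF ell_2_scale[OF uJ(1), of "-t"]] ell_2_summable[OF ell_2_diff[OF uJ(1) u(1)]]] a b
    by linarith
  moreover have "(\<lambda>k. - t * ?uJ k + (?uJ k - u k)) = (\<lambda>k. ?v k - u k)"
    by (simp add: algebra_simps)
  ultimately have "sqsum K (\<lambda>k. ?v k - u k) < \<delta>"
    unfolding sq4 by (simp only: real_sqrt_less_iff)
  from \<delta>(2)[OF this] have "F ?v < F u + e"
    using F_modulus[OF u(1) domG_ell_2[OF v]] unfolding abs_le_iff by argo
  with v show thesis by (rule that)
qed

lemma domG_risk_dense: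
  assumes dense: "\<And>k. k \<in> K \<Longrightarrow> C k \<subseteq> closure {t. h k t < \<infinity>}"
    and f: "f \<in> CC" and e: "0 < e"
  obtains v where "v \<in> domG" "F v < risk P f + e"
proof -
  \<comment> \<open>\<open>\<theta>\<close> keeps its share of the risk below \<open>e / 2\<close>,
    the distance of the approximant contributes less than \<open>e / 4\<close>, and
    \<open>domG_dense\<close> spends the last \<open>e / 4\<close>.\<close>
  define \<theta> where "\<theta> = e / (4 * (risk P f + 1))"
  have R: "0 < risk P f + 1" using risk_nonneg[of f] by simp
  have \<theta>: "0 < \<theta>" "\<theta> * risk P f < e / 2"
  proof -
    show "0 < \<theta>" using e R by (simp add: \<theta>_def)
    have "e / (4 * x) * x = e / 4" if "0 < x" for x using that by simp
    from this[OF R] have "\<theta> * (risk P f + 1) = e / 4" unfolding \<theta>_def .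
    then show "\<theta> * risk P f < e / 2" using \<open>0 < \<theta>\<close> e by (simp add: algebra_simps)
  qed
  have "0 < e / (4 * (1 + 1 / \<theta>))" using e \<theta> by (simp add: add_pos_pos)
  then obtain u where u: "u \<in> ell 2 K" "\<And>k. k \<in> K \<Longrightarrow> u k \<in> C k"
    "(\<integral>x. (A u x - f x)\<^sup>2 \<partial>PX) < e / (4 * (1 + 1 / \<theta>))"
    by (rule CC_approx[OF f]) blast
  have "(1 + 1 / \<theta>) * (\<integral>x. (A u x - f x)\<^sup>2 \<partial>PX) < (1 + 1 / \<theta>) * (e / (4 * (1 + 1 / \<theta>)))"
    using u(3) \<theta> by (intro mult_strict_left_mono) (auto simp: add_pos_pos)
  also have "\<dots> = e / 4"
  proof -
    have "x * (e / (4 * x)) = e / 4" if "0 < x" for x using that by simp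
    then show ?thesis using \<theta>(1) by (simp only: add_pos_pos zero_less_one zero_less_divide_1_iff)
  qed
  finally have "F u < risk P f + 3 / 4 * e"
    using risk_le[OF CC_L2[OF f] A_L2[OF u(1)] \<theta>(1)] \<theta>(2) by (simp add: F_def algebra_simps)
  moreover have "0 < e / 4" using e by simp
  then obtain v where "v \<in> domG" "F v < F u + e / 4"
    using domG_dense[OF dense u(1,2)] by blast
  ultimately show thesis using that by auto
qed

end

section \<open>Empirical risk\<close>

locale learning_sample = learning K r \<eta> C D h MX Y P \<phi> \<kappa> b + iid_sample M P X
  for K :: "'k set" and r \<eta> :: real and C D :: "'k \<Rightarrow> real set" and h :: "'k \<Rightarrow> real \<Rightarrow> ereal"
    and MX :: "'x measure" and Y :: "real set" and P :: "('x \<times> real) measure"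
    and \<phi> :: "'k \<Rightarrow> 'x \<Rightarrow> real" and \<kappa> b :: real
    and M :: "'w measure" and X :: "nat \<Rightarrow> 'w \<Rightarrow> 'x \<times> real"
begin

text \<open>With the minus sign at \<open>None\<close>, the residual \<open>A u x - y\<close> pairs
  the features with the weights \<open>1\<close> at \<open>None\<close> and \<open>u k\<close> at
  \<open>Some k\<close>.\<close>

definition feature :: "'k option \<Rightarrow> 'x \<times> real \<Rightarrow> real" where
  "feature a z = (case a of None \<Rightarrow> - snd z | Some k \<Rightarrow> \<phi> k (fst z))"

definition idx :: "'k option set" where
  "idx = insert None (Some ` K)"

lemma feature_measurable: "a \<in> idx \<Longrightarrow> feature a \<in> borel_measurable P"
  unfolding feature_def idx_def by (auto intro!: measurable_compose[OF fst_measurable phi])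

lemma feature_bound:
  assumes z: "z \<in> space P" and J: "finite J" "J \<subseteq> idx"
  shows "(\<Sum>a\<in>J. (feature a z)\<^sup>2) \<le> \<kappa>\<^sup>2 + b\<^sup>2"
proof -
  define J' where "J' = {k \<in> K. Some k \<in> J}"
  have x: "fst z \<in> space MX" using z by (auto simp: space_P)
  have J': "finite J'" "J' \<subseteq> K" "J \<subseteq> insert None (Some ` J')"
    using J finite_vimageI[of J Some] by (auto simp: J'_def idx_def intro: finite_subset[of _ "Some -` J"])
  have "(\<Sum>a\<in>J. (feature a z)\<^sup>2) \<le> (\<Sum>a\<in>insert None (Some ` J'). (feature a z)\<^sup>2)"
    using J' by (intro sum_mono2) auto
  also have "\<dots> = (snd z)\<^sup>2 + (\<Sum>k\<in>J'. (\<phi> k (fst z))\<^sup>2)"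
    using J' by (simp add: sum.reindex feature_def)
  also have "(snd z)\<^sup>2 \<le> b\<^sup>2"
    using power_mono[OF snd_bound[OF z], where n=2] by simp
  also have "(\<Sum>k\<in>J'. (\<phi> k (fst z))\<^sup>2) \<le> (\<Sum>\<^sub>\<infinity>k\<in>K. (\<phi> k (fst z))\<^sup>2)"
    using J' x by (intro finite_sum_le_infsum_real phi_summable) auto
  also have "\<dots> \<le> \<kappa>\<^sup>2" using kappa(2)[OF x] by simp
  finally show ?thesis by simp
qed

text \<open>The products form a rank-one matrix, whose Hilbert-Schmidt norm is the squared norm of
  the feature vector; this is the origin of \<open>\<kappa>^2 + b^2\<close>. A finite set of index
  pairs is enlarged to a rectangle, where the double sum factors.\<close>

sublocale bounded_features M P X "idx \<times> idx" "\<lambda>(a, a') z. feature a z * feature a' z" "\<kappa>\<^sup>2 + b\<^sup>2"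
proof
  let ?\<psi> = "\<lambda>(a, a') z. feature a z * feature a' z"
  show "countable (idx \<times> idx)" using K by (simp add: idx_def)
  show "?\<psi> i \<in> borel_measurable P" if "i \<in> idx \<times> idx" for i
    using that by (auto intro!: borel_measurable_times feature_measurable)
  fix z J assume z: "z \<in> space P" and J: "finite J" "J \<subseteq> idx \<times> idx"
  have "(\<Sum>i\<in>J. (?\<psi> i z)\<^sup>2)
    \<le> (\<Sum>i\<in>fst ` J \<times> snd ` J. (?\<psi> i z)\<^sup>2)"
    using J(1) subset_fst_snd[of J] by (intro sum_mono2) auto
  also have "\<dots> = (\<Sum>a\<in>fst ` J. (feature a z)\<^sup>2) * (\<Sum>a\<in>snd ` J. (feature a z)\<^sup>2)"
    by (simp add: sum_product sum.cartesian_product power_mult_distrib case_prod_unfold)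
  also have "\<dots> \<le> (\<kappa>\<^sup>2 + b\<^sup>2) * (\<kappa>\<^sup>2 + b\<^sup>2)"
    using J by (intro mult_mono feature_bound z sum_nonneg) auto
  finally show "(\<Sum>i\<in>J. (?\<psi> i z)\<^sup>2) \<le> (\<kappa>\<^sup>2 + b\<^sup>2)\<^sup>2"
    by (simp add: power2_eq_square)
qed simp

text \<open>The sample is cut to \<open>{1..n}\<close> so that it has literally the form of the
  training set given to the estimator.\<close>

definition emp :: "nat \<Rightarrow> 'w \<Rightarrow> ('k \<Rightarrow> real) \<Rightarrow> real" where
  "emp n \<omega> u = empirical_risk n (\<lambda>i\<in>{1..n}. X i \<omega>) (A u)"

lemma emp_eq: "emp n \<omega> u = (1 / real n) * (\<Sum>i=1..n. (A u (fst (X i \<omega>)) - snd (X i \<omega>))\<^sup>2)"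
  unfolding emp_def empirical_risk_def by (intro arg_cong2[where f="(*)"] sum.cong) auto

lemma X_space: "\<omega> \<in> space M \<Longrightarrow> X i \<omega> \<in> space P"
  by (rule measurable_space[OF X_measurable])

lemma emp_nonneg: "0 \<le> emp n \<omega> u"
  unfolding emp_eq by (intro mult_nonneg_nonneg sum_nonneg) auto

lemma emp_modulus:
  assumes "u \<in> ell 2 K" "v \<in> ell 2 K" "\<omega> \<in> space M" "1 \<le> n"
  shows "\<bar>emp n \<omega> v - emp n \<omega> u\<bar> \<le> modulus u v"
proof -
  let ?d = "\<lambda>i. (A v (fst (X i \<omega>)) - snd (X i \<omega>))\<^sup>2 - (A u (fst (X i \<omega>)) - snd (X i \<omega>))\<^sup>2"
  have "emp n \<omega> v - emp n \<omega> u = (1 / real n) * (\<Sum>i=1..n. ?d i)"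
    by (simp add: emp_eq sum_subtractf right_diff_distrib)
  also have "\<bar>\<dots>\<bar> \<le> (1 / real n) * (\<Sum>i=1..n. \<bar>?d i\<bar>)"
    by (simp add: abs_mult divide_right_mono sum_abs)
  also have "\<dots> \<le> (1 / real n) * (\<Sum>i=1..n. modulus u v)"
    using assms by (intro mult_left_mono sum_mono loss_modulus X_space) auto
  also have "\<dots> = modulus u v" using assms(4) by simp
  finally show ?thesis .
qed

lemma emp_0:
  assumes "\<omega> \<in> space M" "1 \<le> n"
  shows "emp n \<omega> (\<lambda>_. 0) \<le> b\<^sup>2"
proof -
  have "emp n \<omega> (\<lambda>_. 0) = (1 / real n) * (\<Sum>i=1..n. (snd (X i \<omega>))\<^sup>2)"
    by (simp add: emp_eq synthesis_def)
  also have "\<dots> \<le> (1 / real n) * (\<Sum>i=1..n. b\<^sup>2)"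
    using power_mono[OF snd_bound[OF X_space[OF assms(1)]], where n=2]
    by (intro mult_left_mono sum_mono) auto
  also have "\<dots> = b\<^sup>2" using assms(2) by simp
  finally show ?thesis .
qed

text \<open>Convexity of the square; it will pass near-minimality from the estimator to the segment
  that joins it to the selected minimizer.\<close>

lemma emp_convex:
  assumes u: "u \<in> ell 2 K" and v: "v \<in> ell 2 K" and w: "\<omega> \<in> space M" and t: "0 \<le> t" "t \<le> 1"
  shows "emp n \<omega> (\<lambda>k. (1 - t) * u k + t * v k) \<le> (1 - t) * emp n \<omega> u + t * emp n \<omega> v"
proof -
  let ?L = "\<lambda>u i. (A u (fst (X i \<omega>)) - snd (X i \<omega>))\<^sup>2"
  have cvx: "((1 - t) * p + t * q)\<^sup>2 \<le> (1 - t) * p\<^sup>2 + t * q\<^sup>2" for p q :: real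
  proof -
    have "(1 - t) * p\<^sup>2 + t * q\<^sup>2 - ((1 - t) * p + t * q)\<^sup>2 = t * (1 - t) * (p - q)\<^sup>2"
      by (simp add: power2_eq_square algebra_simps)
    moreover have "0 \<le> t * (1 - t) * (p - q)\<^sup>2" using t by simp
    ultimately show ?thesis by linarith
  qed
  have "?L (\<lambda>k. (1 - t) * u k + t * v k) i \<le> (1 - t) * ?L u i + t * ?L v i" for i
  proof -
    have "fst (X i \<omega>) \<in> space MX" using X_space[OF w, of i] by (auto simp: space_P)
    then have "A (\<lambda>k. (1 - t) * u k + t * v k) (fst (X i \<omega>)) - snd (X i \<omega>)
      = (1 - t) * (A u (fst (X i \<omega>)) - snd (X i \<omega>)) + t * (A v (fst (X i \<omega>)) - snd (X i \<omega>))"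
      using A_lincomb[OF u v, of "fst (X i \<omega>)" "1 - t" t] by (simp add: algebra_simps)
    then show ?thesis by (simp only: cvx)
  qed
  then have "emp n \<omega> (\<lambda>k. (1 - t) * u k + t * v k) \<le> (1 / real n) * (\<Sum>i=1..n. (1 - t) * ?L u i + t * ?L v i)"
    unfolding emp_eq by (intro mult_left_mono sum_mono) auto
  also have "\<dots> = (1 - t) * emp n \<omega> u + t * emp n \<omega> v"
    unfolding emp_eq by (simp add: sum.distrib sum_distrib_left[symmetric] distrib_left mult.left_commute)
  finally show ?thesis .
qed

text \<open>For finite support both risks expand into double sums with weights
  \<open>W a * W a'\<close>, so their difference pairs these weights with the centred sums.
  Cauchy-Schwarz bounds it by a product of two Hilbert-Schmidt norms; that of the weights is one
  plus the squared norm of \<open>u\<close>.\<close>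

lemma emp_close_finite:
  assumes J: "finite J" "J \<subseteq> K" and u0: "\<And>k. k \<notin> J \<Longrightarrow> u k = 0"
    and w: "\<omega> \<in> space M" and n: "1 \<le> n" and \<delta>: "0 \<le> \<delta>" "devsq n \<omega> \<le> ennreal ((real n * \<delta>)\<^sup>2)"
  shows "\<bar>emp n \<omega> u - F u\<bar> \<le> (1 + (\<Sum>k\<in>J. (u k)\<^sup>2)) * \<delta>"
proof -
  define W where "W = (\<lambda>a. case a of None \<Rightarrow> 1 | Some k \<Rightarrow> u k)"
  let ?I = "insert None (Some ` J)"
  let ?\<psi> = "\<lambda>(a, a') z. feature a z * feature a' z"
  have I: "finite ?I" "?I \<subseteq> idx" using J by (auto simp: idx_def)
  have res: "A u (fst z) - snd z = (\<Sum>a\<in>?I. W a * feature a z)" for z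
  proof -
    have "A u (fst z) = (\<Sum>\<^sub>\<infinity>k\<in>J. u k * \<phi> k (fst z))"
      unfolding synthesis_def using J u0 by (intro infsum_cong_neutral) auto
    then show ?thesis using J by (simp add: sum.reindex W_def feature_def)
  qed
  have loss: "(A u (fst z) - snd z)\<^sup>2 = (\<Sum>i\<in>?I\<times>?I. W (fst i) * W (snd i) * ?\<psi> i z)" for z
    unfolding res power2_eq_square sum_product sum.cartesian_product
    by (intro sum.cong) (auto simp: mult_ac)
  have int: "integrable P (?\<psi> i)" if "i \<in> ?I \<times> ?I" for i
    using that I by (intro \<psi>_integrable) auto
  have "F u = (\<Sum>i\<in>?I\<times>?I. W (fst i) * W (snd i) * (\<integral>z. ?\<psi> i z \<partial>P))"
    unfolding F_def risk_eq loss using int by (simp add: Bochner_Integration.integral_sum)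
  moreover have "emp n \<omega> u = (1 / real n) * (\<Sum>i\<in>?I\<times>?I. W (fst i) * W (snd i) * (\<Sum>m=1..n. ?\<psi> i (X m \<omega>)))"
    unfolding emp_eq loss by (subst sum.swap) (simp add: sum_distrib_left)
  moreover have "dev i n \<omega> = (\<Sum>m=1..n. ?\<psi> i (X m \<omega>)) - real n * (\<integral>z. ?\<psi> i z \<partial>P)" for i
    by (simp add: dev_def centred_def sum_subtractf)
  then have "(\<Sum>m=1..n. ?\<psi> i (X m \<omega>)) = dev i n \<omega> + real n * (\<integral>z. ?\<psi> i z \<partial>P)" for i
    by simp
  ultimately have "emp n \<omega> u - F u = (1 / real n) * (\<Sum>i\<in>?I\<times>?I. W (fst i) * W (snd i) * dev i n \<omega>)"
    using n by (simp only: distrib_left sum.distrib) (simp add: mult.left_commute flip: sum_distrib_left)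
  also have "\<bar>\<dots>\<bar> \<le> (1 / real n) * ((1 + (\<Sum>k\<in>J. (u k)\<^sup>2)) * (real n * \<delta>))"
  proof -
    have "\<bar>\<Sum>i\<in>?I\<times>?I. W (fst i) * W (snd i) * dev i n \<omega>\<bar> \<le> (\<Sum>i\<in>?I\<times>?I. \<bar>W (fst i) * W (snd i)\<bar> * \<bar>dev i n \<omega>\<bar>)"
      by (rule order_trans[OF sum_abs]) (simp add: abs_mult)
    also have "\<dots> \<le> L2_set (\<lambda>i. W (fst i) * W (snd i)) (?I\<times>?I) * L2_set (\<lambda>i. dev i n \<omega>) (?I\<times>?I)"
      by (rule L2_set_mult_ineq)
    also have "L2_set (\<lambda>i. W (fst i) * W (snd i)) (?I\<times>?I) = 1 + (\<Sum>k\<in>J. (u k)\<^sup>2)"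
    proof -
      have "(\<Sum>i\<in>?I\<times>?I. (W (fst i) * W (snd i))\<^sup>2) = (\<Sum>a\<in>?I. (W a)\<^sup>2)\<^sup>2"
        by (simp only: power2_eq_square[of "sum _ _"] sum_product sum.cartesian_product power_mult_distrib case_prod_unfold)
      also have "(\<Sum>a\<in>?I. (W a)\<^sup>2) = 1 + (\<Sum>k\<in>J. (u k)\<^sup>2)"
        using J by (simp add: sum.reindex W_def)
      finally show ?thesis by (simp add: L2_set_def sum_nonneg add_nonneg_nonneg)
    qed
    also have "L2_set (\<lambda>i. dev i n \<omega>) (?I\<times>?I) \<le> real n * \<delta>"
    proof -
      have "ennreal (\<Sum>i\<in>?I\<times>?I. (dev i n \<omega>)\<^sup>2) = (\<Sum>i\<in>?I\<times>?I. ennreal ((dev i n \<omega>)\<^sup>2))"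
        by (simp add: sum_ennreal)
      also have "\<dots> \<le> devsq n \<omega>"
        unfolding devsq_def using I by (intro sum_le_nn_integral_count_space) auto
      also note \<delta>(2)
      finally have "(\<Sum>i\<in>?I\<times>?I. (dev i n \<omega>)\<^sup>2) \<le> (real n * \<delta>)\<^sup>2"
        by (subst (asm) ennreal_le_iff) auto
      then show ?thesis unfolding L2_set_def using \<delta>(1) by (intro real_le_lsqrt) (auto simp: sum_nonneg)
    qed
    finally have "\<bar>\<Sum>i\<in>?I\<times>?I. W (fst i) * W (snd i) * dev i n \<omega>\<bar> \<le> (1 + (\<Sum>k\<in>J. (u k)\<^sup>2)) * (real n * \<delta>)"
      by (simp add: mult_left_mono sum_nonneg add_nonneg_nonneg)
    then have "(1 / real n) * \<bar>\<Sum>i\<in>?I\<times>?I. W (fst i) * W (snd i) * dev i n \<omega>\<bar> \<le> (1 / real n) * ((1 + (\<Sum>k\<in>J. (u k)\<^sup>2)) * (real n * \<delta>))"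
      by (intro mult_left_mono) auto
    then show ?thesis by (simp add: abs_mult)
  qed
  also have "\<dots> = (1 + (\<Sum>k\<in>J. (u k)\<^sup>2)) * \<delta>" using n by simp
  finally show ?thesis .
qed

text \<open>Truncations of \<open>u\<close> change both risks by at most an arbitrarily small
  \<open>modulus\<close>, so the bound for finite support passes to the limit with the same
  \<open>\<delta>\<close>.\<close>

lemma emp_close:
  assumes u: "u \<in> ell 2 K" and w: "\<omega> \<in> space M" and n: "1 \<le> n"
    and \<delta>: "0 \<le> \<delta>" "devsq n \<omega> \<le> ennreal ((real n * \<delta>)\<^sup>2)"
  shows "\<bar>emp n \<omega> u - F u\<bar> \<le> (1 + sqsum K u) * \<delta>"
proof (rule field_le_epsilon)
  fix e :: real assume "0 < e"
  then have "0 < e / 2" by simp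
  then obtain d where d: "0 < d" "\<And>v. sqsum K (\<lambda>k. v k - u k) < d \<Longrightarrow> modulus u v < e / 2"
    by (rule modulus_small[where u=u]) blast
  obtain J where J: "finite J" "J \<subseteq> K" "sqsum K (\<lambda>k. (if k \<in> J then u k else 0) - u k) < d"
    by (rule sqsum_truncate[OF u d(1)]) blast
  let ?v = "\<lambda>k. if k \<in> J then u k else 0"
  have v: "?v \<in> ell 2 K" by (rule sqsum_restrict_le(1)[OF u J(2)])
  have m: "modulus u ?v < e / 2" by (rule d(2)[OF J(3)])
  have "(\<Sum>k\<in>J. (?v k)\<^sup>2) \<le> sqsum K u"
    unfolding sqsum_def using J finite_sum_le_infsum_real[OF ell_2_summable[OF u] J(1,2)] by simp
  then have "(1 + (\<Sum>k\<in>J. (?v k)\<^sup>2)) * \<delta> \<le> (1 + sqsum K u) * \<delta>"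
    using \<delta>(1) by (intro mult_right_mono) auto
  moreover have "\<bar>emp n \<omega> ?v - F ?v\<bar> \<le> (1 + (\<Sum>k\<in>J. (?v k)\<^sup>2)) * \<delta>"
    by (rule emp_close_finite[OF J(1,2) _ w n \<delta>]) simp
  moreover have "\<bar>emp n \<omega> ?v - emp n \<omega> u\<bar> \<le> modulus u ?v"
    by (rule emp_modulus[OF u v w n])
  moreover have "\<bar>F ?v - F u\<bar> \<le> modulus u ?v"
    by (rule F_modulus[OF u v])
  ultimately show "\<bar>emp n \<omega> u - F u\<bar> \<le> (1 + sqsum K u) * \<delta> + e"
    using m by arith
qed

section \<open>Deterministic consistency\<close>

text \<open>Near-minimality as a real inequality, with competitors from \<open>domG\<close>, where
  the penalty is finite. It concerns a single sample point and so involves no measurability.\<close>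

definition est :: "nat \<Rightarrow> real \<Rightarrow> real \<Rightarrow> 'w \<Rightarrow> ('k \<Rightarrow> real) \<Rightarrow> bool" where
  "est n l e \<omega> u \<longleftrightarrow> u \<in> domG \<and> (\<forall>v\<in>domG. emp n \<omega> u + l * Gr u \<le> emp n \<omega> v + l * Gr v + e)"

lemma Argmin_eps_est:
  assumes u: "u \<in> Argmin_eps e (ell 2 K)
      (\<lambda>u. ereal (empirical_risk n (\<lambda>i\<in>{1..n}. X i \<omega>) (A u)) + ereal l * penalty K C D h u)"
    and l: "0 < l"
  shows "est n l e \<omega> u"
proof -
  let ?\<Phi> = "\<lambda>u. ereal (empirical_risk n (\<lambda>i\<in>{1..n}. X i \<omega>) (A u)) + ereal l * penalty K C D h u"
  have fin: "?\<Phi> v = ereal (emp n \<omega> v + l * Gr v)" if "v \<in> domG" for v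
    using penalty_eq[of v] that by (auto simp: emp_def domG_def)
  have u2: "u \<in> ell 2 K" using u by (simp add: Argmin_eps_def)
  have le: "?\<Phi> u \<le> ereal (emp n \<omega> v + l * Gr v + e)" if v: "v \<in> domG" for v
  proof -
    have "?\<Phi> u \<le> (INF v\<in>ell 2 K. ?\<Phi> v) + ereal e"
      using u by (simp add: Argmin_eps_def)
    also have "\<dots> \<le> ?\<Phi> v + ereal e"
      by (intro add_right_mono INF_lower domG_ell_2 v)
    finally show ?thesis unfolding fin[OF v] by simp
  qed
  \<comment> \<open>Comparison with the zero family, whose penalty is finite, excludes an infinite
    penalty.\<close>
  have "u \<in> domG"
  proof (rule ccontr)
    assume "u \<notin> domG"
    then have "penalty K C D h u = \<infinity>" using penalty_eq[of u] u2 by (auto simp: ell_2_iff)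
    then show False using le[OF zero_domG] l by simp
  qed
  then show ?thesis using le fin[OF \<open>u \<in> domG\<close>] by (auto simp: est_def)
qed

text \<open>A bound for \<open>l * psum u\<close> at an estimator: \<open>b^2\<close> bounds the
  empirical risk of \<open>0\<close>, \<open>1\<close> the tolerance, \<open>B\<close> the negative
  part of the penalty, and \<open>2 / \<eta>\<close> is the coercivity constant.\<close>

definition Q :: real where "Q = 2 / \<eta> * (b\<^sup>2 + 1 + B)"

lemma est_sqsum:
  assumes e: "est n l e \<omega> u" "e \<le> 1" and l: "0 < l" "l \<le> 1" and w: "\<omega> \<in> space M" and n: "1 \<le> n"
  shows "sqsum K u * l powr (2 / r) \<le> Q powr (2 / r)"
proof -
  have u: "u \<in> domG" using e(1) by (simp add: est_def)
  have "emp n \<omega> u + l * Gr u \<le> emp n \<omega> (\<lambda>_. 0) + l * Gr (\<lambda>_. 0) + e"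
    using e(1) zero_domG unfolding est_def by blast
  then have lG: "l * Gr u \<le> b\<^sup>2 + 1"
    using emp_nonneg[of n \<omega> u] emp_0[OF w n] e(2) by (simp add: Gr_0)
  have "l * (psum u) \<le> l * (2 / \<eta> * (Gr u + B))"
    using domG_powr(2)[OF u] l by (intro mult_left_mono) auto
  also have "\<dots> = 2 / \<eta> * (l * Gr u + l * B)" by (simp add: algebra_simps)
  also have "\<dots> \<le> Q"
    unfolding Q_def using eta lG l B_nonneg by (intro mult_left_mono add_mono mult_left_le_one_le) auto
  finally have q: "l * (psum u) \<le> Q" .
  have "sqsum K u * l powr (2 / r) \<le> (psum u) powr (2 / r) * l powr (2 / r)"
    by (intro mult_right_mono sqsum_le_powr_sum(2)[OF r domG_powr(1)[OF u]]) auto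
  also have "\<dots> = (l * (psum u)) powr (2 / r)"
    using l by (simp add: powr_mult infsum_nonneg mult.commute)
  also have "\<dots> \<le> Q powr (2 / r)"
    using q l r by (intro powr_mono2 mult_nonneg_nonneg infsum_nonneg) auto
  finally show ?thesis .
qed

text \<open>The deviation is paid twice, at \<open>u\<close> and at the competitor \<open>v\<close>,
  each time with that point's own squared norm.\<close>

lemma near_minimizer_transfer:
  assumes u: "u \<in> domG" and v: "v \<in> domG" and le: "emp n \<omega> u + l * Gr u \<le> emp n \<omega> v + l * Gr v + e"
    and w: "\<omega> \<in> space M" and n: "1 \<le> n" and \<delta>: "0 \<le> \<delta>" "devsq n \<omega> \<le> ennreal ((real n * \<delta>)\<^sup>2)"
  shows "F u + l * Gr u \<le> F v + l * Gr v + (2 + sqsum K v + sqsum K u) * \<delta> + e"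
proof -
  have "F u \<le> emp n \<omega> u + (1 + sqsum K u) * \<delta>"
    using emp_close[OF domG_ell_2[OF u] w n \<delta>] by linarith
  moreover have "emp n \<omega> v \<le> F v + (1 + sqsum K v) * \<delta>"
    using emp_close[OF domG_ell_2[OF v] w n \<delta>] by linarith
  moreover have "(2 + sqsum K v + sqsum K u) * \<delta> = (1 + sqsum K u) * \<delta> + (1 + sqsum K v) * \<delta>"
    by (simp add: algebra_simps)
  ultimately show ?thesis using le by linarith
qed

text \<open>One competitor \<open>v\<close>, chosen for \<open>s\<close> alone, serves all
  \<open>n\<close>. The possibly large norm of the estimator is compensated by the factor
  \<open>l powr (2 / r)\<close> of the deviation, through \<open>est_sqsum\<close>.\<close>

lemma risk_consistency:
  assumes fC: "fC \<in> CC" "\<And>f. f \<in> CC \<Longrightarrow> risk P fC \<le> risk P f"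
    and dense: "\<And>k. k \<in> K \<Longrightarrow> C k \<subseteq> closure {t. h k t < \<infinity>}" and s: "0 < s"
  obtains \<tau> where "0 < \<tau>"
    "\<And>n l e \<omega> u. 1 \<le> n \<Longrightarrow> 0 < l \<Longrightarrow> l < \<tau> \<Longrightarrow> e < \<tau> \<Longrightarrow> \<omega> \<in> space M \<Longrightarrow> est n l e \<omega> u \<Longrightarrow>
       devsq n \<omega> \<le> ennreal ((real n * (\<tau> * l powr (2 / r)))\<^sup>2) \<Longrightarrow> (\<integral>x. (A u x - fC x)\<^sup>2 \<partial>PX) \<le> s"
proof -
  have s8: "0 < s / 8" using s by simp
  obtain v where v: "v \<in> domG" "F v < risk P fC + s / 8"
    using domG_risk_dense[OF dense fC(1) s8] by blast
  define c1 where "c1 = 2 + sqsum K v + Q powr (2 / r)"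
  define c2 where "c2 = \<bar>Gr v\<bar> + B + 1"
  have c: "0 < c1" "0 < c2" using B_nonneg by (auto simp: c1_def c2_def add_pos_nonneg add_nonneg_pos)
  \<comment> \<open>Four errors of size \<open>s / 8\<close>: the competitor, the tolerance, the
    deviation through \<open>c1\<close> and the penalty through \<open>c2\<close>.
    \<open>CC_minimizer_dist\<close> doubles their sum to \<open>s\<close>.\<close>
  define \<tau> where "\<tau> = min (min 1 (s / 8)) (min (s / 8 / c1) (s / 8 / c2))"
  have \<tau>: "0 < \<tau>" "\<tau> \<le> 1" "\<tau> \<le> s / 8" "\<tau> * c1 \<le> s / 8" "\<tau> * c2 \<le> s / 8"
  proof -
    show "0 < \<tau>" "\<tau> \<le> 1" "\<tau> \<le> s / 8" using s c by (auto simp: \<tau>_def)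
    have "\<tau> \<le> s / 8 / c1" "\<tau> \<le> s / 8 / c2" by (auto simp: \<tau>_def)
    then show "\<tau> * c1 \<le> s / 8" "\<tau> * c2 \<le> s / 8" using c by (simp_all only: pos_le_divide_eq)
  qed
  show thesis
  proof (rule that[OF \<tau>(1)])
    fix n l e \<omega> u
    assume n: "1 \<le> n" and l: "0 < l" "l < \<tau>" and e: "e < \<tau>" and w: "\<omega> \<in> space M" and est: "est n l e \<omega> u"
      and dev: "devsq n \<omega> \<le> ennreal ((real n * (\<tau> * l powr (2 / r)))\<^sup>2)"
    have u: "u \<in> domG" using est by (simp add: est_def)
    have l1: "l \<le> 1" "e \<le> 1" using l e \<tau> by auto
    have lp: "0 \<le> l powr (2 / r)" "l powr (2 / r) \<le> 1"
      using l l1 r by (auto intro: powr_le1)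
    have "emp n \<omega> u + l * Gr u \<le> emp n \<omega> v + l * Gr v + e"
      using est v(1) by (auto simp: est_def)
    from near_minimizer_transfer[OF u v(1) this w n _ dev]
    have main: "F u + l * Gr u \<le> F v + l * Gr v + (2 + sqsum K v + sqsum K u) * (\<tau> * l powr (2 / r)) + e"
      using \<tau>(1) by simp
    have "(2 + sqsum K v) * l powr (2 / r) + sqsum K u * l powr (2 / r) \<le> (2 + sqsum K v) * 1 + Q powr (2 / r)"
      by (intro add_mono mult_left_mono lp est_sqsum[OF est l1(2) l(1) l1(1) w n]) auto
    then have "\<tau> * ((2 + sqsum K v) * l powr (2 / r) + sqsum K u * l powr (2 / r)) \<le> \<tau> * c1"
      using \<tau>(1) by (intro mult_left_mono) (auto simp: c1_def)
    then have t1: "(2 + sqsum K v + sqsum K u) * (\<tau> * l powr (2 / r)) \<le> s / 8"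
      using \<tau>(4) by (simp add: algebra_simps)
    have "l * (Gr v - Gr u) \<le> \<tau> * c2"
    proof -
      have "Gr v - Gr u \<le> c2" using Gr_ge[OF u] by (simp add: c2_def)
      then have "l * (Gr v - Gr u) \<le> l * c2" using l by (intro mult_left_mono) auto
      also have "\<dots> \<le> \<tau> * c2" using l c by (intro mult_right_mono) auto
      finally show ?thesis .
    qed
    then have t2: "l * Gr v - l * Gr u \<le> s / 8" using \<tau>(5) by (simp add: right_diff_distrib)
    have "F u \<le> risk P fC + s / 2"
      using main t1 t2 v(2) e \<tau>(3) s by argo
    then have "2 * (risk P (A u) - risk P fC) \<le> s" by (simp add: F_def)
    then show "(\<integral>x. (A u x - fC x)\<^sup>2 \<partial>PX) \<le> s"
      using CC_minimizer_dist[OF fC A_domG_CC[OF u]] by (rule order_trans[rotated])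
  qed
qed

text \<open>Moving from the selected minimizer towards the estimator only until the distance is at most
  \<open>1\<close> keeps near-minimality, by convexity, while the deviation of the empirical risk stays bounded
  uniformly; so no a priori bound on the estimator is needed.\<close>
lemma selection_consistency:
  assumes w: "w \<in> domG" and f: "\<And>u. u \<in> domG \<Longrightarrow> F w \<le> F u"
    and stab: "\<And>e. 0 < e \<Longrightarrow> \<exists>\<gamma>>0. \<forall>u\<in>domG. F u \<le> F w + \<gamma> \<longrightarrow> Gr u \<le> Gr w + \<gamma> \<longrightarrow> pdist u w < e"
    and s: "0 < s"
  obtains \<tau> where "0 < \<tau>"
    "\<And>n l e \<omega> u. 1 \<le> n \<Longrightarrow> 0 < l \<Longrightarrow> l < \<tau> \<Longrightarrow> 0 \<le> e \<Longrightarrow> e \<le> \<tau> * l \<Longrightarrow> \<omega> \<in> space M \<Longrightarrow> est n l e \<omega> u \<Longrightarrow>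
       devsq n \<omega> \<le> ennreal ((real n * (\<tau> * l))\<^sup>2) \<Longrightarrow> pdist u w < s"
proof -
  \<comment> \<open>The cap at \<open>1\<close> makes the conclusion incompatible with a point at
    distance exactly \<open>1\<close>, which settles the second case at the end.\<close>
  have "0 < min s 1" using s by simp
  from stab[OF this] obtain \<gamma> where \<gamma>: "0 < \<gamma>"
    "\<And>u. u \<in> domG \<Longrightarrow> F u \<le> F w + \<gamma> \<Longrightarrow> Gr u \<le> Gr w + \<gamma> \<Longrightarrow> pdist u w < min s 1" by blast
  \<comment> \<open>Within distance \<open>1\<close> of \<open>w\<close>, \<open>sqsum K v\<close>
    is at most the last summand. Of the \<open>3\<close>, two units come from the transfer and one
    pays for the tolerance, since \<open>e \<le> \<tau> * l\<close>.\<close>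
  define c1 where "c1 = 3 + sqsum K w + (sqrt (sqsum K w) + 1)\<^sup>2"
  define c2 where "c2 = \<bar>Gr w\<bar> + B + 1"
  have c: "0 < c1" "0 < c2" using B_nonneg by (auto simp: c1_def c2_def add_pos_nonneg add_nonneg_pos)
  define \<tau> where "\<tau> = min 1 (min (\<gamma> / 2 / c1) (\<gamma> / 2 / c2))"
  have \<tau>: "0 < \<tau>" "\<tau> \<le> 1" "\<tau> * c1 \<le> \<gamma> / 2" "\<tau> * c2 \<le> \<gamma> / 2"
  proof -
    show "0 < \<tau>" "\<tau> \<le> 1" using \<gamma>(1) c by (auto simp: \<tau>_def)
    have "\<tau> \<le> \<gamma> / 2 / c1" "\<tau> \<le> \<gamma> / 2 / c2" by (auto simp: \<tau>_def)
    then show "\<tau> * c1 \<le> \<gamma> / 2" "\<tau> * c2 \<le> \<gamma> / 2" using c by (simp_all only: pos_le_divide_eq)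
  qed
  show thesis
  proof (rule that[OF \<tau>(1)])
    fix n l e \<omega> u
    assume n: "1 \<le> n" and l: "0 < l" "l < \<tau>" and e: "0 \<le> e" "e \<le> \<tau> * l" and \<omega>: "\<omega> \<in> space M"
      and est: "est n l e \<omega> u" and dev: "devsq n \<omega> \<le> ennreal ((real n * (\<tau> * l))\<^sup>2)"
    have u: "u \<in> domG" using est by (simp add: est_def)
    have close: "pdist v w < min s 1"
      if v: "v \<in> domG" and le: "emp n \<omega> v + l * Gr v \<le> emp n \<omega> w + l * Gr w + e"
        and d: "sqsum K (\<lambda>k. v k - w k) \<le> 1" for v
    proof -
      have "sqrt (sqsum K (\<lambda>k. w k + (v k - w k))) \<le> sqrt (sqsum K w) + sqrt (sqsum K (\<lambda>k. v k - w k))"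
        using ell_2_summable[OF domG_ell_2[OF w]] ell_2_summable[OF ell_2_diff[OF domG_ell_2[OF v] domG_ell_2[OF w]]]
        by (rule sqsum_triangle(2))
      also have "\<dots> \<le> sqrt (sqsum K w) + 1" using d by simp
      finally have "sqrt (sqsum K v) \<le> sqrt (sqsum K w) + 1" by simp
      then have "(sqrt (sqsum K v))\<^sup>2 \<le> (sqrt (sqsum K w) + 1)\<^sup>2" by (intro power_mono) auto
      then have "sqsum K v \<le> (sqrt (sqsum K w) + 1)\<^sup>2" by simp
      then have "(2 + sqsum K w + sqsum K v) * (\<tau> * l) \<le> (c1 - 1) * (\<tau> * l)"
        using \<tau>(1) l by (intro mult_right_mono) (auto simp: c1_def)
      moreover have "F v + l * Gr v \<le> F w + l * Gr w + (2 + sqsum K w + sqsum K v) * (\<tau> * l) + e"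
        using \<tau>(1) l by (intro near_minimizer_transfer[OF v w le \<omega> n _ dev]) auto
      ultimately have main: "F v + l * Gr v \<le> F w + l * Gr w + l * (\<tau> * c1)"
        using e(2) by (simp add: algebra_simps)
      \<comment> \<open>\<open>F w\<close> is minimal, so the risks drop out, and division by
        \<open>l\<close> bounds the penalty.\<close>
      have "l * (Gr v - Gr w) \<le> l * (\<tau> * c1)"
        using main f[OF v] by (simp add: algebra_simps)
      then have "Gr v - Gr w \<le> \<tau> * c1" using l(1) by (simp only: mult_le_cancel_left_pos)
      then have Gle: "Gr v \<le> Gr w + \<gamma>" using \<tau>(3) \<gamma>(1) by simp
      \<comment> \<open>Conversely, the penalty is bounded below, so its part in the bound for
        \<open>F v\<close> is of order \<open>l\<close>.\<close>
      have "l * (Gr w - Gr v) \<le> \<tau> * c2"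
      proof -
        have "Gr w - Gr v \<le> c2" using Gr_ge[OF v] by (simp add: c2_def)
        then have "l * (Gr w - Gr v) \<le> l * c2" using l by (intro mult_left_mono) auto
        also have "\<dots> \<le> \<tau> * c2" using l c by (intro mult_right_mono) auto
        finally show ?thesis .
      qed
      then have "l * Gr w - l * Gr v \<le> \<gamma> / 2" using \<tau>(4) by (simp add: right_diff_distrib)
      moreover have "l * (\<tau> * c1) \<le> \<gamma> / 2"
      proof -
        have "l * (\<tau> * c1) \<le> 1 * (\<tau> * c1)" using l \<tau> c by (intro mult_right_mono) auto
        then show ?thesis using \<tau>(3) by simp
      qed
      ultimately have "F v \<le> F w + \<gamma>" using main by argo
      with v Gle show ?thesis by (intro \<gamma>(2))
    qed
    have opt: "emp n \<omega> u + l * Gr u \<le> emp n \<omega> w + l * Gr w + e"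
      using est w by (auto simp: est_def)
    show "pdist u w < s"
    proof (cases "sqsum K (\<lambda>k. u k - w k) \<le> 1")
      case True
      then show ?thesis using close[OF u opt] by simp
    next
      case False
      let ?d = "sqsum K (\<lambda>k. u k - w k)"
      \<comment> \<open>This places \<open>?v\<close> at distance exactly \<open>1\<close> from
        \<open>w\<close>.\<close>
      define t where "t = 1 / sqrt ?d"
      have t: "0 < t" "t < 1" using False by (auto simp: t_def)
      let ?v = "\<lambda>k. (1 - t) * w k + t * u k"
      have v: "?v \<in> domG" "Gr ?v \<le> (1 - t) * Gr w + t * Gr u"
        using convex_comb_domG[OF w u t] by auto
      have "l * Gr ?v \<le> l * ((1 - t) * Gr w + t * Gr u)"
        using v(2) l by (intro mult_left_mono) auto
      then have lG: "l * Gr ?v \<le> (1 - t) * (l * Gr w) + t * (l * Gr u)"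
        by (simp add: algebra_simps)
      have "emp n \<omega> ?v + l * Gr ?v \<le> (1 - t) * (emp n \<omega> w + l * Gr w) + t * (emp n \<omega> u + l * Gr u)"
        using emp_convex[OF domG_ell_2[OF w] domG_ell_2[OF u] \<omega>, of t n] t lG by (simp add: distrib_left)
      also have "\<dots> \<le> (1 - t) * (emp n \<omega> w + l * Gr w) + t * (emp n \<omega> w + l * Gr w + e)"
        using opt t by (intro add_left_mono mult_left_mono) auto
      also have "\<dots> = emp n \<omega> w + l * Gr w + t * e" by (simp add: algebra_simps)
      also have "\<dots> \<le> emp n \<omega> w + l * Gr w + e"
        using t e(1) by (simp add: mult_left_le_one_le)
      finally have le: "emp n \<omega> ?v + l * Gr ?v \<le> emp n \<omega> w + l * Gr w + e" .
      have eq: "(\<lambda>k. ?v k - w k) = (\<lambda>k. t * (u k - w k))" by (simp add: algebra_simps)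
      have one: "sqsum K (\<lambda>k. ?v k - w k) = 1"
        unfolding eq sqsum_scale using False by (simp add: t_def power_divide)
      \<comment> \<open>A \<open>pdist\<close> below \<open>1\<close> forces a distance in
        \<open>ell 2 K\<close> below \<open>1\<close>, against \<open>one\<close>; the case does not
        occur.\<close>
      have "pdist ?v w < 1" using close[OF v(1) le] one by simp
      then have "pdist ?v w powr (2 / r) < 1 powr (2 / r)"
        using r pdist_nonneg by (intro powr_less_mono2) auto
      moreover have "sqsum K (\<lambda>k. ?v k - w k) \<le> pdist ?v w powr (2 / r)"
        unfolding pdist_def using pdist_summable[OF v(1) w] by (rule sqsum_le_powr_sum(2)[OF r])
      ultimately show ?thesis using one by simp
    qed
  qed
qed

end

section \<open>Consistency\<close>

context bounded_features
begin

text \<open>The interface between the deterministic estimates and probability: \<open>a n\<close> is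
  the scale against which the average deviation has to be small, and the threshold for
  \<open>n\<close> is uniform over the sample space.\<close>

definition controlled :: "(nat \<Rightarrow> 'w \<Rightarrow> ereal) \<Rightarrow> (nat \<Rightarrow> real) \<Rightarrow> bool" where
  "controlled W a \<longleftrightarrow> (\<forall>s>0. \<exists>\<tau>>0. \<forall>\<^sub>F n in sequentially. \<forall>x\<in>space M.
     devsq n x \<le> ennreal ((real n * (\<tau> * a n))\<^sup>2) \<longrightarrow> \<bar>W n x\<bar> \<le> ereal s)"

text \<open>If \<open>W n\<close> is large, \<open>devsq n\<close> exceeds
  \<open>(n * \<tau> * a n)^2\<close>. Markov's inequality gives this event probability at most
  \<open>c^2 / \<tau>^2 * (1 / (a n * sqrt n))^2\<close>.\<close>

lemma deviation_in_prob:
  fixes W :: "nat \<Rightarrow> 'w \<Rightarrow> ereal" and a :: "nat \<Rightarrow> real"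
  assumes meas: "\<And>n. 1 \<le> n \<Longrightarrow> W n \<in> borel_measurable M"
    and a: "\<And>n. 1 \<le> n \<Longrightarrow> 0 < a n" "(\<lambda>n. 1 / (a n * real n powr (1 / 2))) \<longlonglongrightarrow> 0"
    and key: "controlled W a"
  shows "tendsto_zero_in_prob M W"
  unfolding tendsto_zero_in_prob_def
proof (intro conjI allI impI meas)
  fix s :: real assume "0 < s"
  with key obtain \<tau> where \<tau>: "0 < \<tau>" and ev: "\<forall>\<^sub>F n in sequentially. \<forall>x\<in>space M.
      devsq n x \<le> ennreal ((real n * (\<tau> * a n))\<^sup>2) \<longrightarrow> \<bar>W n x\<bar> \<le> ereal s" unfolding controlled_def by blast
  show "(\<lambda>n. measure M {x \<in> space M. ereal s < \<bar>W n x\<bar>}) \<longlonglongrightarrow> 0"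
  proof (rule tendsto_sandwich[OF _ _ tendsto_const])
    show "(\<lambda>n. c\<^sup>2 / \<tau>\<^sup>2 * (1 / (a n * real n powr (1 / 2)))\<^sup>2) \<longlonglongrightarrow> 0"
      using tendsto_mult_left[OF tendsto_power[OF a(2), of 2], of "c\<^sup>2 / \<tau>\<^sup>2"] by simp
    show "\<forall>\<^sub>F n in sequentially. measure M {x \<in> space M. ereal s < \<bar>W n x\<bar>}
        \<le> c\<^sup>2 / \<tau>\<^sup>2 * (1 / (a n * real n powr (1 / 2)))\<^sup>2"
      using ev eventually_ge_at_top[of 1]
    proof eventually_elim
      case (elim n)
      have "0 < (real n * (\<tau> * a n))\<^sup>2" using elim(2) \<tau> a(1)[OF elim(2)] by simp
      note Markov = devsq_Markov[OF this, of n]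
      have "measure M {x \<in> space M. ereal s < \<bar>W n x\<bar>}
          \<le> measure M {x\<in>space M. ennreal ((real n * (\<tau> * a n))\<^sup>2) < devsq n x}"
        using elim(1) by (intro finite_measure_mono) (auto simp: not_le[symmetric])
      also note Markov
      also have "real n * c\<^sup>2 / (real n * (\<tau> * a n))\<^sup>2 = c\<^sup>2 / \<tau>\<^sup>2 * (1 / (a n * real n powr (1 / 2)))\<^sup>2"
        using elim(2) by (simp add: power_mult_distrib power_divide powr_half_sqrt) (simp add: power2_eq_square)
      finally show ?case .
    qed
  qed auto
qed

text \<open>Almost surely the root of \<open>devsq n\<close> is eventually at most
  \<open>4 * ln n * sqrt n\<close>. The hypothesis on \<open>a\<close> puts this below
  \<open>n * \<tau> * a n\<close> once the ratio is below \<open>\<tau> / 4\<close>.\<close>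

lemma deviation_AE:
  fixes W :: "nat \<Rightarrow> 'w \<Rightarrow> ereal" and a :: "nat \<Rightarrow> real"
  assumes a: "\<And>n. 1 \<le> n \<Longrightarrow> 0 < a n" "(\<lambda>n. ln (real n) / (a n * real n powr (1 / 2))) \<longlonglongrightarrow> 0"
    and key: "controlled W a"
  shows "tendsto_zero_ae M W"
  unfolding tendsto_zero_ae_def
  using devsq_AE_le
proof (rule AE_mp, intro AE_I2 impI)
  fix x assume w: "x \<in> space M"
    and dev: "\<forall>\<^sub>F n in sequentially. devsq n x \<le> ennreal (16 * (real n * (ln (real n))\<^sup>2))"
  have small: "\<forall>\<^sub>F n in sequentially. \<bar>W n x\<bar> \<le> ereal s" if s: "0 < s" for s
  proof -
    from key s obtain \<tau> where \<tau>: "0 < \<tau>" and ev: "\<forall>\<^sub>F n in sequentially. \<forall>x\<in>space M.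
        devsq n x \<le> ennreal ((real n * (\<tau> * a n))\<^sup>2) \<longrightarrow> \<bar>W n x\<bar> \<le> ereal s" unfolding controlled_def by blast
    have "\<forall>\<^sub>F n in sequentially. ln (real n) / (a n * real n powr (1 / 2)) < \<tau> / 4"
      using \<tau> by (intro order_tendstoD(2)[OF a(2)]) simp
    with ev dev eventually_ge_at_top[of 1] show ?thesis
    proof eventually_elim
      case (elim n)
      have n: "0 < sqrt (real n)" "real n = (sqrt (real n))\<^sup>2" using elim(3) by auto
      have "ln (real n) \<le> \<tau> / 4 * (a n * sqrt (real n))"
        using elim(4) a(1)[OF elim(3)] n(1) by (simp add: powr_half_sqrt pos_divide_less_eq)
      then have "4 * ln (real n) * sqrt (real n) \<le> \<tau> * (a n * sqrt (real n)) * sqrt (real n)"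
        using n(1) by (intro mult_right_mono) auto
      also have "\<dots> = real n * (\<tau> * a n)"
        using n(2) by (simp add: power2_eq_square)
      finally have "(4 * ln (real n) * sqrt (real n))\<^sup>2 \<le> (real n * (\<tau> * a n))\<^sup>2"
        using elim(3) n(1) by (intro power_mono) auto
      moreover have "(4 * ln (real n) * sqrt (real n))\<^sup>2 = 16 * (real n * (ln (real n))\<^sup>2)"
        by (simp add: power_mult_distrib)
      ultimately have "ennreal (16 * (real n * (ln (real n))\<^sup>2)) \<le> ennreal ((real n * (\<tau> * a n))\<^sup>2)"
        by (simp add: ennreal_leI)
      with elim(2) have "devsq n x \<le> ennreal ((real n * (\<tau> * a n))\<^sup>2)" by (rule order_trans)
      then show ?case using elim(1) w by blast
    qed
  qed
  show "(\<lambda>n. W n x) \<longlonglongrightarrow> 0"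
  proof (rule order_tendstoI)
    fix y :: ereal assume "0 < y"
    then obtain s where s: "0 < ereal s" "ereal s < y" using ereal_dense2 by blast
    then have "0 < s" by simp
    from small[OF this] show "\<forall>\<^sub>F n in sequentially. W n x < y"
    proof eventually_elim
      case (elim n)
      then have "W n x \<le> ereal s" by (cases "W n x") auto
      then show ?case using s(2) by (rule le_less_trans)
    qed
  next
    fix y :: ereal assume "y < 0"
    then obtain s where s: "y < ereal s" "ereal s < 0" using ereal_dense2 by blast
    then have "0 < - s" by simp
    from small[OF this] show "\<forall>\<^sub>F n in sequentially. y < W n x"
    proof eventually_elim
      case (elim n)
      then have "ereal s \<le> W n x" by (cases "W n x") auto
      with s(1) show ?case by (rule less_le_trans)
    qed
  qed
qed

end

section \<open>Measurability of the error norms\<close>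

context learning
begin

text \<open>\<open>A (U \<omega>) x\<close> is jointly measurable, being a countable sum of products
  of coordinates of \<open>U \<omega>\<close> with \<open>\<phi> k x\<close>; integrating out
  \<open>x\<close> keeps measurability in \<open>\<omega>\<close>.\<close>

lemma measurable_L2_norm_A:
  assumes U: "U \<in> M \<rightarrow>\<^sub>M ell2_borel K" and f: "f \<in> L2_space PX"
  shows "(\<lambda>\<omega>. L2_norm PX (\<lambda>x. A (U \<omega>) x - f x)) \<in> borel_measurable M"
proof -
  interpret PX: prob_space PX by (rule prob_PX)
  note [measurable] = L2_spaceD(1)[OF f]
  have U2: "U \<omega> \<in> ell 2 K" if "\<omega> \<in> space M" for \<omega>
    using measurable_space[OF U that] by (simp add: space_ell2_borel)
  have Uk[measurable]: "(\<lambda>\<omega>. U \<omega> k) \<in> borel_measurable M" for k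
    by (rule measurable_compose[OF U measurable_ell2_coord])
  have eq: "L2_norm PX (\<lambda>x. A (U \<omega>) x - f x) = ereal (sqrt (\<integral>x. (A (U \<omega>) x - f x)\<^sup>2 \<partial>PX))"
    if "\<omega> \<in> space M" for \<omega>
    using L2_diff[OF A_L2[OF U2[OF that]] f] by (simp add: L2_norm_def)
  have [measurable]: "\<phi> k \<in> borel_measurable MX" if "k \<in> K" for k using phi[OF that] .
  have [measurable]: "(\<lambda>z. A (U (fst z)) (snd z)) \<in> borel_measurable (M \<Otimes>\<^sub>M PX)"
    unfolding synthesis_def
  proof (rule borel_measurable_infsum[OF K])
    show "(\<lambda>z. U (fst z) k * \<phi> k (snd z)) \<in> borel_measurable (M \<Otimes>\<^sub>M PX)" if "k \<in> K" for k
      using that by measurable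
    show "(\<lambda>k. U (fst z) k * \<phi> k (snd z)) summable_on K" if "z \<in> space (M \<Otimes>\<^sub>M PX)" for z
      using that by (intro A_summable U2) (auto simp: space_pair_measure)
  qed
  have "(\<lambda>\<omega>. \<integral>x. (A (U \<omega>) x - f x)\<^sup>2 \<partial>PX) \<in> borel_measurable M"
    by (rule PX.borel_measurable_lebesgue_integral) (simp add: case_prod_unfold)
  then have "(\<lambda>\<omega>. ereal (sqrt (\<integral>x. (A (U \<omega>) x - f x)\<^sup>2 \<partial>PX))) \<in> borel_measurable M"
    by measurable
  then show ?thesis by (subst measurable_cong[OF eq])
qed

lemma ell_norm_pdist:
  assumes "u \<in> domG" "v \<in> domG"
  shows "ell_norm r K (\<lambda>k. u k - v k) = ereal (pdist u v powr (1 / r))"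
  using pdist_summable[OF assms] by (simp add: ell_norm_def pdist_def)

lemma measurable_ell_norm:
  assumes U: "U \<in> M \<rightarrow>\<^sub>M ell2_borel K" "\<And>\<omega>. \<omega> \<in> space M \<Longrightarrow> U \<omega> \<in> domG" and v: "v \<in> domG"
  shows "(\<lambda>\<omega>. ell_norm r K (\<lambda>k. U \<omega> k - v k)) \<in> borel_measurable M"
proof -
  have [measurable]: "(\<lambda>\<omega>. U \<omega> k) \<in> borel_measurable M" for k
    by (rule measurable_compose[OF U(1) measurable_ell2_coord])
  have "(\<lambda>\<omega>. pdist (U \<omega>) v) \<in> borel_measurable M"
    unfolding pdist_def by (intro borel_measurable_infsum K pdist_summable U(2) v) auto
  then have "(\<lambda>\<omega>. ereal (pdist (U \<omega>) v powr (1 / r))) \<in> borel_measurable M" by measurable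
  then show ?thesis by (subst measurable_cong[OF ell_norm_pdist[OF U(2) v]])
qed

text \<open>Attainment of \<open>fC\<close> is an almost everywhere statement, while
  \<open>risk\<close> is evaluated at a representative.\<close>

lemma risk_cong_AE:
  assumes "f \<in> L2_space PX" "g \<in> L2_space PX" and ae: "AE x in PX. f x = g x"
  shows "risk P f = risk P g"
proof -
  note [measurable] = L2_spaceD(1)[OF assms(1)] L2_spaceD(1)[OF assms(2)]
  have "AE z in P. f (fst z) = g (fst z)" by (rule AE_distrD[OF _ ae]) simp
  then show ?thesis unfolding risk_eq by (intro integral_cong_AE) auto
qed

end

theorem theorem2p4:
  fixes MX :: "'x measure" and Y :: "real set" and P :: "('x \<times> real) measure"
    and PX :: "'x measure"
    and K :: "'k set" and \<phi> :: "'k \<Rightarrow> 'x \<Rightarrow> real" and \<kappa> :: real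
    and r \<eta> :: real
    and C D :: "'k \<Rightarrow> real set" and h :: "'k \<Rightarrow> real \<Rightarrow> ereal"
    and A :: "('k \<Rightarrow> real) \<Rightarrow> 'x \<Rightarrow> real" and F :: "('k \<Rightarrow> real) \<Rightarrow> real"
    and G :: "('k \<Rightarrow> real) \<Rightarrow> ereal" and domG :: "('k \<Rightarrow> real) set"
    and CC :: "('x \<Rightarrow> real) set" and fC :: "'x \<Rightarrow> real"
    and M :: "'w measure" and Xs :: "nat \<Rightarrow> 'w \<Rightarrow> 'x" and Ys :: "nat \<Rightarrow> 'w \<Rightarrow> real"
    and Z :: "nat \<Rightarrow> 'w \<Rightarrow> nat \<Rightarrow> 'x \<times> real"
    and \<epsilon> :: "real \<Rightarrow> real"
    and uhat :: "nat \<Rightarrow> real \<Rightarrow> (nat \<Rightarrow> 'x \<times> real) \<Rightarrow> 'k \<Rightarrow> real"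
    and lam :: "nat \<Rightarrow> real"
    and fhat :: "nat \<Rightarrow> 'w \<Rightarrow> 'x \<Rightarrow> real"
    and S :: "('k \<Rightarrow> real) set"
  assumes Y: "Y \<noteq> {}" "is_interval Y" "bounded Y"
    and P: "prob_space P" "sets P = sets (MX \<Otimes>\<^sub>M restrict_space borel Y)"
  defines "PX \<equiv> distr P MX fst"
  assumes K: "countable K"
    and phi: "\<And>k. k \<in> K \<Longrightarrow> \<phi> k \<in> borel_measurable MX"
    and kappa: "\<kappa> > 0"
      "\<And>x. x \<in> space MX \<Longrightarrow>
         (\<lambda>k. \<bar>\<phi> k x\<bar>\<^sup>2) summable_on K \<and> (\<Sum>\<^sub>\<infinity>k\<in>K. \<bar>\<phi> k x\<bar>\<^sup>2) \<le> \<kappa>\<^sup>2"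
    and r: "1 < r" "r \<le> 2"
    and eta: "\<eta> > 0"
    and C: "\<And>k. k \<in> K \<Longrightarrow> closed (C k) \<and> is_interval (C k) \<and> 0 \<in> C k"
    and D: "\<And>k. k \<in> K \<Longrightarrow> D k \<noteq> {} \<and> closed (D k) \<and> bounded (D k) \<and> is_interval (D k)"
      "(\<lambda>k. \<bar>max (Inf (D k)) 0\<bar> powr (r / (r - 1))) summable_on K"
      "(\<lambda>k. \<bar>max (- Sup (D k)) 0\<bar> powr (r / (r - 1))) summable_on K"
    and h: "\<And>k. k \<in> K \<Longrightarrow> h k \<in> Gamma0_plus \<and> h k 0 = 0 \<and>
      (\<lambda>t. h k t - ereal (\<eta> * \<bar>t\<bar> powr r)) \<in> Gamma0_plus"
  defines "A \<equiv> synthesis K \<phi>"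
    and "F \<equiv> (\<lambda>u. risk P (A u))"
    and "G \<equiv> penalty K C D h"
    and "domG \<equiv> penalty_dom K C D h"
    and "CC \<equiv> L2_closure PX (A ` {u \<in> ell 2 K. \<forall>k\<in>K. u k \<in> C k})"
  assumes fC: "unique_minimizer_ae PX CC (risk P) fC"
    and M: "prob_space M"
    and iid: "prob_space.indep_vars M (\<lambda>_. P) (\<lambda>i \<omega>. (Xs i \<omega>, Ys i \<omega>)) UNIV"
      "\<And>i. distr M P (\<lambda>\<omega>. (Xs i \<omega>, Ys i \<omega>)) = P"
  defines "Z \<equiv> (\<lambda>n \<omega>. \<lambda>i\<in>{1..n}. (Xs i \<omega>, Ys i \<omega>))"
  assumes eps: "\<And>l. l > 0 \<Longrightarrow> 0 \<le> \<epsilon> l \<and> \<epsilon> l \<le> 1" "(\<epsilon> \<longlongrightarrow> 0) (at_right 0)"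
    and uhat: "\<And>n l z. n \<ge> 1 \<Longrightarrow> l > 0 \<Longrightarrow> z \<in> {1..n} \<rightarrow>\<^sub>E space MX \<times> Y \<Longrightarrow>
        uhat n l z \<in> Argmin_eps (\<epsilon> l) (ell 2 K)
          (\<lambda>u. ereal (empirical_risk n z (A u)) + ereal l * G u)"
      "\<And>n l. n \<ge> 1 \<Longrightarrow> l > 0 \<Longrightarrow> (\<lambda>\<omega>. uhat n l (Z n \<omega>)) \<in> M \<rightarrow>\<^sub>M ell2_borel K"
    and lam: "\<And>n. n \<ge> 1 \<Longrightarrow> lam n > 0" "lam \<longlonglongrightarrow> 0"
  defines "fhat \<equiv> (\<lambda>n \<omega>. A (uhat n (lam n) (Z n \<omega>)))"
    and "S \<equiv> Argmin domG F"
  shows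
    "((\<forall>k\<in>K. C k \<subseteq> closure {t. h k t < \<infinity>}) \<longrightarrow>
      (\<lambda>n. \<epsilon> (lam n) / lam n powr (4 / r)) \<longlonglongrightarrow> 0 \<longrightarrow>
      (\<lambda>n. 1 / (lam n powr (2 / r) * real n powr (1 / 2))) \<longlonglongrightarrow> 0 \<longrightarrow>
      tendsto_zero_in_prob M (\<lambda>n \<omega>. L2_norm PX (\<lambda>x. fhat n \<omega> x - fC x)))
     \<and>
     ((\<forall>k\<in>K. C k \<subseteq> closure {t. h k t < \<infinity>}) \<longrightarrow>
      (\<lambda>n. \<epsilon> (lam n)) \<in> O(\<lambda>n. 1 / real n) \<longrightarrow>
      (\<lambda>n. ln (real n) / (lam n powr (2 / r) * real n powr (1 / 2))) \<longlonglongrightarrow> 0 \<longrightarrow>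
      tendsto_zero_ae M (\<lambda>n \<omega>. L2_norm PX (\<lambda>x. fhat n \<omega> x - fC x)))
     \<and>
     ((\<exists>u\<in>domG. AE x in PX. A u x = fC x) \<longrightarrow>
      (\<exists>!u. u \<in> Argmin S G) \<and>
      (\<forall>udag\<in>Argmin S G.
        (AE x in PX. A udag x = fC x) \<and>
        ((\<lambda>n. \<epsilon> (lam n) / (lam n)\<^sup>2) \<longlonglongrightarrow> 0 \<longrightarrow>
         (\<lambda>n. 1 / (lam n * real n powr (1 / 2))) \<longlonglongrightarrow> 0 \<longrightarrow>
         tendsto_zero_in_prob M
           (\<lambda>n \<omega>. ell_norm r K (\<lambda>k. uhat n (lam n) (Z n \<omega>) k - udag k))) \<and>
        ((\<lambda>n. \<epsilon> (lam n)) \<in> O(\<lambda>n. 1 / real n) \<longrightarrow>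
         (\<lambda>n. ln (real n) / (lam n * real n powr (1 / 2))) \<longlonglongrightarrow> 0 \<longrightarrow>
         tendsto_zero_ae M
           (\<lambda>n \<omega>. ell_norm r K (\<lambda>k. uhat n (lam n) (Z n \<omega>) k - udag k)))))"
proof -
  obtain b0 where b0: "\<And>y. y \<in> Y \<Longrightarrow> \<bar>y\<bar> \<le> b0"
    using Y(3) by (auto simp: bounded_iff)
  define b where "b = max b0 0"
  interpret prob_space M by (rule M)
  interpret L: learning_sample K r \<eta> C D h MX Y P \<phi> \<kappa> b M "\<lambda>i \<omega>. (Xs i \<omega>, Ys i \<omega>)"
  proof (intro learning_sample.intro learning.intro composite_penalty.intro learning_axioms.intro
      iid_sample.intro iid_sample_axioms.intro)
    show "\<bar>y\<bar> \<le> b" if "y \<in> Y" for y using b0[OF that] by (simp add: b_def)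
    show "0 \<le> b" by (simp add: b_def)
  qed (fact P K phi kappa r eta C D h M iid)+
  have F: "F = L.F" unfolding F_def L.F_def[abs_def] A_def ..
  have domG: "domG = L.domG" unfolding domG_def by (rule L.penalty_dom_eq)
  have CC: "CC = L.CC" unfolding CC_def L.CC_def A_def PX_def ..
  have G: "G u = ereal (L.Gr u)" if "u \<in> L.domG" for u
    using L.penalty_eq[of u] that by (auto simp: G_def L.domG_def)
  have fC': "fC \<in> L.CC" "\<And>f. f \<in> L.CC \<Longrightarrow> risk P fC \<le> risk P f"
    and fC_unique: "\<And>f. f \<in> L.CC \<Longrightarrow> risk P f \<le> risk P fC \<Longrightarrow> AE x in PX. f x = fC x"
    using fC unfolding unique_minimizer_ae_def Argmin_def is_arg_min_def CC
    by (auto simp: not_less) (meson order_trans)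
  define U where "U n \<omega> = uhat n (lam n) (Z n \<omega>)" for n \<omega>
  have Z: "Z n \<omega> \<in> {1..n} \<rightarrow>\<^sub>E space MX \<times> Y" if "\<omega> \<in> space M" for n \<omega>
    using L.X_space[OF that] by (auto simp: Z_def L.space_P)
  have est: "L.est n (lam n) (\<epsilon> (lam n)) \<omega> (U n \<omega>)" if n: "1 \<le> n" and w: "\<omega> \<in> space M" for n \<omega>
    using uhat(1)[OF n lam(1)[OF n] Z[OF w]]
    unfolding U_def Z_def A_def G_def by (rule L.Argmin_eps_est[OF _ lam(1)[OF n]])
  have UM: "U n \<in> M \<rightarrow>\<^sub>M ell2_borel K" if "1 \<le> n" for n
    unfolding U_def[abs_def] by (rule uhat(2)[OF that lam(1)[OF that]])
  have UG: "U n \<omega> \<in> L.domG" if "1 \<le> n" "\<omega> \<in> space M" for n \<omega>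
    using est[OF that] by (simp add: L.est_def)
  have fhat: "fhat n \<omega> = synthesis K \<phi> (U n \<omega>)" for n \<omega>
    by (simp add: fhat_def A_def U_def)
  have "filterlim lam (at_right 0) sequentially"
    unfolding filterlim_at
  proof
    show "\<forall>\<^sub>F n in sequentially. lam n \<in> {0<..} \<and> lam n \<noteq> 0"
      using eventually_ge_at_top[of 1] by eventually_elim (use lam(1) in force)
  qed (rule lam(2))
  then have eps_lim: "(\<lambda>n. \<epsilon> (lam n)) \<longlonglongrightarrow> 0"
    by (rule filterlim_compose[OF eps(2)])
  have ev: "\<forall>\<^sub>F n in sequentially. 1 \<le> n \<and> lam n < \<tau> \<and> \<epsilon> (lam n) < \<tau>" if "0 < \<tau>" for \<tau>
    using order_tendstoD(2)[OF lam(2) that] order_tendstoD(2)[OF eps_lim that] eventually_ge_at_top[of 1]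
    by eventually_elim auto

  let ?W = "\<lambda>n \<omega>. L2_norm PX (\<lambda>x. fhat n \<omega> x - fC x)"
  have W_meas: "?W n \<in> borel_measurable M" if "1 \<le> n" for n
    unfolding fhat PX_def by (rule L.measurable_L2_norm_A[OF UM[OF that] L.CC_L2[OF fC'(1)]])
  have W_key: "L.controlled ?W (\<lambda>n. lam n powr (2 / r))"
    if dense: "\<forall>k\<in>K. C k \<subseteq> closure {t. h k t < \<infinity>}"
    unfolding L.controlled_def
  proof (intro allI impI)
    fix s :: real assume s: "0 < s"
    then have "0 < s\<^sup>2" by simp
    \<comment> \<open>\<open>risk_consistency\<close> bounds the squared norm, so it is invoked with
      the square of \<open>s\<close>.\<close>
    obtain \<tau> where \<tau>: "0 < \<tau>"
      "\<And>n l e \<omega> u. 1 \<le> n \<Longrightarrow> 0 < l \<Longrightarrow> l < \<tau> \<Longrightarrow> e < \<tau> \<Longrightarrow> \<omega> \<in> space M \<Longrightarrow> L.est n l e \<omega> u \<Longrightarrow>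
       L.devsq n \<omega> \<le> ennreal ((real n * (\<tau> * l powr (2 / r)))\<^sup>2) \<Longrightarrow>
       (\<integral>x. (L.A u x - fC x)\<^sup>2 \<partial>L.PX) \<le> s\<^sup>2"
      by (rule L.risk_consistency[OF fC' _ \<open>0 < s\<^sup>2\<close>]) (use dense in blast)+
    have "\<forall>\<^sub>F n in sequentially. \<forall>\<omega>\<in>space M.
        L.devsq n \<omega> \<le> ennreal ((real n * (\<tau> * lam n powr (2 / r)))\<^sup>2) \<longrightarrow> \<bar>?W n \<omega>\<bar> \<le> ereal s"
      using ev[OF \<tau>(1)]
    proof (eventually_elim, intro ballI impI)
      fix n \<omega> assume n: "1 \<le> n \<and> lam n < \<tau> \<and> \<epsilon> (lam n) < \<tau>" and w: "\<omega> \<in> space M"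
        and d: "L.devsq n \<omega> \<le> ennreal ((real n * (\<tau> * lam n powr (2 / r)))\<^sup>2)"
      have n1: "1 \<le> n" using n by blast
      have "(\<integral>x. (L.A (U n \<omega>) x - fC x)\<^sup>2 \<partial>L.PX) \<le> s\<^sup>2"
        using n by (intro \<tau>(2)[OF n1 lam(1)[OF n1] _ _ w est[OF n1 w] d]) auto
      then have "sqrt (\<integral>x. (L.A (U n \<omega>) x - fC x)\<^sup>2 \<partial>L.PX) \<le> s"
        using s by (intro real_le_lsqrt) auto
      then show "\<bar>?W n \<omega>\<bar> \<le> ereal s"
        using L.L2_diff[OF L.A_L2[OF L.domG_ell_2[OF UG[OF n1 w]]] L.CC_L2[OF fC'(1)]]
        by (simp add: L2_norm_def fhat PX_def)
    qed
    with \<tau>(1) show "\<exists>\<tau>>0. \<forall>\<^sub>F n in sequentially. \<forall>\<omega>\<in>space M.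
        L.devsq n \<omega> \<le> ennreal ((real n * (\<tau> * lam n powr (2 / r)))\<^sup>2) \<longrightarrow> \<bar>?W n \<omega>\<bar> \<le> ereal s"
      by blast
  qed
  have lam_r: "0 < lam n powr (2 / r)" if "1 \<le> n" for n
    using lam(1)[OF that] by simp

  show ?thesis
  proof (intro conjI impI ballI)
    assume dense: "\<forall>k\<in>K. C k \<subseteq> closure {t. h k t < \<infinity>}"
    show "tendsto_zero_in_prob M ?W"
      if "(\<lambda>n. 1 / (lam n powr (2 / r) * real n powr (1 / 2))) \<longlonglongrightarrow> 0"
      by (rule L.deviation_in_prob[OF W_meas lam_r that W_key[OF dense]])
    show "tendsto_zero_ae M ?W"
      if "(\<lambda>n. ln (real n) / (lam n powr (2 / r) * real n powr (1 / 2))) \<longlonglongrightarrow> 0"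
      by (rule L.deviation_AE[OF lam_r that W_key[OF dense]])
  next
    assume attained: "\<exists>u\<in>domG. AE x in PX. A u x = fC x"
    obtain u0 where u0: "u0 \<in> L.domG" "AE x in distr P MX fst. synthesis K \<phi> u0 x = fC x"
      using attained unfolding domG A_def PX_def by blast
    \<comment> \<open>Attainment makes the minimum of \<open>F\<close> over the domain equal to the
      minimal risk over \<open>CC\<close>, the common value required by
      \<open>selected_minimizer\<close>.\<close>
    have Fu0: "L.F u0 = risk P fC"
      unfolding L.F_def by (rule L.risk_cong_AE[OF L.A_L2[OF L.domG_ell_2[OF u0(1)]] L.CC_L2[OF fC'(1)] u0(2)])
    have F_ge: "risk P fC \<le> L.F u" if "u \<in> L.domG" for u
      unfolding L.F_def by (intro fC'(2) L.A_domG_CC that)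
    have F_mid: "L.F (\<lambda>k. (u k + v k) / 2) \<le> max (L.F u) (L.F v)" if "u \<in> L.domG" "v \<in> L.domG" for u v
      using L.F_midpoint[OF L.domG_ell_2[OF that(1)] L.domG_ell_2[OF that(2)]]
      by (auto simp: max_def)
    obtain w where w: "w \<in> L.domG" "L.F w = risk P fC"
      and w_min: "\<And>v. v \<in> L.domG \<Longrightarrow> L.F v = risk P fC \<Longrightarrow> L.Gr w \<le> L.Gr v"
      and w_uniq: "\<And>v. v \<in> L.domG \<Longrightarrow> L.F v = risk P fC \<Longrightarrow> L.Gr v \<le> L.Gr w \<Longrightarrow> v = w"
      and stab: "\<And>e. 0 < e \<Longrightarrow> \<exists>\<gamma>>0. \<forall>u\<in>L.domG. L.F u \<le> risk P fC + \<gamma> \<longrightarrow> L.Gr u \<le> L.Gr w + \<gamma> \<longrightarrow> L.pdist u w < e"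
      by (rule L.selected_minimizer[OF F_mid L.F_pdist_continuous F_ge u0(1) Fu0]) blast+
    have S: "S = {u \<in> L.domG. L.F u = risk P fC}"
      unfolding S_def Argmin_def is_arg_min_def F domG
      using F_ge Fu0 u0(1) by (auto simp: not_less) (metis order_antisym)
    have argmin: "u \<in> Argmin S G \<longleftrightarrow> u = w" for u
    proof -
      have "u \<in> Argmin S G \<longleftrightarrow> u \<in> S \<and> (\<forall>v\<in>S. L.Gr u \<le> L.Gr v)"
        unfolding Argmin_def is_arg_min_def S using G by (auto simp: not_less)
      also have "\<dots> \<longleftrightarrow> u = w"
        unfolding S using w w_min w_uniq by auto
      finally show ?thesis .
    qed
    let ?V = "\<lambda>n \<omega>. ell_norm r K (\<lambda>k. uhat n (lam n) (Z n \<omega>) k - w k)"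
    have V: "?V n \<omega> = ereal (L.pdist (U n \<omega>) w powr (1 / r))" if "1 \<le> n" "\<omega> \<in> space M" for n \<omega>
      using L.ell_norm_pdist[OF UG[OF that] w(1)] by (simp add: U_def)
    have V_meas: "?V n \<in> borel_measurable M" if "1 \<le> n" for n
      using L.measurable_ell_norm[OF UM[OF that] UG[OF that] w(1)] by (simp add: U_def)
    \<comment> \<open>Both rate conditions on the tolerance in (iii) enter through their common
      consequence that the tolerance is small against \<open>lam n\<close>.\<close>
    have V_key: "L.controlled ?V lam" if ratio: "(\<lambda>n. \<epsilon> (lam n) / lam n) \<longlonglongrightarrow> 0"
      unfolding L.controlled_def
    proof (intro allI impI)
      fix s :: real assume s: "0 < s"
      have "0 < s powr r" using s by simp
      have stab': "\<exists>\<gamma>>0. \<forall>u\<in>L.domG. L.F u \<le> L.F w + \<gamma> \<longrightarrow> L.Gr u \<le> L.Gr w + \<gamma> \<longrightarrow> L.pdist u w < e" if "0 < e" for e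
        using stab[OF that] w(2) by simp
      have F_ge': "L.F w \<le> L.F u" if "u \<in> L.domG" for u using F_ge[OF that] w(2) by simp
      obtain \<tau> where \<tau>: "0 < \<tau>"
        "\<And>n l e \<omega> u. 1 \<le> n \<Longrightarrow> 0 < l \<Longrightarrow> l < \<tau> \<Longrightarrow> 0 \<le> e \<Longrightarrow> e \<le> \<tau> * l \<Longrightarrow> \<omega> \<in> space M \<Longrightarrow> L.est n l e \<omega> u \<Longrightarrow>
         L.devsq n \<omega> \<le> ennreal ((real n * (\<tau> * l))\<^sup>2) \<Longrightarrow> L.pdist u w < s powr r"
        by (rule L.selection_consistency[OF w(1) F_ge' stab' \<open>0 < s powr r\<close>]) blast+
      have "\<forall>\<^sub>F n in sequentially. 1 \<le> n \<and> lam n < \<tau> \<and> \<epsilon> (lam n) / lam n < \<tau>"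
        using ev[OF \<tau>(1)] order_tendstoD(2)[OF ratio \<tau>(1)] by eventually_elim auto
      then have "\<forall>\<^sub>F n in sequentially. \<forall>\<omega>\<in>space M.
          L.devsq n \<omega> \<le> ennreal ((real n * (\<tau> * lam n))\<^sup>2) \<longrightarrow> \<bar>?V n \<omega>\<bar> \<le> ereal s"
      proof (eventually_elim, intro ballI impI)
        fix n \<omega> assume n: "1 \<le> n \<and> lam n < \<tau> \<and> \<epsilon> (lam n) / lam n < \<tau>" and w: "\<omega> \<in> space M"
          and d: "L.devsq n \<omega> \<le> ennreal ((real n * (\<tau> * lam n))\<^sup>2)"
        have n1: "1 \<le> n" "lam n < \<tau>" using n by auto
        have "\<epsilon> (lam n) \<le> \<tau> * lam n"
          using n lam(1)[OF n1(1)] by (simp add: pos_divide_less_eq)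
        then have "L.pdist (U n \<omega>) w < s powr r"
          using eps(1)[OF lam(1)[OF n1(1)]]
          by (intro \<tau>(2)[OF n1(1) lam(1)[OF n1(1)] n1(2) _ _ w est[OF n1(1) w] d]) auto
        then have "L.pdist (U n \<omega>) w powr (1 / r) \<le> (s powr r) powr (1 / r)"
          using r L.pdist_nonneg by (intro powr_mono2) auto
        also have "\<dots> = s" using r s by (simp add: powr_powr)
        finally show "\<bar>?V n \<omega>\<bar> \<le> ereal s" by (simp add: V[OF n1(1) w])
      qed
      with \<tau>(1) show "\<exists>\<tau>>0. \<forall>\<^sub>F n in sequentially. \<forall>\<omega>\<in>space M.
          L.devsq n \<omega> \<le> ennreal ((real n * (\<tau> * lam n))\<^sup>2) \<longrightarrow> \<bar>?V n \<omega>\<bar> \<le> ereal s" by blast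
    qed
    show "\<exists>!u. u \<in> Argmin S G" using argmin by simp
    fix udag assume "udag \<in> Argmin S G"
    then have [simp]: "udag = w" using argmin by simp
    show "AE x in PX. A udag x = fC x"
      unfolding A_def using w by (auto intro!: fC_unique L.A_domG_CC simp: L.F_def)
    show "tendsto_zero_in_prob M (\<lambda>n \<omega>. ell_norm r K (\<lambda>k. uhat n (lam n) (Z n \<omega>) k - udag k))"
      if e: "(\<lambda>n. \<epsilon> (lam n) / (lam n)\<^sup>2) \<longlonglongrightarrow> 0" and l: "(\<lambda>n. 1 / (lam n * real n powr (1 / 2))) \<longlonglongrightarrow> 0"
    proof -
      have "(\<lambda>n. \<epsilon> (lam n) / (lam n)\<^sup>2 * lam n) \<longlonglongrightarrow> 0 * 0"
        by (intro tendsto_mult e lam(2))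
      moreover have "\<epsilon> (lam n) / (lam n)\<^sup>2 * lam n = \<epsilon> (lam n) / lam n" for n
        by (simp add: power2_eq_square)
      ultimately have "(\<lambda>n. \<epsilon> (lam n) / lam n) \<longlonglongrightarrow> 0" by simp
      then show ?thesis using L.deviation_in_prob[OF V_meas lam(1) l] V_key by simp
    qed
    show "tendsto_zero_ae M (\<lambda>n \<omega>. ell_norm r K (\<lambda>k. uhat n (lam n) (Z n \<omega>) k - udag k))"
      if e: "(\<lambda>n. \<epsilon> (lam n)) \<in> O(\<lambda>n. 1 / real n)" and l: "(\<lambda>n. ln (real n) / (lam n * real n powr (1 / 2))) \<longlonglongrightarrow> 0"
    proof -
      obtain c where c: "\<forall>\<^sub>F n in sequentially. norm (\<epsilon> (lam n)) \<le> c * norm (1 / real n)"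
        using e by (elim landau_o.bigE)
      \<comment> \<open>The ratio is at most \<open>|c| / (n * lam n)\<close>, and
        \<open>1 / n \<le> ln n / sqrt n\<close> compares it with the sequence assumed to
        vanish.\<close>
      have "(\<lambda>n. \<epsilon> (lam n) / lam n) \<longlonglongrightarrow> 0"
      proof (rule tendsto_sandwich[OF _ _ tendsto_const])
        show "(\<lambda>n. \<bar>c\<bar> * (ln (real n) / (lam n * real n powr (1 / 2)))) \<longlonglongrightarrow> 0"
          using tendsto_mult_left[OF l, of "\<bar>c\<bar>"] by simp
        show "\<forall>\<^sub>F n in sequentially. 0 \<le> \<epsilon> (lam n) / lam n"
          using eventually_ge_at_top[of 1] by eventually_elim (use eps(1) lam(1) in \<open>simp add: less_imp_le\<close>)
        show "\<forall>\<^sub>F n in sequentially. \<epsilon> (lam n) / lam n \<le> \<bar>c\<bar> * (ln (real n) / (lam n * real n powr (1 / 2)))"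
          \<comment> \<open>From \<open>3\<close> on, \<open>ln n \<ge> 1\<close>, because
            \<open>exp 1 \<le> 3\<close>.\<close>
          using c eventually_ge_at_top[of 3]
        proof eventually_elim
          case (elim n)
          have n: "1 \<le> n" "0 < lam n" using elim(2) lam(1)[of n] by auto
          have "exp 1 \<le> real n" using elim(2) exp_le by simp
          then have ln1: "1 \<le> ln (real n)" using n(1) by (subst ln_ge_iff) auto
          have sq: "1 \<le> sqrt (real n)" "real n = sqrt (real n) * sqrt (real n)" using n by auto
          have "\<epsilon> (lam n) \<le> norm (\<epsilon> (lam n))" by simp
          also have "\<dots> \<le> c * (1 / real n)" using elim(1) by simp
          also have "\<dots> \<le> \<bar>c\<bar> * (1 / real n)" by (intro mult_right_mono) auto
          finally have "\<epsilon> (lam n) \<le> \<bar>c\<bar> * (1 / real n)" .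
          also have "1 / real n \<le> ln (real n) / sqrt (real n)"
          proof -
            have "sqrt (real n) * 1 \<le> sqrt (real n) * sqrt (real n)" using sq(1) by (intro mult_left_mono) auto
            then have "1 * sqrt (real n) \<le> ln (real n) * real n"
              using sq ln1 n by (intro mult_mono) auto
            then show ?thesis using sq(1) n by (simp add: divide_le_eq le_divide_eq field_simps)
          qed
          finally have "\<epsilon> (lam n) \<le> \<bar>c\<bar> * (ln (real n) / sqrt (real n))" by (simp add: mult_left_mono)
          then have "\<epsilon> (lam n) / lam n \<le> \<bar>c\<bar> * (ln (real n) / sqrt (real n)) / lam n"
            using n by (intro divide_right_mono) auto
          then show ?case by (simp add: powr_half_sqrt mult.commute)
        qed
      qed
      then show ?thesis using L.deviation_AE[OF lam(1) l] V_key by simp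
    qed
  qed
qed

end
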